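(* The set of points at which arc-length parametrized sub-Riemannian geodesics of $(N,\mathcal N,g)$ that start at the origin and are contained in $C_{\mathfrak n}$ lose their optimality is the vertical set $\{(0,0,y)\in C_{\mathfrak n}: y\in\mathbb R^3,\ y\neq 0\}$. These points are Maxwell points. Moreover, for the geodesic in $C_{\mathfrak n}$ defined by parameters $(C_1,C_2)\neq(0,0)$ (and a unit vector $k\in\mathbb R^3$), namely $$x(t)=C_1(\cos(Kt)-1)+C_2\sin(Kt),\quad \ell(t)=\big(C_1\sin(Kt)+C_2(1-\cos(Kt))\big)k,\quad y(t)=\tfrac12(C_1^2+C_2^2)(Kt-\sin(Kt))\,k,$$ with $K>0$ determined by $K^2(C_1^2+C_2^2)=1$, the cut time is $$t_{cut}=2\pi\sqrt{C_1^2+C_2^2}.$$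
   Context: Let $N=\mathbb R\times\mathbb R^3\times\mathbb R^3$ with coordinates $(x,\ell,y)$, $\ell=(\ell_1,\ell_2,\ell_3)^t$, $y=(y_1,y_2,y_3)^t$, be the Carnot group with product $(x,\ell,y)\cdot(\tilde x,\tilde\ell,\tilde y)=(x+\tilde x,\ \ell+\tilde\ell,\ y+\tilde y+\tfrac12(x\tilde\ell-\tilde x\ell))$ and origin $o=(0,0,0)$. Consider the left-invariant vector fields $$N_0=\partial_x-\tfrac12\sum_{i=1}^3\ell_i\,\partial_{y_i},\qquad N_i=\partial_{\ell_i}+\tfrac{x}{2}\,\partial_{y_i},\quad i=1,2,3.$$ Let $\mathcal N=\langle N_0,N_1,N_2,N_3\rangle$ and let $g$ be the sub-Riemannian metric on $\mathcal N$ for which $N_0,\dots,N_3$ are orthonormal. Geodesics are admissible curves (tangent to $\mathcal N$) parametrized by constant speed whose sufficiently small arcs are length minimizers; arc-length geodesics have unit speed, and geodesics are considered on $[0,\infty)$. $C_{\mathfrak n}=\{(x,\ell,y)\in\mathbb R\times\mathbb R^3\times\mathbb R^3:\ \ell\text{ and }y\text{ are linearly dependent}\}$. The arc-length geodesics from the origin contained in $C_{\mathfrak n}$ are straight lines $t\mapsto(at,tv,0)$ with $a^2+|v|^2=1$, and the curves displayed in the claim. The cut time of an arc-length geodesic $\gamma$ from $o$ is $t_{cut}=\sup\{t>0:\gamma|_{[0,t]}\text{ is length minimizing}\}$; if it is finite, $\gamma$ is said to lose its optimality at the point $\gamma(t_{cut})$. A Maxwell point is a point where distinct geodesics starting at the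 origin intersect with the corresponding geodesic segments having equal length. *)

theory Defs
  imports "HOL-Analysis.Analysis"
begin

type_synonym carnot = "real \<times> (real^3) \<times> (real^3)"

definition carnot_mult :: "carnot \<Rightarrow> carnot \<Rightarrow> carnot" where
  "carnot_mult = (\<lambda>(x, l, y) (x', l', y').
     (x + x', l + l', y + y' + (1/2) *\<^sub>R (x *\<^sub>R l' - x' *\<^sub>R l)))"

text \<open>Vector fields are maps from points to coordinate vectors.\<close>

definition N0 :: "carnot \<Rightarrow> carnot" where
  "N0 = (\<lambda>(x, l, y). (1, 0, - (1/2) *\<^sub>R l))"

definition Ni :: "3 \<Rightarrow> carnot \<Rightarrow> carnot" where
  "Ni i = (\<lambda>(x, l, y). (0, axis i 1, (x/2) *\<^sub>R axis i 1))"

definition frame :: "carnot \<Rightarrow> carnot set" where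
  "frame p = insert (N0 p) (range (\<lambda>i. Ni i p))"

definition distrib_N :: "carnot \<Rightarrow> carnot set" where
  "distrib_N p = span (frame p)"

text \<open>The metric with orthonormal frame; it is meaningful for \<open>v\<close> and \<open>w\<close> in \<open>distrib_N p\<close> only.\<close>

definition sr_metric :: "carnot \<Rightarrow> carnot \<Rightarrow> carnot \<Rightarrow> real" where
  "sr_metric p v w =
     (\<Sum>b\<in>frame p. representation (frame p) v b * representation (frame p) w b)"

lemma left_invariant_fields:
  "\<exists>D. (carnot_mult p has_derivative D) (at q) \<and>
       D (N0 q) = N0 (carnot_mult p q) \<and> (\<forall>i. D (Ni i q) = Ni i (carnot_mult p q))"
proof -
  obtain x l y where p: "p = (x, l, y)" by (cases p)
  obtain x' l' y' where q: "q = (x', l', y')" by (cases q)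
  define D :: "carnot \<Rightarrow> carnot" where
    "D = (\<lambda>v. (fst v, fst (snd v),
       snd (snd v) + (1/2) *\<^sub>R (x *\<^sub>R fst (snd v) - fst v *\<^sub>R l)))"
  have eq: "carnot_mult p = (\<lambda>v. (x + fst v, l + fst (snd v),
       y + snd (snd v) + (1/2) *\<^sub>R (x *\<^sub>R fst (snd v) - fst v *\<^sub>R l)))"
    by (auto simp: carnot_mult_def p fun_eq_iff)
  have "(carnot_mult p has_derivative D) (at q)"
    unfolding eq D_def by (auto intro!: derivative_eq_intros)
  moreover have "D (N0 q) = N0 (carnot_mult p q)"
    by (simp add: D_def N0_def p q carnot_mult_def algebra_simps)
  moreover have "D (Ni i q) = Ni i (carnot_mult p q)" for i
    by (simp add: D_def Ni_def p q carnot_mult_def add_divide_distrib algebra_simps)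
  ultimately show ?thesis by blast
qed

lemma inj_Ni: "inj (\<lambda>i. Ni i p)"
  by (auto simp: inj_def Ni_def axis_eq_axis split: prod.splits)

lemma N0_neq_Ni: "N0 p \<noteq> Ni i p"
  by (auto simp: N0_def Ni_def split: prod.splits)

lemma finite_frame [simp]: "finite (frame p)"
  by (simp add: frame_def)

lemma sum_frame: "(\<Sum>b\<in>frame p. f b) = f (N0 p) + (\<Sum>i\<in>UNIV. f (Ni i p))"
proof -
  have "N0 p \<notin> range (\<lambda>i. Ni i p)" using N0_neq_Ni by blast
  then show ?thesis
    by (simp add: frame_def sum.reindex[OF inj_Ni, unfolded o_def])
qed

lemma independent_frame: "independent (frame p)"
proof (rule independent_if_scalars_zero)
  fix f :: "carnot \<Rightarrow> real" and b
  assume 0: "(\<Sum>b\<in>frame p. f b *\<^sub>R b) = 0" and b: "b \<in> frame p"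
  obtain x l y where p: "p = (x, l, y)" by (cases p)
  have s: "f (N0 p) *\<^sub>R N0 p + (\<Sum>i\<in>UNIV. f (Ni i p) *\<^sub>R Ni i p) = 0"
    using 0 by (simp add: sum_frame)
  have "f (N0 p) = 0"
    using arg_cong[OF s, of fst] by (simp add: fst_sum Ni_def N0_def p)
  moreover have "f (Ni j p) = 0" for j
  proof -
    have "(\<Sum>i\<in>UNIV. f (Ni i p) * (axis i 1 :: real^3) $ j) = 0"
      using arg_cong[OF s, of "\<lambda>v. fst (snd v) $ j"]
      by (simp add: fst_sum snd_sum Ni_def N0_def p)
    then show ?thesis
      by (simp add: axis_def if_distrib sum.delta cong: if_cong)
  qed
  ultimately show "f b = 0" using b by (auto simp: frame_def)
qed simp

lemma orthonormal_frame:
  assumes "b \<in> frame p" "c \<in> frame p"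
  shows "sr_metric p b c = (if b = c then 1 else 0)"
proof -
  have "sr_metric p b c =
      (\<Sum>a\<in>frame p. if a = b then (if a = c then 1 else 0) else 0)"
    unfolding sr_metric_def
    by (intro sum.cong) (use assms in \<open>auto simp: representation_basis[OF independent_frame]\<close>)
  also have "\<dots> = (if b = c then 1 else 0)"
    using assms by simp
  finally show ?thesis .
qed

text \<open>
  As usual in sub-Riemannian geometry, admissible curves are Lipschitz and tangent to the
  distribution almost everywhere.
\<close>

definition admissible :: "(real \<Rightarrow> carnot) \<Rightarrow> real \<Rightarrow> real \<Rightarrow> bool" where
  "admissible \<gamma> a b \<longleftrightarrow> a \<le> b \<and> (\<exists>L. L-lipschitz_on {a..b} \<gamma>) \<and>
     (AE t in lebesgue_on {a..b}. \<gamma> differentiable (at t) \<and>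
        vector_derivative \<gamma> (at t) \<in> distrib_N (\<gamma> t))"

definition speed :: "(real \<Rightarrow> carnot) \<Rightarrow> real \<Rightarrow> real" where
  "speed \<gamma> t =
     sqrt (sr_metric (\<gamma> t) (vector_derivative \<gamma> (at t)) (vector_derivative \<gamma> (at t)))"

definition sr_length :: "(real \<Rightarrow> carnot) \<Rightarrow> real \<Rightarrow> real \<Rightarrow> real" where
  "sr_length \<gamma> a b = integral {a..b} (speed \<gamma>)"

definition length_minimizing :: "(real \<Rightarrow> carnot) \<Rightarrow> real \<Rightarrow> real \<Rightarrow> bool" where
  "length_minimizing \<gamma> a b \<longleftrightarrow> admissible \<gamma> a b \<and>
     (\<forall>\<eta> c d. admissible \<eta> c d \<and> \<eta> c = \<gamma> a \<and> \<eta> d = \<gamma> b \<longrightarrow>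
        sr_length \<gamma> a b \<le> sr_length \<eta> c d)"

text \<open>Only the values of \<open>\<gamma>\<close> on \<open>{0..}\<close> matter for the notions below.\<close>

definition sr_geodesic :: "(real \<Rightarrow> carnot) \<Rightarrow> bool" where
  "sr_geodesic \<gamma> \<longleftrightarrow> (\<forall>T\<ge>0. admissible \<gamma> 0 T) \<and>
     (\<exists>c. AE t in lebesgue_on {0..}. speed \<gamma> t = c) \<and>
     (\<forall>t\<ge>0. \<exists>\<epsilon>>0. \<forall>a b. 0 \<le> a \<and> t - \<epsilon> \<le> a \<and> a \<le> b \<and> b \<le> t + \<epsilon> \<longrightarrow>
        length_minimizing \<gamma> a b)"

definition arclength_geodesic :: "(real \<Rightarrow> carnot) \<Rightarrow> bool" where
  "arclength_geodesic \<gamma> \<longleftrightarrow> sr_geodesic \<gamma> \<and> (AE t in lebesgue_on {0..}. speed \<gamma> t = 1)"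

definition cut_time :: "(real \<Rightarrow> carnot) \<Rightarrow> ereal" where
  "cut_time \<gamma> = Sup {ereal t | t. 0 < t \<and> length_minimizing \<gamma> 0 t}"

definition loses_optimality_at :: "(real \<Rightarrow> carnot) \<Rightarrow> carnot \<Rightarrow> bool" where
  "loses_optimality_at \<gamma> p \<longleftrightarrow> (\<exists>T. cut_time \<gamma> = ereal T \<and> p = \<gamma> T)"

text \<open>
  Both geodesics are parametrized by arc length, so that two parametrizations of one curve do not
  count as distinct geodesics.
\<close>

definition maxwell_point :: "carnot \<Rightarrow> bool" where
  "maxwell_point p \<longleftrightarrow> (\<exists>\<gamma> \<eta> T. arclength_geodesic \<gamma> \<and> arclength_geodesic \<eta> \<and>
     \<gamma> 0 = (0, 0, 0) \<and> \<eta> 0 = (0, 0, 0) \<and> 0 < T \<and> \<gamma> T = p \<and> \<eta> T = p \<and>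
     sr_length \<gamma> 0 T = sr_length \<eta> 0 T \<and> (\<exists>t\<in>{0..T}. \<gamma> t \<noteq> \<eta> t))"

text \<open>
  Linear dependence of the pair \<open>l, y\<close>; \<open>dependent {l, y}\<close> would be wrong for \<open>l = y\<close>.
\<close>

definition C_n :: "carnot set" where
  "C_n = {(x, l, y). \<exists>\<alpha> \<beta> :: real. (\<alpha>, \<beta>) \<noteq> (0, 0) \<and> \<alpha> *\<^sub>R l + \<beta> *\<^sub>R y = 0}"

definition geodesic_in_C_n :: "(real \<Rightarrow> carnot) \<Rightarrow> bool" where
  "geodesic_in_C_n \<gamma> \<longleftrightarrow>
     arclength_geodesic \<gamma> \<and> \<gamma> 0 = (0, 0, 0) \<and> (\<forall>t\<ge>0. \<gamma> t \<in> C_n)"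

definition circle_curve :: "real \<Rightarrow> real \<Rightarrow> real \<Rightarrow> real^3 \<Rightarrow> real \<Rightarrow> carnot" where
  "circle_curve C1 C2 K k t =
     (C1 * (cos (K * t) - 1) + C2 * sin (K * t),
      (C1 * sin (K * t) + C2 * (1 - cos (K * t))) *\<^sub>R k,
      ((1/2) * (C1\<^sup>2 + C2\<^sup>2) * (K * t - sin (K * t))) *\<^sub>R k)"

end

theory Submission
  imports Defs
begin

text \<open>
  The plane part \<open>(x, l)\<close> of a horizontal curve determines its vertical part up to the initial value, since the
  vertical velocity is half the area swept by the plane part; and the length of the curve is the Euclidean
  length of the plane part. Finding minimizers is therefore an isoperimetric problem with a vector-valued
  area. Its natural candidates are circular arcs and lines in the planes spanned by the \<open>x\<close>-axis and a unit
  vector \<open>k\<close>, here treated uniformly as curves \<open>geod \<phi> K k\<close> of unit speed and constant curvature \<open>K\<close>.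

  Optimality. Let \<open>z\<close> be the difference of the plane parts of a horizontal curve and of an arc with the same end
  points. Arcs are critical points of the energy with a multiplier for the vertical end point, so all terms linear
  in \<open>z\<close> integrate to zero (\<open>lip_deriv_G\<close>) and the energies differ by a quadratic form. For arcs of less than a full
  turn this form is positive definite, because it is a sum of squares up to a derivative
  (\<open>weighted_energy_lower_bound\<close>). Hence such arcs are minimizing (\<open>geod_minimizing\<close>), and they are the only
  minimizers between their end points (\<open>geod_unique_minimizer\<close>).

  The cut. After a full turn all arcs with the same \<open>K\<close> and \<open>k\<close> meet in the point
  \<open>(0, 0, (pi / K\<^sup>2) *\<^sub>R k)\<close>. These points are Maxwell points, and every point \<open>(0, 0, y)\<close> with \<open>y \<noteq> 0\<close> is
  one of them. A longer arc cannot be minimizing, since exchanging its first turn for a different one would give a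
  minimizer with a corner. Corners are excluded by
  \<open>geod_extension\<close>: a minimizer that starts as an arc continues as that arc. If it deviated, the deviation could be
  replaced by one that grows linearly and starts earlier, on the arc; this saves the energy of the deviation up
  to terms that are smaller by a factor of the length of the interval, and the resulting vertical error can be
  corrected on the arc at a cost of the same small size. Knowing that one side of the possible corner is an
  arc makes that correction explicit.

  The converse. Let a geodesic in \<open>C_n\<close> lose its optimality at a point with nonzero plane part. The point lies in a
  Heisenberg subgroup spanned by the \<open>x\<close>-axis and some \<open>k\<close>, where an arc of less than a full turn leads to it
  (\<open>geod_exists\<close>). By uniqueness the geodesic is this arc up to the point, by \<open>geod_extension\<close> it is this arc a
  little further, and there it is still minimizing: a contradiction (\<open>cut_point_vertical\<close>).
\<close>

section \<open>Lipschitz curves with an almost everywhere derivative\<close>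

text \<open>
  The derivative is fixed only up to null sets. Carrying it as an argument keeps the product and chain
  rules below free of null sets.
\<close>
definition lip_deriv :: "(real \<Rightarrow> 'a::euclidean_space) \<Rightarrow> (real \<Rightarrow> 'a) \<Rightarrow> real \<Rightarrow> real \<Rightarrow> bool" where
  "lip_deriv f f' a b \<longleftrightarrow> (\<exists>L. L-lipschitz_on {a..b} f) \<and>
     (\<exists>N. negligible N \<and> (\<forall>t\<in>{a..b} - N. (f has_vector_derivative f' t) (at t)))"

lemma vector_derivative_quotient_limit:
  fixes f :: "real \<Rightarrow> 'a::real_normed_vector"
  assumes "(f has_vector_derivative d) (at t)"
  shows "((\<lambda>h. (f (t + h) - f t) /\<^sub>R h) \<longlongrightarrow> d) (at 0)"
proof -
  have *: "((\<lambda>h. norm (f (t + h) - f t - h *\<^sub>R d) / norm h) \<longlongrightarrow> 0) (at 0)"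
    using assms by (simp add: has_vector_derivative_def has_derivative_at)
  have "((\<lambda>h. norm ((f (t + h) - f t) /\<^sub>R h - d)) \<longlongrightarrow> 0) (at 0)"
  proof (rule Lim_transform_eventually[OF *])
    have "norm (f (t + h) - f t - h *\<^sub>R d) / norm h = norm ((f (t + h) - f t) /\<^sub>R h - d)"
      if "h \<noteq> 0" for h
    proof -
      have "(f (t + h) - f t) /\<^sub>R h - d = (f (t + h) - f t - h *\<^sub>R d) /\<^sub>R h"
        using that by (simp add: algebra_simps)
      then show ?thesis by (simp add: divide_inverse_commute)
    qed
    then show "\<forall>\<^sub>F h in at 0. norm (f (t + h) - f t - h *\<^sub>R d) / norm h =
        norm ((f (t + h) - f t) /\<^sub>R h - d)"
      by (auto simp: eventually_at_filter)
  qed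
  then show ?thesis
    by (simp add: tendsto_norm_zero_iff LIM_zero_iff)
qed

lemma lip_derivE:
  assumes "lip_deriv f f' a b"
  obtains L N where "L-lipschitz_on {a..b} f" "negligible N" "a \<in> N" "b \<in> N"
    "\<And>t. t \<in> {a..b} - N \<Longrightarrow> (f has_vector_derivative f' t) (at t)"
    "\<And>t. t \<in> {a..b} - N \<Longrightarrow> norm (f' t) \<le> L"
proof -
  obtain L N where L: "L-lipschitz_on {a..b} f" and N: "negligible N"
    and d: "\<forall>t\<in>{a..b} - N. (f has_vector_derivative f' t) (at t)"
    using assms unfolding lip_deriv_def by blast
  have "norm (f' t) \<le> L" if t: "t \<in> {a..b} - insert a (insert b N)" for t
  proof -
    have ab: "a < t" "t < b" using t by auto
    have "(f has_vector_derivative f' t) (at t)" using d t by auto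
    then have lim: "((\<lambda>h. norm ((f (t + h) - f t) /\<^sub>R h)) \<longlongrightarrow> norm (f' t)) (at 0)"
      by (intro tendsto_norm vector_derivative_quotient_limit)
    have "norm ((f (t + h) - f t) /\<^sub>R h) \<le> L" if "h \<noteq> 0" "dist h 0 < min (t - a) (b - t)" for h
    proof -
      have "norm (f (t + h) - f t) \<le> L * norm (t + h - t)"
        by (rule lipschitz_on_normD[OF L]) (use that ab in \<open>auto simp: dist_real_def\<close>)
      then show ?thesis using that(1) by (simp add: pos_divide_le_eq flip: divide_inverse_commute)
    qed
    then have "\<forall>\<^sub>F h in at 0. norm ((f (t + h) - f t) /\<^sub>R h) \<le> L"
      unfolding eventually_at using ab by (intro exI[of _ "min (t - a) (b - t)"]) auto
    then show ?thesis using tendsto_upperbound[OF lim] by auto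
  qed
  then show ?thesis
    using that[of L "insert a (insert b N)"] L N d by auto
qed

lemma integral_quotient_limit:
  fixes F :: "real \<Rightarrow> 'a::euclidean_space"
  fixes h :: "nat \<Rightarrow> real"
  assumes "continuous_on UNIV F" and h: "h \<longlonglongrightarrow> 0" "\<And>n. h n > 0"
  shows "(\<lambda>n. integral {c..c + h n} F /\<^sub>R h n) \<longlonglongrightarrow> F c"
proof -
  define G where "G = (\<lambda>t. integral {c - 1..t} F)"
  have int: "F integrable_on {u..v}" for u v
    using assms(1) by (intro integrable_continuous_real) (auto intro: continuous_on_subset)
  have "(G has_vector_derivative F c) (at c within {c - 1..c + 1})"
    unfolding G_def by (rule integral_has_vector_derivative)
      (use assms(1) in \<open>auto intro: continuous_on_subset\<close>)
  then have "(G has_vector_derivative F c) (at c)"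
    by (simp add: at_within_Icc_at)
  then have "((\<lambda>h. (G (c + h) - G c) /\<^sub>R h) \<longlongrightarrow> F c) (at 0)"
    by (rule vector_derivative_quotient_limit)
  moreover have "filterlim h (at 0) sequentially"
    using h by (auto simp: filterlim_at intro!: always_eventually) (metis less_irrefl)
  ultimately have "(\<lambda>n. (G (c + h n) - G c) /\<^sub>R h n) \<longlonglongrightarrow> F c"
    by (rule filterlim_compose)
  moreover have "G (c + h n) - G c = integral {c..c + h n} F" for n
  proof -
    have "integral {c - 1..c} F + integral {c..c + h n} F = integral {c - 1..c + h n} F"
      by (rule Henstock_Kurzweil_Integration.integral_combine) (use h(2)[of n] int in auto)
    then show ?thesis unfolding G_def by (simp add: algebra_simps)
  qed
  ultimately show ?thesis by simp
qed

text \<open>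
  The difference quotients are continuous, uniformly bounded and converge to the derivative almost
  everywhere, and their integrals telescope. They serve twice: for the fundamental theorem of calculus,
  and as positive continuous weights that approximate the speed of a curve.
\<close>
lemma lip_deriv_approx:
  fixes f :: "real \<Rightarrow> 'a::euclidean_space"
  assumes "lip_deriv f f' a b" "a \<le> b"
  obtains Q :: "nat \<Rightarrow> real \<Rightarrow> 'a" and N L where "negligible N"
    "\<And>n. continuous_on {a..b} (Q n)" "\<And>n t. norm (Q n t) \<le> L"
    "\<And>t. t \<in> {a..b} - N \<Longrightarrow> (\<lambda>n. Q n t) \<longlonglongrightarrow> f' t"
    "(\<lambda>n. integral {a..b} (Q n)) \<longlonglongrightarrow> f b - f a"
proof -
  obtain L N where L: "L-lipschitz_on {a..b} f" and N: "negligible N" "a \<in> N" "b \<in> N"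
    and d: "\<And>t. t \<in> {a..b} - N \<Longrightarrow> (f has_vector_derivative f' t) (at t)"
    using lip_derivE[OF assms(1)] by metis
  define F where "F = (\<lambda>t. f (min b (max a t)))"
  define h :: "nat \<Rightarrow> real" where "h = (\<lambda>n. 1 / (real n + 1))"
  have h0: "h \<longlonglongrightarrow> 0" unfolding h_def by real_asymp
  have hpos: "h n > 0" for n by (simp add: h_def)
  have L0: "L \<ge> 0" using L by (rule lipschitz_on_nonneg)
  have FL: "norm (F s - F t) \<le> L * \<bar>s - t\<bar>" for s t
  proof -
    have "norm (F s - F t) \<le> L * norm (min b (max a s) - min b (max a t))"
      unfolding F_def by (rule lipschitz_on_normD[OF L]) (use assms(2) in auto)
    also have "\<dots> \<le> L * \<bar>s - t\<bar>"
      by (rule mult_left_mono[OF _ L0]) auto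
    finally show ?thesis .
  qed
  have "L-lipschitz_on UNIV F"
    by (rule lipschitz_onI) (use FL L0 in \<open>auto simp: dist_norm\<close>)
  then have cF: "continuous_on UNIV F" by (rule lipschitz_on_continuous_on)
  have int: "F integrable_on {u..v}" for u v
    using cF by (intro integrable_continuous_real) (auto intro: continuous_on_subset)
  define Q where "Q = (\<lambda>n t. (F (t + h n) - F t) /\<^sub>R h n)"
  have cQ: "continuous_on {a..b} (Q n)" for n
    unfolding Q_def
    by (intro continuous_intros continuous_on_compose2[OF cF]) auto
  have bound: "norm (Q n t) \<le> L" for n t
    using FL[of "t + h n" t] hpos[of n] by (simp add: Q_def pos_divide_le_eq flip: divide_inverse_commute)
  have lim: "(\<lambda>n. Q n t) \<longlonglongrightarrow> f' t" if t: "t \<in> {a..b} - N" for t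
  proof -
    have ab: "a < t" "t < b" using t N by (auto simp: less_le)
    have "((\<lambda>h. (f (t + h) - f t) /\<^sub>R h) \<longlongrightarrow> f' t) (at 0)"
      using d t by (intro vector_derivative_quotient_limit) auto
    moreover have "filterlim h (at 0) sequentially"
      using h0 hpos by (auto simp: filterlim_at intro!: always_eventually) (metis less_irrefl)
    ultimately have "(\<lambda>n. (f (t + h n) - f t) /\<^sub>R h n) \<longlonglongrightarrow> f' t"
      by (rule filterlim_compose)
    moreover have "\<forall>\<^sub>F n in sequentially. h n < b - t"
      using order_tendstoD(2)[OF h0, of "b - t"] ab by simp
    then have "\<forall>\<^sub>F n in sequentially. (f (t + h n) - f t) /\<^sub>R h n = Q n t"
      by eventually_elim
        (use ab hpos in \<open>auto simp: Q_def F_def min_def max_def add_increasing2 less_imp_le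
          not_le dest: less_le_trans\<close>)
    ultimately show ?thesis
      by (rule Lim_transform_eventually)
  qed
  have "integral {a..b} (Q n) = integral {b..b + h n} F /\<^sub>R h n - integral {a..a + h n} F /\<^sub>R h n" for n
  proof -
    have "integral {a..b} (Q n) = (integral {a..b} (\<lambda>t. F (t + h n)) - integral {a..b} F) /\<^sub>R h n"
      unfolding Q_def
      by (subst integral_cmul, subst integral_diff)
        (auto intro!: int integrable_continuous_real continuous_intros continuous_on_compose2[OF cF])
    also have "integral {a..b} (\<lambda>t. F (t + h n)) = integral {a + h n..b + h n} F"
      using has_integral_shift_real_ivl[OF integrable_integral[OF int[of "a + h n" "b + h n"]], of "h n"]
      by (simp add: integral_unique)
    also have "\<dots> - integral {a..b} F = integral {b..b + h n} F - integral {a..a + h n} F"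
    proof -
      have "integral {a..b} F + integral {b..b + h n} F = integral {a..b + h n} F"
        by (rule Henstock_Kurzweil_Integration.integral_combine) (use assms hpos[of n] int in auto)
      moreover have "integral {a..a + h n} F + integral {a + h n..b + h n} F = integral {a..b + h n} F"
        by (rule Henstock_Kurzweil_Integration.integral_combine) (use assms hpos[of n] int in auto)
      ultimately show ?thesis by (simp add: algebra_simps)
    qed
    finally show ?thesis by (simp add: scaleR_diff_right)
  qed
  then have lim2: "(\<lambda>n. integral {a..b} (Q n)) \<longlonglongrightarrow> F b - F a"
    using tendsto_diff[OF integral_quotient_limit[OF cF h0 hpos, of b] integral_quotient_limit[OF cF h0 hpos, of a]]
    by simp
  then have "(\<lambda>n. integral {a..b} (Q n)) \<longlonglongrightarrow> f b - f a"
    using assms(2) by (simp add: F_def)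
  from N(1) cQ bound lim this show ?thesis by (rule that)
qed

theorem lip_deriv_has_integral:
  fixes f :: "real \<Rightarrow> 'a::euclidean_space"
  assumes "lip_deriv f f' a b" "a \<le> b"
  shows "(f' has_integral f b - f a) {a..b}"
proof -
  obtain Q :: "nat \<Rightarrow> real \<Rightarrow> 'a" and N L where N: "negligible N"
    and cQ: "\<And>n. continuous_on {a..b} (Q n)" and bound: "\<And>n t. norm (Q n t) \<le> L"
    and lim: "\<And>t. t \<in> {a..b} - N \<Longrightarrow> (\<lambda>n. Q n t) \<longlonglongrightarrow> f' t"
    and int: "(\<lambda>n. integral {a..b} (Q n)) \<longlonglongrightarrow> f b - f a"
    using lip_deriv_approx[OF assms] by metis
  define Q0 where "Q0 = (\<lambda>n t. if t \<in> N then 0 else Q n t)"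
  define g where "g = (\<lambda>t. if t \<in> N then 0 else f' t)"
  have L0: "L \<ge> 0" using bound[of 0 0] norm_ge_zero[of "Q 0 0"] by linarith
  have iQ0: "Q0 n integrable_on {a..b}" for n
    by (rule integrable_spike[OF integrable_continuous_real[OF cQ] N]) (auto simp: Q0_def)
  have bound': "norm (Q0 n t) \<le> L" for n t
    using bound L0 by (simp add: Q0_def)
  have lim': "(\<lambda>n. Q0 n t) \<longlonglongrightarrow> g t" if "t \<in> {a..b}" for t
    using lim[of t] that by (cases "t \<in> N") (simp_all add: Q0_def g_def)
  have ig: "g integrable_on {a..b}"
    and lim1: "(\<lambda>n. integral {a..b} (Q0 n)) \<longlonglongrightarrow> integral {a..b} g"
    using dominated_convergence[of Q0 "{a..b}" "\<lambda>_. L" g] iQ0 bound' lim' by auto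
  have "integral {a..b} (Q0 n) = integral {a..b} (Q n)" for n
    by (rule integral_spike[OF N]) (auto simp: Q0_def)
  then have "integral {a..b} g = f b - f a"
    using LIMSEQ_unique[OF lim1] int by simp
  then have "(g has_integral f b - f a) {a..b}"
    using ig by (metis integrable_integral)
  then show ?thesis
    by (rule has_integral_spike[OF N(1), rotated]) (auto simp: g_def)
qed

lemma lip_deriv_mono:
  assumes "lip_deriv f f' a b" "a \<le> c" "d \<le> b"
  shows "lip_deriv f f' c d"
proof -
  have "{c..d} \<subseteq> {a..b}" using assms(2,3) by auto
  then show ?thesis
    using assms(1) unfolding lip_deriv_def by (blast intro: lipschitz_on_subset)
qed

lemma lip_deriv_continuous_on: "lip_deriv f f' a b \<Longrightarrow> continuous_on {a..b} f"
  unfolding lip_deriv_def using lipschitz_on_continuous_on by blast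

lemma continuous_on_Icc_bounded:
  fixes f :: "real \<Rightarrow> 'a::real_normed_vector"
  assumes "continuous_on {a..b} f"
  obtains B where "B \<ge> 0" "\<And>t. t \<in> {a..b} \<Longrightarrow> norm (f t) \<le> B"
proof -
  have "bounded (f ` {a..b})"
    by (intro compact_imp_bounded compact_continuous_image assms compact_Icc)
  then obtain B where "\<forall>t\<in>{a..b}. norm (f t) \<le> B"
    unfolding bounded_iff by blast
  then have "\<And>t. t \<in> {a..b} \<Longrightarrow> norm (f t) \<le> max B 0"
    by (simp add: le_max_iff_disj)
  then show ?thesis using that[of "max B 0"] by simp
qed

lemma lip_deriv_C1:
  fixes f :: "real \<Rightarrow> 'a::euclidean_space"
  assumes d: "\<And>t. t \<in> {a..b} \<Longrightarrow> (f has_vector_derivative f' t) (at t within {a..b})"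
    and c: "continuous_on {a..b} f'"
  shows "lip_deriv f f' a b"
proof -
  obtain B where B0: "B \<ge> 0" and B: "\<And>t. t \<in> {a..b} \<Longrightarrow> norm (f' t) \<le> B"
    using continuous_on_Icc_bounded[OF c] by blast
  have "B-lipschitz_on {a..b} f"
  proof (rule bounded_derivative_imp_lipschitz)
    fix t assume t: "t \<in> {a..b}"
    show "(f has_derivative (\<lambda>h. h *\<^sub>R f' t)) (at t within {a..b})"
      using d[OF t] by (simp add: has_vector_derivative_def)
    show "onorm (\<lambda>h. h *\<^sub>R f' t) \<le> B"
      by (rule onorm_le) (use B[OF t] in \<open>simp add: mult.commute[of _ "norm (f' t)"] mult_right_mono\<close>)
  qed (use B0 in auto)
  moreover have "(f has_vector_derivative f' t) (at t)" if "t \<in> {a..b} - {a, b}" for t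
    using d[of t] that by (auto simp: at_within_Icc_at)
  ultimately show ?thesis
    unfolding lip_deriv_def
    by (metis finite.emptyI finite.insertI negligible_finite)
qed

lemma lip_deriv_add:
  assumes "lip_deriv f f' a b" "lip_deriv g g' a b"
  shows "lip_deriv (\<lambda>t. f t + g t) (\<lambda>t. f' t + g' t) a b"
proof -
  obtain L N where 1: "L-lipschitz_on {a..b} f" "negligible N"
      "\<forall>t\<in>{a..b} - N. (f has_vector_derivative f' t) (at t)"
    using assms(1) unfolding lip_deriv_def by blast
  obtain L' N' where 2: "L'-lipschitz_on {a..b} g" "negligible N'"
      "\<forall>t\<in>{a..b} - N'. (g has_vector_derivative g' t) (at t)"
    using assms(2) unfolding lip_deriv_def by blast
  have "(L + L')-lipschitz_on {a..b} (\<lambda>t. f t + g t)"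
    by (rule lipschitz_on_add) (use 1 2 in auto)
  moreover have "\<forall>t\<in>{a..b} - (N \<union> N'). ((\<lambda>t. f t + g t) has_vector_derivative f' t + g' t) (at t)"
    using 1 2 by (auto intro: has_vector_derivative_add)
  ultimately show ?thesis
    unfolding lip_deriv_def using negligible_Un[OF 1(2) 2(2)] by blast
qed

lemma lip_deriv_bounded_linear:
  assumes "bounded_linear T" "lip_deriv f f' a b"
  shows "lip_deriv (\<lambda>t. T (f t)) (\<lambda>t. T (f' t)) a b"
proof -
  interpret T: bounded_linear T by fact
  obtain L N where 1: "L-lipschitz_on {a..b} f" "negligible N"
      "\<forall>t\<in>{a..b} - N. (f has_vector_derivative f' t) (at t)"
    using assms(2) unfolding lip_deriv_def by blast
  obtain B where B: "B-lipschitz_on (f ` {a..b}) T"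
    by (rule T.lipschitz_boundE)
  then have "\<exists>L. L-lipschitz_on {a..b} (\<lambda>t. T (f t))"
    using lipschitz_on_compose2[OF 1(1) B] by blast
  moreover have "\<forall>t\<in>{a..b} - N. ((\<lambda>t. T (f t)) has_vector_derivative T (f' t)) (at t)"
    using 1 T.has_vector_derivative by blast
  ultimately show ?thesis
    unfolding lip_deriv_def using 1 by blast
qed

lemma lip_deriv_diff:
  assumes "lip_deriv f f' a b" "lip_deriv g g' a b"
  shows "lip_deriv (\<lambda>t. f t - g t) (\<lambda>t. f' t - g' t) a b"
  using lip_deriv_add[OF assms(1) lip_deriv_bounded_linear[OF bounded_linear_minus[OF bounded_linear_ident] assms(2)]]
  by simp

lemma lip_deriv_bilinear:
  assumes "bounded_bilinear P" "lip_deriv f f' a b" "lip_deriv g g' a b"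
  shows "lip_deriv (\<lambda>t. P (f t) (g t)) (\<lambda>t. P (f t) (g' t) + P (f' t) (g t)) a b"
proof -
  interpret P: bounded_bilinear P by fact
  obtain L N where 1: "L-lipschitz_on {a..b} f" "negligible N"
      "\<forall>t\<in>{a..b} - N. (f has_vector_derivative f' t) (at t)"
    using assms(2) unfolding lip_deriv_def by blast
  obtain L' N' where 2: "L'-lipschitz_on {a..b} g" "negligible N'"
      "\<forall>t\<in>{a..b} - N'. (g has_vector_derivative g' t) (at t)"
    using assms(3) unfolding lip_deriv_def by blast
  obtain A where A: "A \<ge> 0" "\<And>t. t \<in> {a..b} \<Longrightarrow> norm (f t) \<le> A"
    using continuous_on_Icc_bounded[OF lip_deriv_continuous_on[OF assms(2)]] by blast
  obtain B where B: "B \<ge> 0" "\<And>t. t \<in> {a..b} \<Longrightarrow> norm (g t) \<le> B"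
    using continuous_on_Icc_bounded[OF lip_deriv_continuous_on[OF assms(3)]] by blast
  obtain C where C: "C \<ge> 0" "\<And>u v. norm (P u v) \<le> norm u * norm v * C"
    using P.nonneg_bounded by blast
  have L0: "L \<ge> 0" "L' \<ge> 0" using 1 2 lipschitz_on_nonneg by auto
  have "(C * (A * L' + L * B))-lipschitz_on {a..b} (\<lambda>t. P (f t) (g t))"
  proof (rule lipschitz_onI)
    fix s t assume s: "s \<in> {a..b}" and t: "t \<in> {a..b}"
    have "P (f s) (g s) - P (f t) (g t) = P (f s) (g s - g t) + P (f s - f t) (g t)"
      by (simp add: P.diff_left P.diff_right)
    then have "norm (P (f s) (g s) - P (f t) (g t)) \<le>
        norm (f s) * norm (g s - g t) * C + norm (f s - f t) * norm (g t) * C"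
      by (simp only:) (intro norm_triangle_le add_mono C(2))
    also have "\<dots> \<le> A * (L' * dist s t) * C + (L * dist s t) * B * C"
    proof (intro add_mono mult_right_mono mult_mono C)
      show "norm (f s) \<le> A" using A(2)[OF s] .
      show "norm (g t) \<le> B" using B(2)[OF t] .
      show "norm (g s - g t) \<le> L' * dist s t" using lipschitz_onD[OF 2(1) s t] by (simp add: dist_norm)
      show "norm (f s - f t) \<le> L * dist s t" using lipschitz_onD[OF 1(1) s t] by (simp add: dist_norm)
    qed (use L0 A B in auto)
    finally show "dist (P (f s) (g s)) (P (f t) (g t)) \<le> C * (A * L' + L * B) * dist s t"
      by (simp add: dist_norm algebra_simps)
  qed (use C L0 A B in auto)
  moreover have "\<forall>t\<in>{a..b} - (N \<union> N').
      ((\<lambda>t. P (f t) (g t)) has_vector_derivative P (f t) (g' t) + P (f' t) (g t)) (at t)"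
    using 1 2 by (auto intro: P.has_vector_derivative)
  ultimately show ?thesis
    unfolding lip_deriv_def using negligible_Un[OF 1(2) 2(2)] by blast
qed

lemma lip_deriv_integrable:
  fixes f :: "real \<Rightarrow> 'a::euclidean_space" and \<Phi> :: "real \<Rightarrow> 'a \<Rightarrow> 'b::euclidean_space"
  assumes f: "lip_deriv f f' a b"
    and \<Phi>: "continuous_on ({a..b} \<times> UNIV) (\<lambda>(t, v). \<Phi> t v)"
  shows "(\<lambda>t. \<Phi> t (f' t)) integrable_on {a..b}"
proof (cases "a \<le> b")
  case True
  obtain L N where N: "negligible N" and L: "\<And>t. t \<in> {a..b} - N \<Longrightarrow> norm (f' t) \<le> L"
    using lip_derivE[OF f] by metis
  define g where "g = (\<lambda>t. if t \<in> N then 0 else f' t)"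
  have gL: "norm (g t) \<le> \<bar>L\<bar>" if "t \<in> {a..b}" for t
    using L[of t] that by (auto simp: g_def)
  have "g integrable_on {a..b}"
    by (rule integrable_spike[OF _ N, of f'])
      (use lip_deriv_has_integral[OF f True] in \<open>auto simp: g_def\<close>)
  then have mg: "g \<in> borel_measurable (lebesgue_on {a..b})"
    by (rule integrable_imp_measurable)
  have mt: "(\<lambda>t. t) \<in> borel_measurable (lebesgue_on {a..b})"
    by (rule integrable_imp_measurable) (auto intro: integrable_continuous_real continuous_intros)
  have "(\<lambda>t. (t, g t)) \<in> borel_measurable (lebesgue_on {a..b})"
    using mt mg by (rule borel_measurable_Pair)
  then have "(\<lambda>t. (t, g t)) \<in> measurable (lebesgue_on {a..b}) (restrict_space borel ({a..b} \<times> UNIV))"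
    by (intro measurable_restrict_space2) auto
  from measurable_compose[OF this borel_measurable_continuous_on_restrict[OF \<Phi>]]
  have m: "(\<lambda>t. \<Phi> t (g t)) \<in> borel_measurable (lebesgue_on {a..b})"
    by simp
  have "compact ((\<lambda>(t, v). \<Phi> t v) ` ({a..b} \<times> cball 0 \<bar>L\<bar>))"
    by (intro compact_continuous_image compact_Times compact_Icc compact_cball
        continuous_on_subset[OF \<Phi>]) auto
  then have "bounded ((\<lambda>(t, v). \<Phi> t v) ` ({a..b} \<times> cball 0 \<bar>L\<bar>))"
    by (rule compact_imp_bounded)
  then obtain B where B: "\<forall>x\<in>{a..b} \<times> cball 0 \<bar>L\<bar>. norm ((\<lambda>(t, v). \<Phi> t v) x) \<le> B"
    unfolding bounded_iff by blast
  have B: "norm (\<Phi> t (g t)) \<le> B" if "t \<in> {a..b}" for t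
    using bspec[OF B, of "(t, g t)"] gL[OF that] that by simp
  have "(\<lambda>t. \<Phi> t (g t)) integrable_on {a..b}"
    by (rule measurable_bounded_by_integrable_imp_integrable[OF m, of "\<lambda>_. B"])
      (use B in auto)
  then show ?thesis
    by (rule integrable_spike[OF _ N]) (auto simp: g_def)
qed auto

text \<open>
  Cauchy-Schwarz, in the form that the distance of \<open>g\<close> to its mean value is nonnegative.
\<close>
lemma norm_integral_squared_le:
  fixes g :: "real \<Rightarrow> 'a::euclidean_space"
  assumes g: "(g has_integral I) {a..b}" and sq: "((\<lambda>t. (norm (g t))\<^sup>2) has_integral E) {a..b}" and ab: "a \<le> b"
  shows "(norm I)\<^sup>2 \<le> (b - a) * E"
proof (cases "a = b")
  case True
  then have "I = 0" using has_integral_unique[OF g] has_integral_refl(2)[of g a] by auto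
  with True show ?thesis by simp
next
  case False
  then have pos: "b - a > 0" using ab by simp
  define m where "m = I /\<^sub>R (b - a)"
  have "((\<lambda>t. (norm (g t))\<^sup>2 - 2 * (g t \<bullet> m) + (norm m)\<^sup>2) has_integral
      E - 2 * (I \<bullet> m) + (b - a) * (norm m)\<^sup>2) {a..b}"
    using has_integral_const_real[of "(norm m)\<^sup>2" a b] ab
    by (intro has_integral_add has_integral_diff has_integral_mult_right sq
        has_integral_linear[OF g bounded_linear_inner_left, unfolded o_def]) auto
  then have "0 \<le> E - 2 * (I \<bullet> m) + (b - a) * (norm m)\<^sup>2"
  proof (rule has_integral_nonneg)
    fix t
    have "(norm (g t))\<^sup>2 - 2 * (g t \<bullet> m) + (norm m)\<^sup>2 = (norm (g t - m))\<^sup>2"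
      by (simp add: power2_norm_eq_inner algebra_simps inner_commute)
    then show "0 \<le> (norm (g t))\<^sup>2 - 2 * (g t \<bullet> m) + (norm m)\<^sup>2" by simp
  qed
  moreover have "I = (b - a) *\<^sub>R m" using pos by (simp add: m_def)
  ultimately have "0 \<le> E - (b - a) * (norm m)\<^sup>2"
    by (simp add: power2_norm_eq_inner)
  moreover have "(norm I)\<^sup>2 = (b - a) * ((b - a) * (norm m)\<^sup>2)"
    using \<open>I = _\<close> by (simp add: power_mult_distrib power2_eq_square)
  ultimately show ?thesis
    using pos by (simp add: mult_left_mono)
qed

lemma lip_deriv_increment_squared_le:
  assumes f: "lip_deriv f f' a b" and st: "a \<le> s" "s \<le> t" "t \<le> b"
  shows "(norm (f t - f s))\<^sup>2 \<le> (t - s) * integral {a..b} (\<lambda>t. (norm (f' t))\<^sup>2)"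
proof -
  have c: "continuous_on ({c..d} \<times> UNIV) (\<lambda>(t, v). (norm v)\<^sup>2)" for c d :: real
    by (auto simp: case_prod_unfold intro!: continuous_intros)
  have f': "lip_deriv f f' s t" by (rule lip_deriv_mono[OF f]) (use st in auto)
  have i: "(\<lambda>t. (norm (f' t))\<^sup>2) integrable_on {a..b}" "(\<lambda>t. (norm (f' t))\<^sup>2) integrable_on {s..t}"
    using lip_deriv_integrable[OF f c] lip_deriv_integrable[OF f' c] by auto
  have "(norm (f t - f s))\<^sup>2 \<le> (t - s) * integral {s..t} (\<lambda>t. (norm (f' t))\<^sup>2)"
    by (rule norm_integral_squared_le[OF lip_deriv_has_integral[OF f']]) (use st i in auto)
  also have "\<dots> \<le> (t - s) * integral {a..b} (\<lambda>t. (norm (f' t))\<^sup>2)"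
    by (intro mult_left_mono integral_subset_le i) (use st in auto)
  finally show ?thesis .
qed

section \<open>Horizontal curves\<close>

type_synonym hplane = "real \<times> (real^3)"

text \<open>
  \<open>area u v\<close> collects, for each of the three coordinates, the oriented area of the parallelogram spanned by
  the projections of \<open>u\<close> and \<open>v\<close> to the plane of \<open>x\<close> and that coordinate.
\<close>
definition plane :: "carnot \<Rightarrow> hplane" where "plane p = (fst p, fst (snd p))"
definition vert :: "carnot \<Rightarrow> real^3" where "vert p = snd (snd p)"
definition area :: "hplane \<Rightarrow> hplane \<Rightarrow> real^3" where
  "area u v = fst u *\<^sub>R snd v - fst v *\<^sub>R snd u"

lemma plane_vert_eqI: "plane p = plane q \<Longrightarrow> vert p = vert q \<Longrightarrow> p = q"
  by (auto simp: plane_def vert_def prod_eq_iff)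

lemma bounded_linear_plane: "bounded_linear plane"
  unfolding plane_def by (intro bounded_linear_Pair bounded_linear_intros)

lemma bounded_linear_vert: "bounded_linear vert"
  unfolding vert_def by (intro bounded_linear_intros)

lemma norm_area_le: "norm (area u v) \<le> norm u * norm v"
proof -
  have "norm (area u v) \<le> \<bar>fst u\<bar> * norm (snd v) + \<bar>fst v\<bar> * norm (snd u)"
    unfolding area_def by (rule order_trans[OF norm_triangle_ineq4]) simp
  also have "\<dots> = (\<bar>fst u\<bar>, norm (snd u)) \<bullet> (norm (snd v), \<bar>fst v\<bar>)"
    by (simp add: inner_prod_def mult.commute)
  also have "\<dots> \<le> norm (\<bar>fst u\<bar>, norm (snd u)) * norm (norm (snd v), \<bar>fst v\<bar>)"
    by (rule norm_cauchy_schwarz)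
  also have "\<dots> = norm u * norm v"
    by (simp add: norm_prod_def add.commute)
  finally show ?thesis .
qed

lemma bounded_bilinear_area: "bounded_bilinear area"
proof
  show "\<exists>K. \<forall>a b. norm (area a b) \<le> norm a * norm b * K"
    by (intro exI[of _ 1]) (simp add: norm_area_le)
qed (simp_all add: area_def algebra_simps)

interpretation area: bounded_bilinear area by (rule bounded_bilinear_area)

lemma area_self [simp]: "area u u = 0" by (simp add: area_def)
lemma area_swap: "area u v = - area v u" by (simp add: area_def)

lemma frame_combination:
  "s *\<^sub>R N0 p + (\<Sum>i\<in>UNIV. r i *\<^sub>R Ni i p) =
     (s, \<chi> i. r i, (1/2) *\<^sub>R area (plane p) (s, \<chi> i. r i))"
proof -
  obtain x l y where p: "p = (x, l, y)" by (cases p)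
  have ax: "(\<Sum>i\<in>UNIV. r i *\<^sub>R axis i 1) = (\<chi> i. r i)"
    by (simp add: vec_eq_iff axis_def if_distrib sum.delta cong: if_cong)
  have "(\<Sum>i\<in>UNIV. r i *\<^sub>R (x/2) *\<^sub>R axis i 1) = (x/2) *\<^sub>R (\<chi> i. r i)"
    unfolding ax[symmetric] scaleR_sum_right by (simp add: mult.commute)
  then show ?thesis
    by (simp add: prod_eq_iff fst_sum snd_sum N0_def Ni_def p ax area_def plane_def algebra_simps)
qed

text \<open>
  Horizontality prescribes the vertical component of a vector, and the metric sees its plane component: this
  makes length minimization a problem about plane curves and their areas.
\<close>
lemma distrib_N_iff: "v \<in> distrib_N p \<longleftrightarrow> vert v = (1/2) *\<^sub>R area (plane p) (plane v)"
proof
  assume "v \<in> distrib_N p"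
  then have "(\<Sum>b\<in>frame p. representation (frame p) v b *\<^sub>R b) = v"
    unfolding distrib_N_def by (intro sum_representation_eq independent_frame) auto
  then have "(representation (frame p) v (N0 p), \<chi> i. representation (frame p) v (Ni i p),
      (1/2) *\<^sub>R area (plane p) (representation (frame p) v (N0 p), \<chi> i. representation (frame p) v (Ni i p))) = v"
    unfolding sum_frame frame_combination .
  then show "vert v = (1/2) *\<^sub>R area (plane p) (plane v)"
    by (metis fst_conv plane_def snd_conv vert_def)
next
  assume v: "vert v = (1/2) *\<^sub>R area (plane p) (plane v)"
  have "v = fst v *\<^sub>R N0 p + (\<Sum>i\<in>UNIV. (fst (snd v) $ i) *\<^sub>R Ni i p)"
    unfolding frame_combination using v by (simp add: prod_eq_iff plane_def vert_def)
  moreover have "\<dots> \<in> span (frame p)"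
    by (intro span_add span_scale span_sum span_base) (auto simp: frame_def)
  ultimately show "v \<in> distrib_N p" unfolding distrib_N_def by metis
qed

lemma sr_metric_self:
  assumes "v \<in> distrib_N p"
  shows "sr_metric p v v = (norm (plane v))\<^sup>2"
proof -
  let ?r = "representation (frame p) v"
  have "(\<Sum>b\<in>frame p. ?r b *\<^sub>R b) = v"
    using assms unfolding distrib_N_def by (intro sum_representation_eq independent_frame) auto
  then have "(?r (N0 p), \<chi> i. ?r (Ni i p), (1/2) *\<^sub>R area (plane p) (?r (N0 p), \<chi> i. ?r (Ni i p))) = v"
    unfolding sum_frame frame_combination .
  then have "plane v = (?r (N0 p), \<chi> i. ?r (Ni i p))"
    by (metis fst_conv plane_def snd_conv)
  then show ?thesis
    by (simp add: sr_metric_def sum_frame power2_norm_eq_inner inner_prod_def inner_vec_def)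
qed

definition hvel :: "(real \<Rightarrow> carnot) \<Rightarrow> real \<Rightarrow> hplane" where
  "hvel \<gamma> t = plane (vector_derivative \<gamma> (at t))"

lemma AE_lebesgue_on_Icc_iff:
  "(AE t in lebesgue_on {a..b::real}. P t) \<longleftrightarrow> (\<exists>N. negligible N \<and> (\<forall>t\<in>{a..b} - N. P t))"
proof -
  have "(AE t in lebesgue_on {a..b}. P t) \<longleftrightarrow> (AE t in lebesgue. t \<in> {a..b} \<longrightarrow> P t)"
    by (rule AE_restrict_space_iff) simp
  also have "\<dots> \<longleftrightarrow> (\<exists>N. negligible N \<and> (\<forall>t\<in>{a..b} - N. P t))"
  proof
    assume "AE t in lebesgue. t \<in> {a..b} \<longrightarrow> P t"
    then have "negligible {t. \<not> (t \<in> {a..b} \<longrightarrow> P t)}"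
      unfolding completion.AE_iff_null_sets negligible_iff_null_sets by simp
    then show "\<exists>N. negligible N \<and> (\<forall>t\<in>{a..b} - N. P t)"
      by (intro exI[of _ "{t. \<not> (t \<in> {a..b} \<longrightarrow> P t)}"]) auto
  next
    assume "\<exists>N. negligible N \<and> (\<forall>t\<in>{a..b} - N. P t)"
    then obtain N where "N \<in> null_sets lebesgue" "\<forall>t\<in>{a..b} - N. P t"
      unfolding negligible_iff_null_sets by blast
    then show "AE t in lebesgue. t \<in> {a..b} \<longrightarrow> P t"
      by (intro AE_I'[of N]) auto
  qed
  finally show ?thesis .
qed

lemma admissible_iff:
  "admissible \<gamma> a b \<longleftrightarrow> a \<le> b \<and> (\<exists>\<gamma>' N. lip_deriv \<gamma> \<gamma>' a b \<and> negligible N \<and>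
     (\<forall>t\<in>{a..b} - N. vert (\<gamma>' t) = (1/2) *\<^sub>R area (plane (\<gamma> t)) (plane (\<gamma>' t))))"
    (is "_ \<longleftrightarrow> _ \<and> ?R")
proof (cases "a \<le> b")
  case True
  have "admissible \<gamma> a b \<longleftrightarrow> ?R"
  proof
    assume "admissible \<gamma> a b"
    then obtain L N where L: "L-lipschitz_on {a..b} \<gamma>" and N: "negligible N"
      "\<And>t. t \<in> {a..b} - N \<Longrightarrow> \<gamma> differentiable (at t) \<and> vector_derivative \<gamma> (at t) \<in> distrib_N (\<gamma> t)"
      unfolding admissible_def AE_lebesgue_on_Icc_iff by blast
    have "lip_deriv \<gamma> (\<lambda>t. vector_derivative \<gamma> (at t)) a b"
      unfolding lip_deriv_def using L N by (auto simp flip: vector_derivative_works)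
    moreover have "\<forall>t\<in>{a..b} - N. vert (vector_derivative \<gamma> (at t)) =
        (1/2) *\<^sub>R area (plane (\<gamma> t)) (plane (vector_derivative \<gamma> (at t)))"
      using N(2) by (simp add: distrib_N_iff)
    ultimately show ?R using N(1) by blast
  next
    assume ?R
    then obtain \<gamma>' N where \<gamma>': "lip_deriv \<gamma> \<gamma>' a b" and N: "negligible N"
      "\<And>t. t \<in> {a..b} - N \<Longrightarrow> vert (\<gamma>' t) = (1/2) *\<^sub>R area (plane (\<gamma> t)) (plane (\<gamma>' t))"
      by blast
    obtain L M where M: "L-lipschitz_on {a..b} \<gamma>" "negligible M"
      "\<And>t. t \<in> {a..b} - M \<Longrightarrow> (\<gamma> has_vector_derivative \<gamma>' t) (at t)"
      using lip_derivE[OF \<gamma>'] by metis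
    have "\<gamma> differentiable (at t) \<and> vector_derivative \<gamma> (at t) \<in> distrib_N (\<gamma> t)"
      if "t \<in> {a..b} - (N \<union> M)" for t
      using M(3)[of t] N(2)[of t] that
      by (auto simp: vector_derivative_at distrib_N_iff intro: differentiableI_vector)
    then show "admissible \<gamma> a b"
      unfolding admissible_def AE_lebesgue_on_Icc_iff using True M(1) negligible_Un[OF N(1) M(2)]
      by blast
  qed
  with True show ?thesis by simp
qed (simp add: admissible_def)

lemma admissible_le: "admissible \<gamma> a b \<Longrightarrow> a \<le> b" by (simp add: admissible_def)

lemma lip_deriv_cong_ae:
  assumes "lip_deriv f f' a b" "negligible N" "\<And>t. t \<in> {a..b} - N \<Longrightarrow> f' t = g' t"
  shows "lip_deriv f g' a b"
proof -
  obtain L M where M: "L-lipschitz_on {a..b} f" "negligible M"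
      "\<And>t. t \<in> {a..b} - M \<Longrightarrow> (f has_vector_derivative f' t) (at t)"
    using lip_derivE[OF assms(1)] by metis
  have "\<forall>t\<in>{a..b} - (M \<union> N). (f has_vector_derivative g' t) (at t)"
    using M(3) assms(3) by (metis DiffE DiffI UnI1 UnI2)
  then show ?thesis
    unfolding lip_deriv_def using M(1) negligible_Un[OF M(2) assms(2)] by blast
qed

lemma admissible_lip_deriv:
  assumes "admissible \<gamma> a b"
  shows admissible_lip_deriv_curve: "lip_deriv \<gamma> (\<lambda>t. vector_derivative \<gamma> (at t)) a b"
    and admissible_lip_deriv_plane: "lip_deriv (\<lambda>t. plane (\<gamma> t)) (hvel \<gamma>) a b"
    and admissible_lip_deriv_vert:
      "lip_deriv (\<lambda>t. vert (\<gamma> t)) (\<lambda>t. (1/2) *\<^sub>R area (plane (\<gamma> t)) (hvel \<gamma> t)) a b"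
proof -
  obtain L N where L: "L-lipschitz_on {a..b} \<gamma>" and N: "negligible N"
      "\<And>t. t \<in> {a..b} - N \<Longrightarrow> \<gamma> differentiable (at t) \<and> vector_derivative \<gamma> (at t) \<in> distrib_N (\<gamma> t)"
    using assms unfolding admissible_def AE_lebesgue_on_Icc_iff by blast
  show 1: "lip_deriv \<gamma> (\<lambda>t. vector_derivative \<gamma> (at t)) a b"
    unfolding lip_deriv_def using L N by (auto simp flip: vector_derivative_works)
  show "lip_deriv (\<lambda>t. plane (\<gamma> t)) (hvel \<gamma>) a b"
    unfolding hvel_def by (rule lip_deriv_bounded_linear[OF bounded_linear_plane 1])
  show "lip_deriv (\<lambda>t. vert (\<gamma> t)) (\<lambda>t. (1/2) *\<^sub>R area (plane (\<gamma> t)) (hvel \<gamma> t)) a b"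
    by (rule lip_deriv_cong_ae[OF lip_deriv_bounded_linear[OF bounded_linear_vert 1] N(1)])
      (use N(2) in \<open>auto simp: hvel_def distrib_N_iff\<close>)
qed

lemma sr_length_has_integral:
  assumes "admissible \<gamma> a b"
  shows "(speed \<gamma> has_integral sr_length \<gamma> a b) {a..b}"
    and "((\<lambda>t. norm (hvel \<gamma> t)) has_integral sr_length \<gamma> a b) {a..b}"
proof -
  obtain N where N: "negligible N"
      "\<And>t. t \<in> {a..b} - N \<Longrightarrow> vector_derivative \<gamma> (at t) \<in> distrib_N (\<gamma> t)"
    using assms unfolding admissible_def AE_lebesgue_on_Icc_iff by blast
  have eq: "speed \<gamma> t = norm (hvel \<gamma> t)" if "t \<in> {a..b} - N" for t
    using N(2)[OF that] by (simp add: speed_def sr_metric_self hvel_def)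
  have i: "(\<lambda>t. norm (hvel \<gamma> t)) integrable_on {a..b}"
    by (rule lip_deriv_integrable[OF admissible_lip_deriv_plane[OF assms], of "\<lambda>t v. norm v"])
      (auto simp: case_prod_unfold intro!: continuous_intros)
  then have "speed \<gamma> integrable_on {a..b}"
    by (rule integrable_spike[OF _ N(1)]) (use eq in auto)
  then show 1: "(speed \<gamma> has_integral sr_length \<gamma> a b) {a..b}"
    unfolding sr_length_def by (rule integrable_integral)
  show "((\<lambda>t. norm (hvel \<gamma> t)) has_integral sr_length \<gamma> a b) {a..b}"
    by (rule has_integral_spike[OF N(1) _ 1]) (use eq in auto)
qed

lemma admissible_unit_speed:
  assumes "admissible \<gamma> a b" "AE t in lebesgue_on {a..b}. speed \<gamma> t = 1"
  obtains N where "negligible N" "\<And>t. t \<in> {a..b} - N \<Longrightarrow> norm (hvel \<gamma> t) = 1"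
proof -
  obtain N where N: "negligible N"
      "\<And>t. t \<in> {a..b} - N \<Longrightarrow> vector_derivative \<gamma> (at t) \<in> distrib_N (\<gamma> t)"
    using assms(1) unfolding admissible_def AE_lebesgue_on_Icc_iff by blast
  obtain M where M: "negligible M" "\<And>t. t \<in> {a..b} - M \<Longrightarrow> speed \<gamma> t = 1"
    using assms(2) unfolding AE_lebesgue_on_Icc_iff by blast
  have "norm (hvel \<gamma> t) = 1" if "t \<in> {a..b} - (N \<union> M)" for t
  proof -
    have "speed \<gamma> t = norm (hvel \<gamma> t)"
      using N(2)[of t] that by (simp add: speed_def sr_metric_self hvel_def)
    then show ?thesis using M(2)[of t] that by simp
  qed
  then show ?thesis using that negligible_Un[OF N(1) M(1)] by blast
qed

definition hcurve :: "(real \<Rightarrow> carnot) \<Rightarrow> (real \<Rightarrow> carnot) \<Rightarrow> real \<Rightarrow> real \<Rightarrow> bool" where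
  "hcurve \<gamma> \<gamma>' a b \<longleftrightarrow> a \<le> b \<and> lip_deriv \<gamma> \<gamma>' a b \<and> (\<exists>N. negligible N \<and>
     (\<forall>t\<in>{a..b} - N. vert (\<gamma>' t) = (1/2) *\<^sub>R area (plane (\<gamma> t)) (plane (\<gamma>' t))))"

lemma admissible_iff_hcurve: "admissible \<gamma> a b \<longleftrightarrow> (\<exists>\<gamma>'. hcurve \<gamma> \<gamma>' a b)"
  unfolding admissible_iff hcurve_def by blast

lemma hcurve_admissible: "hcurve \<gamma> \<gamma>' a b \<Longrightarrow> admissible \<gamma> a b"
  unfolding admissible_iff_hcurve by blast

lemma hcurve_hvel:
  assumes "hcurve \<gamma> \<gamma>' a b"
  obtains N where "negligible N" "\<And>t. t \<in> {a..b} - N \<Longrightarrow> hvel \<gamma> t = plane (\<gamma>' t)"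
proof -
  obtain L N where "negligible N" "\<And>t. t \<in> {a..b} - N \<Longrightarrow> (\<gamma> has_vector_derivative \<gamma>' t) (at t)"
    using assms lip_derivE unfolding hcurve_def by metis
  then have "hvel \<gamma> t = plane (\<gamma>' t)" if "t \<in> {a..b} - N" for t
    unfolding hvel_def using vector_derivative_at that by metis
  with \<open>negligible N\<close> show ?thesis by (rule that)
qed

lemma hcurve_length:
  assumes "hcurve \<gamma> \<gamma>' a b"
  shows "((\<lambda>t. norm (plane (\<gamma>' t))) has_integral sr_length \<gamma> a b) {a..b}"
proof -
  obtain N where N: "negligible N" "\<And>t. t \<in> {a..b} - N \<Longrightarrow> hvel \<gamma> t = plane (\<gamma>' t)"
    using hcurve_hvel[OF assms] by metis
  show ?thesis
    by (rule has_integral_spike[OF N(1) _ sr_length_has_integral(2)[OF hcurve_admissible[OF assms]]])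
      (simp add: N(2))
qed

lemma hcurve_length_eqI:
  assumes "hcurve \<gamma> \<gamma>' a b" "((\<lambda>t. norm (plane (\<gamma>' t))) has_integral l) {a..b}"
  shows "sr_length \<gamma> a b = l"
  using has_integral_unique[OF hcurve_length[OF assms(1)] assms(2)] .

lemma hcurve_mono:
  assumes "hcurve \<gamma> \<gamma>' a b" "a \<le> s" "s \<le> t" "t \<le> b"
  shows "hcurve \<gamma> \<gamma>' s t"
proof -
  obtain N where "negligible N"
     "\<forall>t\<in>{a..b} - N. vert (\<gamma>' t) = (1/2) *\<^sub>R area (plane (\<gamma> t)) (plane (\<gamma>' t))"
    using assms(1) unfolding hcurve_def by blast
  moreover have "{s..t} - N \<subseteq> {a..b} - N" using assms by auto
  moreover have "lip_deriv \<gamma> \<gamma>' s t"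
    by (rule lip_deriv_mono[of _ _ a b]) (use assms in \<open>auto simp: hcurve_def\<close>)
  ultimately show ?thesis
    unfolding hcurve_def using assms(3) by blast
qed

lemma hcurve_C1:
  assumes "a \<le> b" "\<And>t. t \<in> {a..b} \<Longrightarrow> (\<gamma> has_vector_derivative \<gamma>' t) (at t within {a..b})"
    "continuous_on {a..b} \<gamma>'"
    "\<And>t. t \<in> {a..b} \<Longrightarrow> vert (\<gamma>' t) = (1/2) *\<^sub>R area (plane (\<gamma> t)) (plane (\<gamma>' t))"
  shows "hcurve \<gamma> \<gamma>' a b"
  unfolding hcurve_def using assms(1,4) lip_deriv_C1[OF assms(2,3)] negligible_empty by blast

text \<open>
  Competitors are built from their plane part alone; the vertical part is then forced, because its
  derivative is half the area swept by the plane part.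
\<close>
lemma horizontal_lift:
  fixes c c' :: "real \<Rightarrow> hplane"
  assumes "a \<le> b" "\<And>t. t \<in> {a..b} \<Longrightarrow> (c has_vector_derivative c' t) (at t within {a..b})"
    "continuous_on {a..b} c'"
  obtains \<gamma> \<gamma>' where "hcurve \<gamma> \<gamma>' a b" "\<And>t. plane (\<gamma> t) = c t" "\<And>t. plane (\<gamma>' t) = c' t"
    "vert (\<gamma> a) = y"
proof -
  define A where "A = (\<lambda>t. (1/2) *\<^sub>R area (c t) (c' t))"
  have cc: "continuous_on {a..b} c"
    unfolding continuous_on_eq_continuous_within using has_vector_derivative_continuous[OF assms(2)] by blast
  have cA: "continuous_on {a..b} A"
    unfolding A_def by (intro continuous_intros area.continuous_on cc assms(3))
  define \<gamma> where "\<gamma> = (\<lambda>t. (fst (c t), snd (c t), y + integral {a..t} A))"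
  define \<gamma>' where "\<gamma>' = (\<lambda>t. (fst (c' t), snd (c' t), A t))"
  have "hcurve \<gamma> \<gamma>' a b"
  proof (rule hcurve_C1[OF assms(1)])
    fix t assume t: "t \<in> {a..b}"
    have I: "((\<lambda>t. y + integral {a..t} A) has_vector_derivative A t) (at t within {a..b})"
      using has_vector_derivative_add[OF has_vector_derivative_const[of y] integral_has_vector_derivative[OF cA t]]
      by simp
    have f: "((\<lambda>t. fst (c t)) has_vector_derivative fst (c' t)) (at t within {a..b})"
      "((\<lambda>t. snd (c t)) has_vector_derivative snd (c' t)) (at t within {a..b})"
      using assms(2)[OF t] bounded_linear.has_vector_derivative bounded_linear_fst bounded_linear_snd
      by blast+
    show "(\<gamma> has_vector_derivative \<gamma>' t) (at t within {a..b})"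
      unfolding \<gamma>_def \<gamma>'_def by (intro has_vector_derivative_Pair f I)
    show "vert (\<gamma>' t) = (1/2) *\<^sub>R area (plane (\<gamma> t)) (plane (\<gamma>' t))"
      by (simp add: vert_def plane_def \<gamma>_def \<gamma>'_def A_def)
  next
    show "continuous_on {a..b} \<gamma>'"
      unfolding \<gamma>'_def by (intro continuous_intros cA assms(3))
  qed
  then show ?thesis
    using that[of \<gamma> \<gamma>'] by (simp add: \<gamma>_def \<gamma>'_def plane_def vert_def)
qed

lemma lip_deriv_concat:
  assumes f: "lip_deriv f f' a b" and g: "lip_deriv g g' b c" and fg: "f b = g b"
  shows "lip_deriv (\<lambda>t. if t \<le> b then f t else g t) (\<lambda>t. if t \<le> b then f' t else g' t) a c"
proof -
  obtain L N where 1: "L-lipschitz_on {a..b} f" "negligible N" "b \<in> N"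
      "\<And>t. t \<in> {a..b} - N \<Longrightarrow> (f has_vector_derivative f' t) (at t)"
    using lip_derivE[OF f] by metis
  obtain L' N' where 2: "L'-lipschitz_on {b..c} g" "negligible N'"
      "\<And>t. t \<in> {b..c} - N' \<Longrightarrow> (g has_vector_derivative g' t) (at t)"
    using lip_derivE[OF g] by metis
  let ?h = "\<lambda>t. if t \<le> b then f t else g t"
  have "\<exists>L. L-lipschitz_on {a..c} ?h"
    using lipschitz_on_concat_max[OF 1(1) 2(1) fg] by blast
  moreover have "(?h has_vector_derivative (if t \<le> b then f' t else g' t)) (at t)"
    if t: "t \<in> {a..c} - (N \<union> N')" for t
  proof (cases "t < b")
    case True
    have "(?h has_vector_derivative f' t) (at t)"
      by (rule has_vector_derivative_transform_within_open[of f _ _ "{..<b}"]) (use True t 1(4) in auto)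
    then show ?thesis using True by simp
  next
    case False
    then have "t > b" using t 1(3) by (cases "t = b") auto
    have "(?h has_vector_derivative g' t) (at t)"
      by (rule has_vector_derivative_transform_within_open[of g _ _ "{b<..}"]) (use \<open>t > b\<close> t 2(3) in auto)
    then show ?thesis using \<open>t > b\<close> by simp
  qed
  ultimately show ?thesis
    unfolding lip_deriv_def using negligible_Un[OF 1(2) 2(2)] by blast
qed

lemma hcurve_concat:
  assumes f: "hcurve \<gamma> \<gamma>' a b" and g: "hcurve \<eta> \<eta>' b c" and fg: "\<gamma> b = \<eta> b"
  shows "hcurve (\<lambda>t. if t \<le> b then \<gamma> t else \<eta> t) (\<lambda>t. if t \<le> b then \<gamma>' t else \<eta>' t) a c"
    and "sr_length (\<lambda>t. if t \<le> b then \<gamma> t else \<eta> t) a c = sr_length \<gamma> a b + sr_length \<eta> b c"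
proof -
  have le: "a \<le> b" "b \<le> c" using f g by (auto simp: hcurve_def)
  obtain N where 1: "negligible N"
     "\<forall>t\<in>{a..b} - N. vert (\<gamma>' t) = (1/2) *\<^sub>R area (plane (\<gamma> t)) (plane (\<gamma>' t))"
    using f unfolding hcurve_def by blast
  obtain N' where 2: "negligible N'"
     "\<forall>t\<in>{b..c} - N'. vert (\<eta>' t) = (1/2) *\<^sub>R area (plane (\<eta> t)) (plane (\<eta>' t))"
    using g unfolding hcurve_def by blast
  let ?\<rho> = "\<lambda>t. if t \<le> b then \<gamma> t else \<eta> t" and ?\<rho>' = "\<lambda>t. if t \<le> b then \<gamma>' t else \<eta>' t"
  have "lip_deriv ?\<rho> ?\<rho>' a c"
    by (rule lip_deriv_concat) (use f g fg in \<open>auto simp: hcurve_def\<close>)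
  moreover have "\<forall>t\<in>{a..c} - (N \<union> N'). vert (?\<rho>' t) = (1/2) *\<^sub>R area (plane (?\<rho> t)) (plane (?\<rho>' t))"
    using 1(2) 2(2) by auto
  ultimately show h: "hcurve ?\<rho> ?\<rho>' a c"
    unfolding hcurve_def using order_trans[OF le] negligible_Un[OF 1(1) 2(1)] by blast
  show "sr_length ?\<rho> a c = sr_length \<gamma> a b + sr_length \<eta> b c"
  proof (rule hcurve_length_eqI[OF h], rule has_integral_combine[OF le])
    show "((\<lambda>t. norm (plane (?\<rho>' t))) has_integral sr_length \<gamma> a b) {a..b}"
      by (rule has_integral_eq[OF _ hcurve_length[OF f]]) simp
    show "((\<lambda>t. norm (plane (?\<rho>' t))) has_integral sr_length \<eta> b c) {b..c}"
      by (rule has_integral_spike[OF _ _ hcurve_length[OF g], of "{b}"]) auto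
  qed
qed

lemma hcurve_shift:
  assumes f: "hcurve \<gamma> \<gamma>' a b"
  shows "hcurve (\<lambda>t. \<gamma> (t - s)) (\<lambda>t. \<gamma>' (t - s)) (a + s) (b + s)"
    and "sr_length (\<lambda>t. \<gamma> (t - s)) (a + s) (b + s) = sr_length \<gamma> a b"
proof -
  obtain L N where 1: "L-lipschitz_on {a..b} \<gamma>" "negligible N"
      "\<And>t. t \<in> {a..b} - N \<Longrightarrow> (\<gamma> has_vector_derivative \<gamma>' t) (at t)"
    using f lip_derivE unfolding hcurve_def by metis
  obtain M where 2: "negligible M"
     "\<forall>t\<in>{a..b} - M. vert (\<gamma>' t) = (1/2) *\<^sub>R area (plane (\<gamma> t)) (plane (\<gamma>' t))"
    using f unfolding hcurve_def by blast
  have "L-lipschitz_on {a + s..b + s} (\<lambda>t. \<gamma> (t - s))"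
  proof (rule lipschitz_onI)
    fix u t assume "u \<in> {a + s..b + s}" "t \<in> {a + s..b + s}"
    then show "dist (\<gamma> (u - s)) (\<gamma> (t - s)) \<le> L * dist u t"
      using lipschitz_onD[OF 1(1), of "u - s" "t - s"] by (auto simp: dist_real_def)
  qed (rule lipschitz_on_nonneg[OF 1(1)])
  moreover have "((\<lambda>t. \<gamma> (t - s)) has_vector_derivative \<gamma>' (t - s)) (at t)"
    if t: "t \<in> {a + s..b + s} - (+) s ` N" for t
  proof -
    have "t - s \<notin> N"
    proof
      assume "t - s \<in> N"
      then have "s + (t - s) \<in> (+) s ` N" by (rule imageI)
      then show False using t by simp
    qed
    then have "(\<gamma> has_vector_derivative \<gamma>' (t - s)) (at (t - s))" using 1(3) t by auto
    moreover have "((\<lambda>t. t - s) has_vector_derivative 1) (at t)"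
      by (auto intro!: derivative_eq_intros)
    ultimately show ?thesis
      using vector_diff_chain_at[of "\<lambda>t. t - s" 1 t \<gamma> "\<gamma>' (t - s)"] by (simp add: o_def)
  qed
  moreover have "negligible ((+) s ` N)" "negligible ((+) s ` M)"
    using 1 2 by (auto intro: negligible_translation)
  moreover have "\<forall>t\<in>{a + s..b + s} - (+) s ` M. vert (\<gamma>' (t - s)) =
      (1/2) *\<^sub>R area (plane (\<gamma> (t - s))) (plane (\<gamma>' (t - s)))"
  proof
    fix t assume t: "t \<in> {a + s..b + s} - (+) s ` M"
    have "t - s \<notin> M"
    proof
      assume "t - s \<in> M"
      then have "s + (t - s) \<in> (+) s ` M" by (rule imageI)
      then show False using t by simp
    qed
    then show "vert (\<gamma>' (t - s)) = (1/2) *\<^sub>R area (plane (\<gamma> (t - s))) (plane (\<gamma>' (t - s)))"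
      using 2(2) t by auto
  qed
  moreover have "a + s \<le> b + s" using f by (simp add: hcurve_def)
  ultimately show h: "hcurve (\<lambda>t. \<gamma> (t - s)) (\<lambda>t. \<gamma>' (t - s)) (a + s) (b + s)"
    unfolding hcurve_def lip_deriv_def by blast
  show "sr_length (\<lambda>t. \<gamma> (t - s)) (a + s) (b + s) = sr_length \<gamma> a b"
    using hcurve_length_eqI[OF h] has_integral_shift_real_ivl[OF hcurve_length[OF f], of "- s"] by simp
qed

lemma hcurve_reverse:
  assumes f: "hcurve \<gamma> \<gamma>' a b"
  shows "hcurve (\<lambda>t. \<gamma> (- t)) (\<lambda>t. - \<gamma>' (- t)) (- b) (- a)"
    and "sr_length (\<lambda>t. \<gamma> (- t)) (- b) (- a) = sr_length \<gamma> a b"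
proof -
  obtain L N where 1: "L-lipschitz_on {a..b} \<gamma>" "negligible N"
      "\<And>t. t \<in> {a..b} - N \<Longrightarrow> (\<gamma> has_vector_derivative \<gamma>' t) (at t)"
    using f lip_derivE unfolding hcurve_def by metis
  obtain M where 2: "negligible M"
     "\<forall>t\<in>{a..b} - M. vert (\<gamma>' t) = (1/2) *\<^sub>R area (plane (\<gamma> t)) (plane (\<gamma>' t))"
    using f unfolding hcurve_def by blast
  have "L-lipschitz_on {- b..- a} (\<lambda>t. \<gamma> (- t))"
  proof (rule lipschitz_onI)
    fix s t assume "s \<in> {- b..- a}" "t \<in> {- b..- a}"
    then show "dist (\<gamma> (- s)) (\<gamma> (- t)) \<le> L * dist s t"
      using lipschitz_onD[OF 1(1), of "- s" "- t"] by (auto simp: dist_real_def abs_minus_commute)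
  qed (rule lipschitz_on_nonneg[OF 1(1)])
  moreover have "((\<lambda>t. \<gamma> (- t)) has_vector_derivative - \<gamma>' (- t)) (at t)"
    if t: "t \<in> {- b..- a} - uminus ` N" for t
  proof -
    have "- t \<notin> N" using t by (metis DiffD2 image_eqI minus_minus)
    then have "(\<gamma> has_vector_derivative \<gamma>' (- t)) (at (- t))" using 1(3) t by auto
    moreover have "((\<lambda>t. - t) has_vector_derivative - 1) (at t)" for t :: real
      by (auto intro!: derivative_eq_intros)
    ultimately show ?thesis
      using vector_diff_chain_at[of "\<lambda>t. - t" "- 1" t \<gamma> "\<gamma>' (- t)"] by (simp add: o_def)
  qed
  moreover have neg: "negligible (uminus ` X)" if "negligible X" for X :: "real set"
    by (rule negligible_differentiable_image_negligible[OF _ that]) (auto intro: derivative_intros)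
  moreover have "\<forall>t\<in>{- b..- a} - uminus ` M. vert (- \<gamma>' (- t)) =
      (1/2) *\<^sub>R area (plane (\<gamma> (- t))) (plane (- \<gamma>' (- t)))"
  proof
    fix t assume t: "t \<in> {- b..- a} - uminus ` M"
    have "- t \<notin> M" using t by (metis DiffD2 image_eqI minus_minus)
    then have "vert (\<gamma>' (- t)) = (1/2) *\<^sub>R area (plane (\<gamma> (- t))) (plane (\<gamma>' (- t)))"
      using 2(2) t by auto
    then show "vert (- \<gamma>' (- t)) = (1/2) *\<^sub>R area (plane (\<gamma> (- t))) (plane (- \<gamma>' (- t)))"
      by (simp add: vert_def plane_def area_def algebra_simps)
  qed
  moreover have "- b \<le> - a" using f by (simp add: hcurve_def)
  ultimately show h: "hcurve (\<lambda>t. \<gamma> (- t)) (\<lambda>t. - \<gamma>' (- t)) (- b) (- a)"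
    unfolding hcurve_def lip_deriv_def using neg[OF 1(2)] neg[OF 2(1)] by blast
  have "((\<lambda>t. norm (plane (\<gamma>' (- t)))) has_integral sr_length \<gamma> a b) {- b..- a}"
    using has_integral_reflect_real[of "\<lambda>t. norm (plane (\<gamma>' t))"] hcurve_length[OF f] by simp
  moreover have "norm (plane (- v)) = norm (plane v)" for v
    by (simp add: plane_def norm_prod_def)
  ultimately show "sr_length (\<lambda>t. \<gamma> (- t)) (- b) (- a) = sr_length \<gamma> a b"
    using hcurve_length_eqI[OF h] by simp
qed

lemma hcurve_cong:
  assumes f: "hcurve \<gamma> \<gamma>' a b" and eq: "\<And>t. t \<in> {a..b} \<Longrightarrow> \<eta> t = \<gamma> t"
  shows "hcurve \<eta> \<gamma>' a b" and "sr_length \<eta> a b = sr_length \<gamma> a b"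
proof -
  obtain L N where 1: "L-lipschitz_on {a..b} \<gamma>" "negligible N" "a \<in> N" "b \<in> N"
      "\<And>t. t \<in> {a..b} - N \<Longrightarrow> (\<gamma> has_vector_derivative \<gamma>' t) (at t)"
    using f lip_derivE unfolding hcurve_def by metis
  obtain M where 2: "negligible M"
     "\<forall>t\<in>{a..b} - M. vert (\<gamma>' t) = (1/2) *\<^sub>R area (plane (\<gamma> t)) (plane (\<gamma>' t))"
    using f unfolding hcurve_def by blast
  have "L-lipschitz_on {a..b} \<eta>"
    by (rule lipschitz_on_transform[OF 1(1)]) (simp add: eq)
  moreover have "(\<eta> has_vector_derivative \<gamma>' t) (at t)" if "t \<in> {a..b} - N" for t
  proof -
    have "t \<in> {a<..<b}" using that 1(3,4) by (cases "t = a"; cases "t = b") auto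
    then show ?thesis
      by (rule has_vector_derivative_transform_within_open[OF 1(5)[OF that] open_greaterThanLessThan])
        (simp add: eq)
  qed
  moreover have "\<forall>t\<in>{a..b} - M. vert (\<gamma>' t) = (1/2) *\<^sub>R area (plane (\<eta> t)) (plane (\<gamma>' t))"
    using 2(2) eq by auto
  ultimately show h: "hcurve \<eta> \<gamma>' a b"
    unfolding hcurve_def lip_deriv_def using 1(2) 2(1) f[unfolded hcurve_def, THEN conjunct1] by blast
  show "sr_length \<eta> a b = sr_length \<gamma> a b"
    by (rule hcurve_length_eqI[OF h hcurve_length[OF f]])
qed

section \<open>Lengths of connecting curves and minimizers\<close>

definition reach :: "carnot \<Rightarrow> carnot \<Rightarrow> real \<Rightarrow> bool" where
  "reach p q l \<longleftrightarrow> (\<exists>\<eta> c d. admissible \<eta> c d \<and> \<eta> c = p \<and> \<eta> d = q \<and> sr_length \<eta> c d = l)"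

lemma reachI: "admissible \<eta> c d \<Longrightarrow> reach (\<eta> c) (\<eta> d) (sr_length \<eta> c d)"
  unfolding reach_def by blast

lemma length_minimizing_iff:
  "length_minimizing \<gamma> a b \<longleftrightarrow>
     admissible \<gamma> a b \<and> (\<forall>l. reach (\<gamma> a) (\<gamma> b) l \<longrightarrow> sr_length \<gamma> a b \<le> l)"
  unfolding length_minimizing_def reach_def by metis

lemma reach_trans:
  assumes "reach p q l" "reach q r m" shows "reach p r (l + m)"
proof -
  obtain \<gamma> \<gamma>' a b where g: "hcurve \<gamma> \<gamma>' a b" "\<gamma> a = p" "\<gamma> b = q" "sr_length \<gamma> a b = l"
    using assms(1) unfolding reach_def admissible_iff_hcurve by blast
  obtain \<eta> \<eta>' c d where e: "hcurve \<eta> \<eta>' c d" "\<eta> c = q" "\<eta> d = r" "sr_length \<eta> c d = m"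
    using assms(2) unfolding reach_def admissible_iff_hcurve by blast
  let ?\<eta> = "\<lambda>t. \<eta> (t - (b - c))"
  have e': "hcurve ?\<eta> (\<lambda>t. \<eta>' (t - (b - c))) b (d + (b - c))" "sr_length ?\<eta> b (d + (b - c)) = m"
    using hcurve_shift[OF e(1), of "b - c"] e(4) by auto
  have "\<gamma> b = ?\<eta> b" using g e by simp
  note * = hcurve_concat[OF g(1) e'(1) this]
  have le: "a \<le> b" "c \<le> d" using g(1) e(1) by (auto simp: hcurve_def)
  have "(if d + (b - c) \<le> b then \<gamma> (d + (b - c)) else ?\<eta> (d + (b - c))) = r"
    using le g e by (cases "d = c") auto
  then show ?thesis
    using reachI[OF hcurve_admissible[OF *(1)]] le g(2,4) e'(2) *(2) by simp
qed

lemma reach_sym: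
  assumes "reach p q l" shows "reach q p l"
proof -
  obtain \<gamma> \<gamma>' a b where g: "hcurve \<gamma> \<gamma>' a b" "\<gamma> a = p" "\<gamma> b = q" "sr_length \<gamma> a b = l"
    using assms(1) unfolding reach_def admissible_iff_hcurve by blast
  show ?thesis
    using reachI[OF hcurve_admissible[OF hcurve_reverse(1)[OF g(1)]]] hcurve_reverse(2)[OF g(1)] g by simp
qed

lemma reach_refl: "reach p p 0"
proof -
  have "hcurve (\<lambda>_. p) (\<lambda>_. 0) 0 1"
    by (rule hcurve_C1) (auto simp: plane_def vert_def area_def)
  moreover have "sr_length (\<lambda>_. p) 0 1 = 0"
    by (rule hcurve_length_eqI[OF calculation]) (simp add: plane_def)
  ultimately show ?thesis
    using reachI[OF hcurve_admissible] by metis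
qed

lemma reach_nonneg: "reach p q l \<Longrightarrow> l \<ge> 0"
  unfolding reach_def using sr_length_has_integral(2) has_integral_nonneg norm_ge_zero by blast

lemma sr_length_split:
  assumes "admissible \<gamma> a b" "a \<le> s" "s \<le> b"
  shows "admissible \<gamma> a s" "admissible \<gamma> s b" "sr_length \<gamma> a b = sr_length \<gamma> a s + sr_length \<gamma> s b"
proof -
  obtain \<gamma>' where g: "hcurve \<gamma> \<gamma>' a b" using assms(1) unfolding admissible_iff_hcurve by blast
  have 1: "hcurve \<gamma> \<gamma>' a s" and 2: "hcurve \<gamma> \<gamma>' s b"
    by (rule hcurve_mono[OF g]; use assms in simp)+
  show "admissible \<gamma> a s" "admissible \<gamma> s b" using 1 2 hcurve_admissible by auto
  show "sr_length \<gamma> a b = sr_length \<gamma> a s + sr_length \<gamma> s b"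
    by (rule hcurve_length_eqI[OF g has_integral_combine[OF assms(2,3) hcurve_length[OF 1] hcurve_length[OF 2]]])
qed

lemma length_minimizing_mono:
  assumes m: "length_minimizing \<gamma> a b" and st: "a \<le> s" "s \<le> t" "t \<le> b"
  shows "length_minimizing \<gamma> s t"
proof -
  have ad: "admissible \<gamma> a b" using m by (simp add: length_minimizing_iff)
  note 1 = sr_length_split[OF ad, of s] and 2 = sr_length_split[OF sr_length_split(2)[OF ad, of s], of t]
  show ?thesis
    unfolding length_minimizing_iff
  proof (intro conjI allI impI)
    show "admissible \<gamma> s t" using 2 st by simp
    fix l assume l: "reach (\<gamma> s) (\<gamma> t) l"
    have "reach (\<gamma> a) (\<gamma> b) (sr_length \<gamma> a s + (l + sr_length \<gamma> t b))"
      by (rule reach_trans[OF reachI[OF 1(1)] reach_trans[OF l reachI[OF 2(2)]]]) (use st in auto)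
    then have "sr_length \<gamma> a b \<le> sr_length \<gamma> a s + (l + sr_length \<gamma> t b)"
      using m by (simp add: length_minimizing_iff)
    then show "sr_length \<gamma> s t \<le> l" using 1 2 st by simp
  qed
qed

lemma length_minimizing_cong:
  assumes "length_minimizing \<gamma> a b" "\<And>t. t \<in> {a..b} \<Longrightarrow> \<eta> t = \<gamma> t"
  shows "length_minimizing \<eta> a b"
proof -
  obtain \<gamma>' where g: "hcurve \<gamma> \<gamma>' a b"
    using assms(1) unfolding length_minimizing_iff admissible_iff_hcurve by blast
  have "a \<le> b" using g by (simp add: hcurve_def)
  then have "\<eta> a = \<gamma> a" "\<eta> b = \<gamma> b" by (simp_all add: assms(2))
  moreover have "admissible \<eta> a b" "sr_length \<eta> a b = sr_length \<gamma> a b"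
    using hcurve_cong[OF g assms(2)] hcurve_admissible by simp_all
  ultimately show ?thesis
    using assms(1) unfolding length_minimizing_iff by simp
qed

text \<open>
  A shorter connection to the end point, followed by the last bit of \<open>\<gamma>\<close> run through backwards, would be a
  shorter connection to a point slightly before it.
\<close>
lemma length_minimizing_closed:
  assumes ad: "admissible \<gamma> a b" and ab: "a < b"
    and m: "\<And>t. a < t \<Longrightarrow> t < b \<Longrightarrow> length_minimizing \<gamma> a t"
  shows "length_minimizing \<gamma> a b"
  unfolding length_minimizing_iff
proof (intro conjI allI impI ad)
  fix l assume l: "reach (\<gamma> a) (\<gamma> b) l"
  let ?S = "\<lambda>t. integral {a..t} (speed \<gamma>)"
  have le: "sr_length \<gamma> a b \<le> l + 2 * (sr_length \<gamma> a b - ?S t)" if t: "a < t" "t < b" for t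
  proof -
    note s = sr_length_split[OF ad, of t]
    have "reach (\<gamma> a) (\<gamma> t) (l + sr_length \<gamma> t b)"
      by (rule reach_trans[OF l reach_sym[OF reachI[OF s(2)]]]) (use t in auto)
    then have "sr_length \<gamma> a t \<le> l + sr_length \<gamma> t b"
      using m[OF t] by (simp add: length_minimizing_iff)
    moreover have "?S t = sr_length \<gamma> a t" by (simp add: sr_length_def)
    ultimately show ?thesis using s t by simp
  qed
  have "continuous_on {a..b} ?S"
    by (rule indefinite_integral_continuous_1) (use sr_length_has_integral(1)[OF ad] in blast)
  then have "(?S \<longlongrightarrow> ?S b) (at b within {a..b})"
    using ab by (simp add: continuous_on_def)
  then have lim: "(?S \<longlongrightarrow> sr_length \<gamma> a b) (at_left b)"
    using ab by (simp add: at_within_Icc_at_left sr_length_def)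
  have "((\<lambda>t. l + 2 * (sr_length \<gamma> a b - ?S t)) \<longlongrightarrow> l + 2 * (sr_length \<gamma> a b - sr_length \<gamma> a b)) (at_left b)"
    by (intro tendsto_intros lim)
  moreover have "\<forall>\<^sub>F t in at_left b. sr_length \<gamma> a b \<le> l + 2 * (sr_length \<gamma> a b - ?S t)"
    unfolding eventually_at_left[OF ab] using le ab by blast
  ultimately show "sr_length \<gamma> a b \<le> l"
    using tendsto_lowerbound by fastforce
qed

section \<open>Arcs and the first variation of the energy\<close>

definition dir :: "real \<Rightarrow> real \<Rightarrow> real^3 \<Rightarrow> real \<Rightarrow> hplane" where
  "dir \<phi> K k t = (cos (\<phi> + K * t), sin (\<phi> + K * t) *\<^sub>R k)"

text \<open>
  The horizontal curve from the origin whose plane part has unit speed, initial angle \<open>\<phi>\<close> and constant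
  curvature \<open>K\<close> in the plane spanned by the \<open>x\<close>-axis and \<open>k\<close>. Lines are the case \<open>K = 0\<close>.
\<close>
definition geod :: "real \<Rightarrow> real \<Rightarrow> real^3 \<Rightarrow> real \<Rightarrow> carnot" where
  "geod \<phi> K k t = (if K = 0 then (t * cos \<phi>, (t * sin \<phi>) *\<^sub>R k, 0)
     else ((sin (\<phi> + K * t) - sin \<phi>) / K, ((cos \<phi> - cos (\<phi> + K * t)) / K) *\<^sub>R k,
           ((K * t - sin (K * t)) / (2 * K\<^sup>2)) *\<^sub>R k))"

definition geod_vel :: "real \<Rightarrow> real \<Rightarrow> real^3 \<Rightarrow> real \<Rightarrow> carnot" where
  "geod_vel \<phi> K k t = (cos (\<phi> + K * t), sin (\<phi> + K * t) *\<^sub>R k, (if K = 0 then 0 else (1 - cos (K * t)) / (2 * K)) *\<^sub>R k)"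

lemma geod_0 [simp]: "geod \<phi> K k 0 = (0, 0, 0)" by (simp add: geod_def)

lemma plane_geod_vel [simp]: "plane (geod_vel \<phi> K k t) = dir \<phi> K k t"
  by (simp add: plane_def geod_vel_def dir_def)

lemma geod_has_vector_derivative: "(geod \<phi> K k has_vector_derivative geod_vel \<phi> K k t) (at t within S)"
proof (cases "K = 0")
  case True
  then have "geod \<phi> K k = (\<lambda>t. (t * cos \<phi>, (t * sin \<phi>) *\<^sub>R k, 0))"
    by (simp add: geod_def fun_eq_iff)
  moreover have "((\<lambda>t. (t * cos \<phi>, (t * sin \<phi>) *\<^sub>R k, 0 :: real^3)) has_vector_derivative
      (cos \<phi>, sin \<phi> *\<^sub>R k, 0)) (at t within S)"
    unfolding has_vector_derivative_def
    by (auto intro!: derivative_eq_intros simp: fun_eq_iff)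
  ultimately show ?thesis using True by (simp add: geod_vel_def)
next
  case False
  then have "geod \<phi> K k = (\<lambda>t. ((sin (\<phi> + K * t) - sin \<phi>) / K, ((cos \<phi> - cos (\<phi> + K * t)) / K) *\<^sub>R k,
           ((K * t - sin (K * t)) / (2 * K\<^sup>2)) *\<^sub>R k))"
    by (simp add: geod_def fun_eq_iff)
  moreover have "((\<lambda>t. ((sin (\<phi> + K * t) - sin \<phi>) / K, ((cos \<phi> - cos (\<phi> + K * t)) / K) *\<^sub>R k,
           ((K * t - sin (K * t)) / (2 * K\<^sup>2)) *\<^sub>R k)) has_vector_derivative
      (cos (\<phi> + K * t), sin (\<phi> + K * t) *\<^sub>R k, ((1 - cos (K * t)) / (2 * K)) *\<^sub>R k)) (at t within S)"
    by (intro has_vector_derivative_Pair bounded_linear.has_vector_derivative[OF bounded_linear_scaleR_left],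
        unfold has_real_derivative_iff_has_vector_derivative[symmetric])
      (use False in \<open>auto intro!: derivative_eq_intros simp: power2_eq_square field_simps\<close>)
  ultimately show ?thesis using False by (simp add: geod_vel_def)
qed

lemma dir_has_vector_derivative:
  "(dir \<phi> K k has_vector_derivative K *\<^sub>R (- sin (\<phi> + K * t), cos (\<phi> + K * t) *\<^sub>R k)) (at t within S)"
  unfolding has_vector_derivative_def dir_def
  by (rule derivative_eq_intros refl)+ (auto simp: fun_eq_iff algebra_simps)

lemma vert_geod_vel: "vert (geod_vel \<phi> K k t) = (1/2) *\<^sub>R area (plane (geod \<phi> K k t)) (dir \<phi> K k t)"
proof (cases "K = 0")
  case False
  have "cos (K * t) = cos (\<phi> + K * t) * cos \<phi> + sin (\<phi> + K * t) * sin \<phi>"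
    using cos_diff[of "\<phi> + K * t" \<phi>] by simp
  moreover have "K * (cos (\<phi> + K * t) * cos (\<phi> + K * t)) + K * (sin (\<phi> + K * t) * sin (\<phi> + K * t)) = K"
    by (simp flip: distrib_left power2_eq_square)
  ultimately have "(1 - cos (K * t)) / (2 * K) = (1/2) * ((sin (\<phi> + K * t) - sin \<phi>) / K * sin (\<phi> + K * t)
      - cos (\<phi> + K * t) * ((cos \<phi> - cos (\<phi> + K * t)) / K))"
    using False by (simp add: field_simps power2_eq_square) 
  then show ?thesis
    using False by (simp add: vert_def area_def plane_def geod_def geod_vel_def dir_def flip: scaleR_diff_left)
qed (simp add: vert_def area_def plane_def geod_def geod_vel_def dir_def)

lemma norm_dir [simp]: "norm k = 1 \<Longrightarrow> norm (dir \<phi> K k t) = 1"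
  by (simp add: dir_def norm_prod_def)

text \<open>
  The Euler-Lagrange equation of the energy with multiplier \<open>- K *\<^sub>R k\<close> for the vertical end point.
\<close>
lemma dir_derivative_inner:
  assumes "norm k = 1"
  shows "(K *\<^sub>R (- sin (\<phi> + K * t), cos (\<phi> + K * t) *\<^sub>R k)) \<bullet> z = - K * (k \<bullet> area z (dir \<phi> K k t))"
proof -
  have "k \<bullet> k = 1" using assms by (simp add: norm_eq_1)
  then show ?thesis
    by (simp add: inner_prod_def area_def dir_def algebra_simps)
qed

lemma continuous_dir: "continuous_on S (dir \<phi> K k)"
  unfolding dir_def by (intro continuous_intros)

lemma continuous_geod_vel: "continuous_on S (geod_vel \<phi> K k)"
  unfolding geod_vel_def by (cases "K = 0") (auto intro!: continuous_intros)

lemma hcurve_geod: "a \<le> b \<Longrightarrow> hcurve (geod \<phi> K k) (geod_vel \<phi> K k) a b"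
  by (rule hcurve_C1[OF _ geod_has_vector_derivative continuous_geod_vel]) (auto simp: vert_geod_vel)

lemma length_geod:
  assumes "norm k = 1" "a \<le> b" shows "sr_length (geod \<phi> K k) a b = b - a"
  by (rule hcurve_length_eqI[OF hcurve_geod[OF assms(2)]])
    (use assms has_integral_const_real[of "1::real" a b] in simp)

text \<open>
  A horizontal curve \<open>\<gamma>\<close> is compared with the arc run through at the speed \<open>p\<close>. The freedom in \<open>p\<close>
  replaces a reparametrization of \<open>\<gamma>\<close> by arc length, which is singular where the
  speed of \<open>\<gamma>\<close> vanishes. \<open>z\<close> is the deviation of the plane parts. \<open>A\<close> is twice the
  deviation of the vertical parts, minus the part of it that is linear in \<open>z\<close> at the current point; its
  derivative contains no derivative of \<open>z\<close> except in the quadratic term. \<open>G\<close> is the boundary term that the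
  first variation of the energy leaves behind.
\<close>
locale deviation =
  fixes \<gamma> :: "real \<Rightarrow> carnot" and a b \<phi> K :: real and k :: "real^3" and \<sigma> p :: "real \<Rightarrow> real"
  assumes adm: "admissible \<gamma> a b" and k: "norm k = 1"
    and \<sigma>: "\<And>t. t \<in> {a..b} \<Longrightarrow> (\<sigma> has_vector_derivative p t) (at t within {a..b})"
    and p: "continuous_on {a..b} p" "\<And>t. t \<in> {a..b} \<Longrightarrow> p t > 0"
begin

definition z where "z t = plane (\<gamma> t) - plane (geod \<phi> K k (\<sigma> t))"
definition z' where "z' t = hvel \<gamma> t - p t *\<^sub>R dir \<phi> K k (\<sigma> t)"
definition A where "A t = 2 *\<^sub>R vert (\<gamma> t) - 2 *\<^sub>R vert (geod \<phi> K k (\<sigma> t)) - area (plane (geod \<phi> K k (\<sigma> t))) (z t)"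
definition G where "G t = 2 * (dir \<phi> K k (\<sigma> t) \<bullet> z t) + K * (k \<bullet> A t)"

lemma ab: "a \<le> b" using adm by (rule admissible_le)

lemma continuous_\<sigma>: "continuous_on {a..b} \<sigma>"
  unfolding continuous_on_eq_continuous_within using has_vector_derivative_continuous[OF \<sigma>] by blast

lemma lip_deriv_\<sigma>: "lip_deriv \<sigma> p a b" by (rule lip_deriv_C1[OF \<sigma> p(1)])

lemma lip_deriv_comp_\<sigma>:
  assumes "\<And>s. (f has_vector_derivative f' s) (at s)" "continuous_on UNIV f'"
  shows "lip_deriv (\<lambda>t. f (\<sigma> t)) (\<lambda>t. p t *\<^sub>R f' (\<sigma> t)) a b"
proof (rule lip_deriv_C1)
  fix t assume t: "t \<in> {a..b}"
  show "((\<lambda>t. f (\<sigma> t)) has_vector_derivative p t *\<^sub>R f' (\<sigma> t)) (at t within {a..b})"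
    using vector_diff_chain_within[OF \<sigma>[OF t] has_vector_derivative_at_within[OF assms(1)]]
    by (simp add: o_def)
next
  show "continuous_on {a..b} (\<lambda>t. p t *\<^sub>R f' (\<sigma> t))"
    by (intro continuous_intros p continuous_on_compose2[OF assms(2)] continuous_\<sigma>) auto
qed

lemma lip_deriv_geod: "lip_deriv (\<lambda>t. plane (geod \<phi> K k (\<sigma> t))) (\<lambda>t. p t *\<^sub>R dir \<phi> K k (\<sigma> t)) a b"
  and lip_deriv_vert_geod: "lip_deriv (\<lambda>t. vert (geod \<phi> K k (\<sigma> t)))
     (\<lambda>t. p t *\<^sub>R (1/2) *\<^sub>R area (plane (geod \<phi> K k (\<sigma> t))) (dir \<phi> K k (\<sigma> t))) a b"
proof -
  note 1 = lip_deriv_comp_\<sigma>[OF geod_has_vector_derivative continuous_geod_vel]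
  show "lip_deriv (\<lambda>t. plane (geod \<phi> K k (\<sigma> t))) (\<lambda>t. p t *\<^sub>R dir \<phi> K k (\<sigma> t)) a b"
    using lip_deriv_bounded_linear[OF bounded_linear_plane 1]
    by (simp add: linear_scale[OF bounded_linear.linear[OF bounded_linear_plane]])
  show "lip_deriv (\<lambda>t. vert (geod \<phi> K k (\<sigma> t)))
     (\<lambda>t. p t *\<^sub>R (1/2) *\<^sub>R area (plane (geod \<phi> K k (\<sigma> t))) (dir \<phi> K k (\<sigma> t))) a b"
    using lip_deriv_bounded_linear[OF bounded_linear_vert 1]
    by (simp add: linear_scale[OF bounded_linear.linear[OF bounded_linear_vert]] vert_geod_vel)
qed

lemma lip_deriv_z: "lip_deriv z z' a b"
  unfolding z_def z'_def
  by (rule lip_deriv_diff[OF admissible_lip_deriv_plane[OF adm] lip_deriv_geod])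

lemma lip_deriv_A: "lip_deriv A (\<lambda>t. area (z t) (z' t) + (2 * p t) *\<^sub>R area (z t) (dir \<phi> K k (\<sigma> t))) a b"
proof -
  note 1 = lip_deriv_diff[OF lip_deriv_diff[OF
      lip_deriv_bounded_linear[OF bounded_linear_scaleR_right[of 2] admissible_lip_deriv_vert[OF adm]]
      lip_deriv_bounded_linear[OF bounded_linear_scaleR_right[of 2] lip_deriv_vert_geod]]
      lip_deriv_bilinear[OF bounded_bilinear_area lip_deriv_geod lip_deriv_z]]
  have eq: "area (plane (\<gamma> t)) (hvel \<gamma> t) - p t *\<^sub>R area (plane (geod \<phi> K k (\<sigma> t))) (dir \<phi> K k (\<sigma> t)) -
      (area (plane (geod \<phi> K k (\<sigma> t))) (z' t) + area (p t *\<^sub>R dir \<phi> K k (\<sigma> t)) (z t)) =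
      area (z t) (z' t) + (2 * p t) *\<^sub>R area (z t) (dir \<phi> K k (\<sigma> t))" for t
  proof -
    have c: "plane (\<gamma> t) = plane (geod \<phi> K k (\<sigma> t)) + z t" "hvel \<gamma> t = z' t + p t *\<^sub>R dir \<phi> K k (\<sigma> t)"
      by (auto simp: z_def z'_def)
    have s: "area (dir \<phi> K k (\<sigma> t)) (z t) = - area (z t) (dir \<phi> K k (\<sigma> t))" by (rule area_swap)
    show ?thesis
      unfolding c area.add_left area.add_right area.scaleR_left area.scaleR_right s
      by (simp only: vec_eq_iff vector_add_component vector_minus_component vector_uminus_component
          vector_scaleR_component) (simp add: algebra_simps)
  qed
  have two: "2 *\<^sub>R (1/2) *\<^sub>R u = u" "2 *\<^sub>R c *\<^sub>R (1/2) *\<^sub>R u = c *\<^sub>R u" for u :: "real^3" and c :: real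
    by simp_all
  show ?thesis
    by (rule lip_deriv_cong_ae[OF 1[folded A_def] negligible_empty]) (simp only: two eq)
qed

text \<open>
  The arc is critical for the energy with multiplier, so all terms that are linear in the deviation are the
  derivative of \<open>G\<close>, and the difference of the energies is a quadratic form in the deviation.
\<close>
lemma lip_deriv_G:
  "lip_deriv G (\<lambda>t. (norm (hvel \<gamma> t))\<^sup>2 / p t - p t - (norm (z' t))\<^sup>2 / p t + K * (k \<bullet> area (z t) (z' t))) a b"
proof -
  have cd: "continuous_on UNIV (\<lambda>s. K *\<^sub>R (- sin (\<phi> + K * s), cos (\<phi> + K * s) *\<^sub>R k))"
    by (intro continuous_intros)
  note 1 = lip_deriv_add[OF
     lip_deriv_bounded_linear[OF bounded_linear_mult_right[of 2] lip_deriv_bilinear[OF bounded_bilinear_inner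
        lip_deriv_comp_\<sigma>[OF dir_has_vector_derivative cd] lip_deriv_z]]
     lip_deriv_bounded_linear[OF bounded_linear_mult_right[of K]
        lip_deriv_bounded_linear[OF bounded_linear_inner_right[of k] lip_deriv_A]]]
  show ?thesis
  proof (rule lip_deriv_cong_ae[OF 1[folded G_def] negligible_empty])
    fix t assume t: "t \<in> {a..b} - {}"
    let ?e = "dir \<phi> K k (\<sigma> t)"
    have pt: "p t > 0" using p(2) t by simp
    have c: "hvel \<gamma> t = z' t + p t *\<^sub>R ?e" by (simp add: z'_def)
    have "?e \<bullet> ?e = 1" using norm_dir[OF k] by (simp add: norm_eq_1)
    then have "(norm (hvel \<gamma> t))\<^sup>2 = (norm (z' t))\<^sup>2 + 2 * p t * (?e \<bullet> z' t) + (p t)\<^sup>2"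
      unfolding c power2_norm_eq_inner
      by (simp add: inner_add_left inner_add_right inner_commute power2_eq_square)
    then have "(norm (hvel \<gamma> t))\<^sup>2 / p t - p t - (norm (z' t))\<^sup>2 / p t = 2 * (?e \<bullet> z' t)"
      using pt by (simp add: field_simps power2_eq_square)
    moreover have "(p t *\<^sub>R K *\<^sub>R (- sin (\<phi> + K * \<sigma> t), cos (\<phi> + K * \<sigma> t) *\<^sub>R k)) \<bullet> z t
        = p t * (- K * (k \<bullet> area (z t) ?e))"
      by (simp only: inner_scaleR_left[of "p t"] dir_derivative_inner[OF k])
    ultimately show "2 * (?e \<bullet> z' t + (p t *\<^sub>R K *\<^sub>R (- sin (\<phi> + K * \<sigma> t), cos (\<phi> + K * \<sigma> t) *\<^sub>R k)) \<bullet> z t)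
        + K * (k \<bullet> (area (z t) (z' t) + (2 * p t) *\<^sub>R area (z t) ?e)) =
        (norm (hvel \<gamma> t))\<^sup>2 / p t - p t - (norm (z' t))\<^sup>2 / p t + K * (k \<bullet> area (z t) (z' t))"
      by (simp only: inner_add_right inner_scaleR_right) (simp add: algebra_simps)
  qed
qed

lemma integrable_hvel: "(\<lambda>t. (norm (hvel \<gamma> t))\<^sup>2 / p t) integrable_on {a..b}"
  and integrable_z': "(\<lambda>t. (norm (z' t))\<^sup>2 / p t) integrable_on {a..b}"
proof -
  have c: "continuous_on ({a..b} \<times> UNIV) (\<lambda>(t, v :: hplane). (norm v)\<^sup>2 / p t)"
    unfolding case_prod_unfold using p(2)
    by (intro continuous_intros continuous_on_compose2[OF p(1)]) (auto, force)
  show "(\<lambda>t. (norm (hvel \<gamma> t))\<^sup>2 / p t) integrable_on {a..b}"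
    by (rule lip_deriv_integrable[OF admissible_lip_deriv_plane[OF adm] c])
  show "(\<lambda>t. (norm (z' t))\<^sup>2 / p t) integrable_on {a..b}"
    by (rule lip_deriv_integrable[OF lip_deriv_z c])
qed

end

section \<open>The isoperimetric inequality for arcs of less than a full turn\<close>

context deviation begin

lemma \<sigma>_integral: "a \<le> s \<Longrightarrow> s \<le> t \<Longrightarrow> t \<le> b \<Longrightarrow> (p has_integral \<sigma> t - \<sigma> s) {s..t}"
  by (rule lip_deriv_has_integral[OF lip_deriv_mono[OF lip_deriv_\<sigma>]]) auto

lemma \<sigma>_mono: "a \<le> s \<Longrightarrow> s \<le> t \<Longrightarrow> t \<le> b \<Longrightarrow> \<sigma> s \<le> \<sigma> t"
  using has_integral_nonneg[OF \<sigma>_integral, of s t] p(2) by (auto simp: less_imp_le)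

text \<open>
  This is the second variation. With \<open>X\<close> and \<open>B\<close> the coordinates of the deviation in the plane of the arc, the
  quadratic form for the curvature \<open>K'\<close> dominates a sum of two squares after adding the derivative of
  \<open>K' / 2 * H\<close>. Here \<open>tan (\<theta> t)\<close> solves the Riccati equation of the problem; it is finite on the whole
  interval because an arc of curvature \<open>K'\<close> makes less than a full turn there and \<open>\<theta>\<close> is centred
  at the midpoint. A curvature \<open>K' > K\<close> with the same property leaves a positive multiple of the energy of
  the deviation to spare.
\<close>
lemma weighted_energy_lower_bound:
  assumes K: "0 \<le> K" "K \<le> K'" "0 < K'" "K' * (\<sigma> b - \<sigma> a) < 2 * pi"
    and ends: "z a = 0" "z b = 0"
      "k \<bullet> (vert (\<gamma> b) - vert (\<gamma> a)) = k \<bullet> (vert (geod \<phi> K k (\<sigma> b)) - vert (geod \<phi> K k (\<sigma> a)))"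
  shows "\<sigma> b - \<sigma> a + (1 - K / K') * integral {a..b} (\<lambda>t. (norm (z' t))\<^sup>2 / p t)
    \<le> integral {a..b} (\<lambda>t. (norm (hvel \<gamma> t))\<^sup>2 / p t)"
proof -
  define m where "m = (\<sigma> a + \<sigma> b) / 2"
  define \<theta> where "\<theta> = (\<lambda>t. K' / 2 * (\<sigma> t - m))"
  define X where "X = (\<lambda>t. fst (z t))"
  define X' where "X' = (\<lambda>t. fst (z' t))"
  define B where "B = (\<lambda>t. k \<bullet> snd (z t))"
  define B' where "B' = (\<lambda>t. k \<bullet> snd (z' t))"
  define H where "H = (\<lambda>t. tan (\<theta> t) * (X t * X t + B t * B t))"
  define H' where "H' = (\<lambda>t. tan (\<theta> t) * ((X t * X' t + X' t * X t) + (B t * B' t + B' t * B t))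
      + (K' / 2 * p t * (1 + (tan (\<theta> t))\<^sup>2)) * (X t * X t + B t * B t))"
  have cos: "cos (\<theta> t) > 0" if "t \<in> {a..b}" for t
  proof -
    have "\<sigma> a \<le> \<sigma> t" "\<sigma> t \<le> \<sigma> b" using \<sigma>_mono[of a t] \<sigma>_mono[of t b] that by auto
    then have "\<bar>\<sigma> t - m\<bar> \<le> (\<sigma> b - \<sigma> a) / 2" by (auto simp: m_def abs_le_iff field_simps)
    then have "\<bar>\<theta> t\<bar> \<le> K' / 2 * ((\<sigma> b - \<sigma> a) / 2)"
      using K(3) by (simp add: \<theta>_def abs_mult)
    then have "\<bar>\<theta> t\<bar> < pi / 2" using K(4) by simp
    then show ?thesis by (intro cos_gt_zero_pi) auto
  qed
  have "lip_deriv (\<lambda>t. tan (\<theta> t)) (\<lambda>t. K' / 2 * p t * (1 + (tan (\<theta> t))\<^sup>2)) a b"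
  proof (rule lip_deriv_C1)
    fix t assume t: "t \<in> {a..b}"
    have "(\<sigma> has_real_derivative p t) (at t within {a..b})"
      using \<sigma>[OF t] by (simp add: has_real_derivative_iff_has_vector_derivative)
    then have "((\<lambda>t. tan (\<theta> t)) has_real_derivative K' / 2 * p t * (1 + (tan (\<theta> t))\<^sup>2)) (at t within {a..b})"
      unfolding \<theta>_def using cos[OF t, unfolded \<theta>_def]
      by (auto intro!: derivative_eq_intros simp: tan_sec field_simps)
    then show "((\<lambda>t. tan (\<theta> t)) has_vector_derivative K' / 2 * p t * (1 + (tan (\<theta> t))\<^sup>2)) (at t within {a..b})"
      by (simp add: has_real_derivative_iff_has_vector_derivative)
  next
    show "continuous_on {a..b} (\<lambda>t. K' / 2 * p t * (1 + (tan (\<theta> t))\<^sup>2))"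
      unfolding \<theta>_def using cos unfolding \<theta>_def
      by (intro continuous_intros continuous_\<sigma> p(1)) (auto simp: less_imp_neq[symmetric])
  qed
  note dtan = this
  have dX: "lip_deriv X X' a b"
    unfolding X_def X'_def by (rule lip_deriv_bounded_linear[OF bounded_linear_fst lip_deriv_z])
  have dB: "lip_deriv B B' a b"
    unfolding B_def B'_def
    by (intro lip_deriv_bounded_linear[OF bounded_linear_inner_right]
        lip_deriv_bounded_linear[OF bounded_linear_snd] lip_deriv_z)
  note mm = lip_deriv_bilinear[OF bounded_bilinear_mult]
  have dH: "lip_deriv H H' a b"
    unfolding H_def H'_def
    by (intro mm[OF dtan lip_deriv_add[OF mm[OF dX dX] mm[OF dB dB]]])
  have key: "K' * (k \<bullet> area (z t) (z' t)) - K' / 2 * H' t \<le> (norm (z' t))\<^sup>2 / p t" if t: "t \<in> {a..b}" for t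
  proof -
    have q: "p t > 0" using p(2)[OF t] .
    let ?q = "p t" and ?T = "tan (\<theta> t)"
    have area: "k \<bullet> area (z t) (z' t) = X t * B' t - X' t * B t"
      by (simp add: area_def X_def X'_def B_def B'_def inner_diff_right)
    have "\<bar>B' t\<bar> \<le> norm (snd (z' t))"
      using Cauchy_Schwarz_ineq2[of k "snd (z' t)"] k by (simp add: B'_def)
    then have "(B' t)\<^sup>2 \<le> (norm (snd (z' t)))\<^sup>2" by (rule abs_le_square_iff[THEN iffD1, OF order_trans]) simp
    then have n: "(X' t)\<^sup>2 + (B' t)\<^sup>2 \<le> (norm (z' t))\<^sup>2"
      by (simp add: X'_def norm_prod_def)
    have "0 \<le> ?q * ((X' t / ?q + K' / 2 * B t + K' / 2 * ?T * X t)\<^sup>2 + (B' t / ?q - K' / 2 * X t + K' / 2 * ?T * B t)\<^sup>2)"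
      using q by simp
    also have "\<dots> = ((X' t)\<^sup>2 + (B' t)\<^sup>2) / ?q - (K' * (X t * B' t - X' t * B t) - K' / 2 * H' t)"
      using q by (simp add: H'_def field_simps power2_eq_square)
    also have "\<dots> \<le> (norm (z' t))\<^sup>2 / ?q - (K' * (X t * B' t - X' t * B t) - K' / 2 * H' t)"
      using divide_right_mono[OF n, of ?q] q by simp
    finally show ?thesis unfolding area by simp
  qed
  have pi: "(p has_integral \<sigma> b - \<sigma> a) {a..b}" by (rule \<sigma>_integral) (use ab in auto)
  have "H a = 0" "H b = 0" using ends by (simp_all add: H_def X_def B_def)
  then have iH: "(H' has_integral 0) {a..b}" using lip_deriv_has_integral[OF dH ab] by simp
  have "G b - G a = 0"
    using ends by (simp add: G_def A_def inner_diff_right area.zero_right)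
  then have iG: "((\<lambda>t. (norm (hvel \<gamma> t))\<^sup>2 / p t - p t - (norm (z' t))\<^sup>2 / p t + K * (k \<bullet> area (z t) (z' t)))
      has_integral 0) {a..b}"
    using lip_deriv_has_integral[OF lip_deriv_G ab] by simp
  let ?Z = "\<lambda>t. (norm (z' t))\<^sup>2 / p t"
  have "(((\<lambda>t. ((norm (hvel \<gamma> t))\<^sup>2 / p t - p t - ?Z t + K * (k \<bullet> area (z t) (z' t))) + p t
      + (1 - K / K') * ?Z t - K / 2 * H' t)) has_integral 0 + (\<sigma> b - \<sigma> a) + (1 - K / K') * integral {a..b} ?Z - K / 2 * 0) {a..b}"
    by (intro has_integral_add has_integral_diff has_integral_mult_right iG pi iH integrable_integral[OF integrable_z'])
  then have "0 + (\<sigma> b - \<sigma> a) + (1 - K / K') * integral {a..b} ?Z - K / 2 * 0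
      \<le> integral {a..b} (\<lambda>t. (norm (hvel \<gamma> t))\<^sup>2 / p t)"
  proof (rule has_integral_le[OF _ integrable_integral[OF integrable_hvel]])
    fix t assume t: "t \<in> {a..b}"
    have "K / K' * (K' * (k \<bullet> area (z t) (z' t)) - K' / 2 * H' t) \<le> K / K' * ?Z t"
      by (rule mult_left_mono[OF key[OF t]]) (use K in simp)
    moreover have "K / K' * (K' * (k \<bullet> area (z t) (z' t)) - K' / 2 * H' t) = K * (k \<bullet> area (z t) (z' t)) - K / 2 * H' t"
      using K(3) by (simp add: field_simps)
    ultimately show "((norm (hvel \<gamma> t))\<^sup>2 / p t - p t - ?Z t + K * (k \<bullet> area (z t) (z' t))) + p t
      + (1 - K / K') * ?Z t - K / 2 * H' t \<le> (norm (hvel \<gamma> t))\<^sup>2 / p t"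
      by (simp only: left_diff_distrib mult_1_left)
  qed
  then show ?thesis by simp
qed

end

lemma reach_nontrivial:
  assumes "reach p q l"
  obtains \<eta> c d where "c < d" "admissible \<eta> c d" "\<eta> c = p" "\<eta> d = q" "sr_length \<eta> c d = l"
proof -
  obtain \<eta> c d where e: "admissible \<eta> c d" "\<eta> c = p" "\<eta> d = q" "sr_length \<eta> c d = l"
    using assms unfolding reach_def by blast
  show ?thesis
  proof (cases "c < d")
    case True
    then show ?thesis using that e by blast
  next
    case False
    then have "c = d" using admissible_le[OF e(1)] by simp
    then have "p = q" "l = 0" using e by (auto simp: sr_length_def)
    moreover have h: "hcurve (\<lambda>_. p) (\<lambda>_. 0) 0 1"
      by (rule hcurve_C1) (auto simp: plane_def vert_def area_def)
    moreover have "sr_length (\<lambda>_. p) 0 1 = 0"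
      by (rule hcurve_length_eqI[OF h]) (simp add: plane_def)
    ultimately show ?thesis
      using that[of 0 1 "\<lambda>_. p"] hcurve_admissible[OF h] by simp
  qed
qed

text \<open>
  Only the plane end points and the component along \<open>k\<close> of the vertical displacement are prescribed for the
  competitor. Its speed may vanish, so it is weighted with continuous approximations \<open>q n\<close> of its speed
  plus \<open>\<epsilon>\<close>, normalized to the total \<open>\<tau>\<close>. In the limit the weighted energy is at most the squared length divided
  by \<open>\<tau>\<close>.
\<close>
lemma geod_length_le:
  assumes k: "norm k = 1" and K: "0 \<le> K" "K * (s1 - s0) < 2 * pi" and s: "s0 \<le> s1"
    and r: "reach P Q l"
    and P: "plane P = plane (geod \<phi> K k s0)" and Q: "plane Q = plane (geod \<phi> K k s1)"
    and v: "k \<bullet> (vert Q - vert P) = k \<bullet> (vert (geod \<phi> K k s1) - vert (geod \<phi> K k s0))"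
  shows "s1 - s0 \<le> l"
proof (cases "s0 = s1")
  case True
  then show ?thesis using reach_nonneg[OF r] by simp
next
  case False
  define \<tau> where "\<tau> = s1 - s0"
  have \<tau>: "\<tau> > 0" using False s by (simp add: \<tau>_def)
  obtain \<eta> c d where cd: "c < d" and ad: "admissible \<eta> c d" and ends: "\<eta> c = P" "\<eta> d = Q"
    and l: "sr_length \<eta> c d = l"
    using reach_nontrivial[OF r] by metis
  have l0: "l \<ge> 0" using reach_nonneg[OF r] .
  obtain K' where K': "K < K'" "K' * \<tau> < 2 * pi"
  proof -
    have "K < 2 * pi / \<tau>" using K(2) \<tau> by (simp add: \<tau>_def field_simps)
    then obtain K' where "K < K'" "K' < 2 * pi / \<tau>" using dense by blast
    then show ?thesis using that \<tau> by (simp add: field_simps)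
  qed
  obtain Q' :: "nat \<Rightarrow> real \<Rightarrow> hplane" and N L where N: "negligible N"
    and cQ: "\<And>n. continuous_on {c..d} (Q' n)" and bound: "\<And>n t. norm (Q' n t) \<le> L"
    and lim: "\<And>t. t \<in> {c..d} - N \<Longrightarrow> (\<lambda>n. Q' n t) \<longlonglongrightarrow> hvel \<eta> t"
    using lip_deriv_approx[OF admissible_lip_deriv_plane[OF ad]] cd by (metis less_imp_le)
  have ihv: "(\<lambda>t. (norm (hvel \<eta> t))\<^sup>2) integrable_on {c..d}"
    by (rule lip_deriv_integrable[OF admissible_lip_deriv_plane[OF ad], of "\<lambda>t v. (norm v)\<^sup>2"])
      (auto simp: case_prod_unfold intro!: continuous_intros)
  have main: "\<tau>\<^sup>2 \<le> (l + \<epsilon> * (d - c)) * l" if \<epsilon>: "\<epsilon> > 0" for \<epsilon>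
  proof -
    define q where "q = (\<lambda>n t. norm (Q' n t) + \<epsilon>)"
    define I where "I = (\<lambda>n. integral {c..d} (q n))"
    have cq: "continuous_on {c..d} (q n)" for n
      unfolding q_def by (intro continuous_intros cQ)
    have q\<epsilon>: "q n t \<ge> \<epsilon>" for n t by (simp add: q_def)
    have iq: "q n integrable_on {c..d}" for n by (rule integrable_continuous_real[OF cq])
    have Ipos: "I n > 0" for n
    proof -
      have "((\<lambda>_. \<epsilon>) has_integral \<epsilon> * (d - c)) {c..d}"
        using has_integral_const_real[of \<epsilon> c d] cd by (simp add: mult.commute)
      then have "\<epsilon> * (d - c) \<le> I n" unfolding I_def
        by (rule has_integral_le[OF _ integrable_integral[OF iq]]) (rule q\<epsilon>)
      then show ?thesis using \<epsilon> cd by (smt (verit) mult_pos_pos)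
    qed
    have step: "\<tau>\<^sup>2 \<le> I n * integral {c..d} (\<lambda>t. (norm (hvel \<eta> t))\<^sup>2 / q n t)"
      and stepi: "(\<lambda>t. (norm (hvel \<eta> t))\<^sup>2 / q n t) integrable_on {c..d}" for n
    proof -
      define p where "p = (\<lambda>t. \<tau> / I n * q n t)"
      define \<sigma> where "\<sigma> = (\<lambda>t. s0 + integral {c..t} p)"
      have cp: "continuous_on {c..d} p" unfolding p_def by (intro continuous_intros cq)
      have ppos: "p t > 0" for t
        using \<tau> Ipos[of n] q\<epsilon>[of n t] \<epsilon> by (simp add: p_def)
      interpret deviation \<eta> c d \<phi> K k \<sigma> p
      proof
        fix t assume "t \<in> {c..d}"
        then show "(\<sigma> has_vector_derivative p t) (at t within {c..d})"
          unfolding \<sigma>_def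
          using has_vector_derivative_add[OF has_vector_derivative_const[of s0] integral_has_vector_derivative[OF cp]]
          by simp
      qed (use ad k cp ppos in auto)
      have \<sigma>c: "\<sigma> c = s0" by (simp add: \<sigma>_def)
      have "integral {c..d} p = \<tau> / I n * I n" by (simp add: p_def I_def)
      then have \<sigma>d: "\<sigma> d = s1" using Ipos[of n] by (simp add: \<sigma>_def \<tau>_def)
      have eq: "(norm (hvel \<eta> t))\<^sup>2 / p t = I n / \<tau> * ((norm (hvel \<eta> t))\<^sup>2 / q n t)" for t
        by (simp add: p_def)
      have "\<sigma> d - \<sigma> c + (1 - K / K') * integral {c..d} (\<lambda>t. (norm (z' t))\<^sup>2 / p t)
          \<le> integral {c..d} (\<lambda>t. (norm (hvel \<eta> t))\<^sup>2 / p t)"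
        by (rule weighted_energy_lower_bound)
          (use K K' ends P Q v in \<open>auto simp: \<sigma>c \<sigma>d z_def \<tau>_def\<close>)
      moreover have "0 \<le> (1 - K / K') * integral {c..d} (\<lambda>t. (norm (z' t))\<^sup>2 / p t)"
        by (intro mult_nonneg_nonneg integral_nonneg integrable_z') (use K K' ppos in \<open>auto simp: less_imp_le\<close>)
      ultimately have "\<tau> \<le> integral {c..d} (\<lambda>t. I n / \<tau> * ((norm (hvel \<eta> t))\<^sup>2 / q n t))"
        unfolding eq by (simp add: \<sigma>c \<sigma>d \<tau>_def)
      then have "\<tau> \<le> I n / \<tau> * integral {c..d} (\<lambda>t. (norm (hvel \<eta> t))\<^sup>2 / q n t)"
        by (simp only: integral_mult_right)
      then show "\<tau>\<^sup>2 \<le> I n * integral {c..d} (\<lambda>t. (norm (hvel \<eta> t))\<^sup>2 / q n t)"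
        using \<tau> by (simp add: field_simps power2_eq_square)
      have "(\<lambda>t. \<tau> / I n * ((norm (hvel \<eta> t))\<^sup>2 / p t)) integrable_on {c..d}"
        by (intro integrable_on_mult_right integrable_hvel)
      then show "(\<lambda>t. (norm (hvel \<eta> t))\<^sup>2 / q n t) integrable_on {c..d}"
        unfolding eq using \<tau> Ipos[of n] by simp
    qed
    define off where "off = (\<lambda>f :: real \<Rightarrow> real. \<lambda>t. if t \<in> N then 0 else f t)"
    have off_integral: "integral {c..d} (off f) = integral {c..d} f" for f
      by (rule integral_spike[OF N]) (auto simp: off_def)
    have off_integrable: "f integrable_on {c..d} \<Longrightarrow> off f integrable_on {c..d}" for f
      by (rule integrable_spike[OF _ N]) (auto simp: off_def)
    have l_int: "((\<lambda>t. norm (hvel \<eta> t)) has_integral l) {c..d}"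
      using sr_length_has_integral(2)[OF ad] l by simp
    have L0: "L \<ge> 0" using bound[of 0 0] norm_ge_zero[of "Q' 0 0"] by linarith
    have "(\<lambda>n. integral {c..d} (off (q n))) \<longlonglongrightarrow> integral {c..d} (off (\<lambda>t. norm (hvel \<eta> t) + \<epsilon>))"
    proof (rule dominated_convergence(2)[where h = "\<lambda>_. L + \<epsilon>"])
      show "off (q n) integrable_on {c..d}" for n by (rule off_integrable[OF iq])
      show "(\<lambda>_. L + \<epsilon>) integrable_on {c..d}" by (rule integrable_const_ivl)
      show "norm (off (q n) t) \<le> L + \<epsilon>" for n t
        using bound[of n t] \<epsilon> L0 by (simp add: off_def q_def)
      show "(\<lambda>n. off (q n) t) \<longlonglongrightarrow> off (\<lambda>t. norm (hvel \<eta> t) + \<epsilon>) t" if "t \<in> {c..d}" for t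
        using that by (cases "t \<in> N") (auto simp: off_def q_def intro!: tendsto_intros lim)
    qed
    moreover have "integral {c..d} (\<lambda>t. norm (hvel \<eta> t) + \<epsilon>) = l + \<epsilon> * (d - c)"
      using has_integral_add[OF l_int has_integral_const_real[of \<epsilon> c d]] cd
      by (simp add: integral_unique mult.commute)
    ultimately have limI: "I \<longlonglongrightarrow> l + \<epsilon> * (d - c)"
      unfolding off_integral I_def by simp
    let ?g = "\<lambda>t. (norm (hvel \<eta> t))\<^sup>2 / (norm (hvel \<eta> t) + \<epsilon>)"
    have dom: "norm (off (\<lambda>t. (norm (hvel \<eta> t))\<^sup>2 / q n t) t) \<le> (norm (hvel \<eta> t))\<^sup>2 / \<epsilon>" for n t
      using q\<epsilon>[of n t] \<epsilon> by (auto simp: off_def intro!: divide_left_mono)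
    have domi: "(\<lambda>t. (norm (hvel \<eta> t))\<^sup>2 / \<epsilon>) integrable_on {c..d}"
      using integrable_on_mult_right[OF ihv, of "1 / \<epsilon>"] by simp
    have conv: "(\<lambda>n. off (\<lambda>t. (norm (hvel \<eta> t))\<^sup>2 / q n t) t) \<longlonglongrightarrow> off ?g t" if "t \<in> {c..d}" for t
    proof (cases "t \<in> N")
      case False
      have "norm (hvel \<eta> t) + \<epsilon> \<noteq> 0" using \<epsilon> norm_ge_zero[of "hvel \<eta> t"] by linarith
      then show ?thesis
        using False lim[of t] that by (auto simp: off_def q_def intro!: tendsto_intros)
    qed (simp add: off_def)
    have ig: "off ?g integrable_on {c..d}"
      by (rule dominated_convergence(1)[OF off_integrable[OF stepi] domi dom conv])
    have "(\<lambda>n. integral {c..d} (off (\<lambda>t. (norm (hvel \<eta> t))\<^sup>2 / q n t))) \<longlonglongrightarrow> integral {c..d} (off ?g)"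
      by (rule dominated_convergence(2)[OF off_integrable[OF stepi] domi dom conv])
    from tendsto_mult[OF limI this] have "\<tau>\<^sup>2 \<le> (l + \<epsilon> * (d - c)) * integral {c..d} (off ?g)"
      by (rule tendsto_lowerbound) (use step in \<open>auto simp: off_integral\<close>)
    also have "\<dots> \<le> (l + \<epsilon> * (d - c)) * l"
    proof (rule mult_left_mono)
      show "integral {c..d} (off ?g) \<le> l"
      proof (rule has_integral_le[OF integrable_integral[OF ig] l_int])
        fix t
        have "(norm (hvel \<eta> t))\<^sup>2 \<le> norm (hvel \<eta> t) * (norm (hvel \<eta> t) + \<epsilon>)"
          using \<epsilon> by (simp add: power2_eq_square distrib_left)
        moreover have "norm (hvel \<eta> t) + \<epsilon> > 0" using \<epsilon> norm_ge_zero[of "hvel \<eta> t"] by linarith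
        ultimately show "off ?g t \<le> norm (hvel \<eta> t)"
          by (simp add: off_def divide_le_eq)
      qed
      show "0 \<le> l + \<epsilon> * (d - c)" using l0 \<epsilon> cd by simp
    qed
    finally show ?thesis .
  qed
  have "((\<lambda>\<epsilon>. (l + \<epsilon> * (d - c)) * l) \<longlongrightarrow> (l + 0 * (d - c)) * l) (at_right 0)"
    by (intro tendsto_intros)
  then have "\<tau>\<^sup>2 \<le> (l + 0 * (d - c)) * l"
    by (rule tendsto_lowerbound) (use main in \<open>auto simp: eventually_at_filter\<close>)
  then have "\<tau>\<^sup>2 \<le> l\<^sup>2" by (simp add: power2_eq_square)
  then have "\<tau> \<le> l" using l0 by (rule power2_le_imp_le)
  then show ?thesis by (simp add: \<tau>_def)
qed

section \<open>Uniqueness and existence of minimizing arcs\<close>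

lemma (in deviation) z_eq_0_imp_eq_geod:
  assumes z0: "\<And>t. t \<in> {a..b} \<Longrightarrow> z t = 0" and va: "vert (\<gamma> a) = vert (geod \<phi> K k (\<sigma> a))"
    and t: "t \<in> {a..b}"
  shows "\<gamma> t = geod \<phi> K k (\<sigma> t)"
proof (rule plane_vert_eqI)
  show "plane (\<gamma> t) = plane (geod \<phi> K k (\<sigma> t))" using z0[OF t] by (simp add: z_def)
  have "lip_deriv A (\<lambda>t. area (z t) (z' t) + (2 * p t) *\<^sub>R area (z t) (dir \<phi> K k (\<sigma> t))) a t"
    by (rule lip_deriv_mono[OF lip_deriv_A]) (use t in auto)
  then have "((\<lambda>t. area (z t) (z' t) + (2 * p t) *\<^sub>R area (z t) (dir \<phi> K k (\<sigma> t))) has_integral A t - A a) {a..t}"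
    by (rule lip_deriv_has_integral) (use t in auto)
  moreover have "((\<lambda>t. area (z t) (z' t) + (2 * p t) *\<^sub>R area (z t) (dir \<phi> K k (\<sigma> t))) has_integral 0) {a..t}"
    by (rule has_integral_is_0) (use t z0 in \<open>auto simp: area.zero_left\<close>)
  ultimately have "A t - A a = 0" by (rule has_integral_unique)
  then have "A t = A a" by simp
  then show "vert (\<gamma> t) = vert (geod \<phi> K k (\<sigma> t))"
    using z0[OF t] z0[of a] ab va by (simp add: A_def area.zero_right)
qed

lemma geod_minimizing:
  assumes "norm k = 1" "0 \<le> K" "s0 \<le> s1" "K * (s1 - s0) < 2 * pi"
  shows "length_minimizing (geod \<phi> K k) s0 s1"
  unfolding length_minimizing_iff
  using hcurve_admissible[OF hcurve_geod] length_geod geod_length_le assms by simp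

text \<open>
  A minimizer has the length of the arc; then the surplus in the energy estimate forces the deviation to be
  constant.
\<close>
lemma geod_unique_minimizer:
  assumes k: "norm k = 1" and K: "0 \<le> K" "K * s < 2 * pi" and s: "0 \<le> s"
    and m: "length_minimizing \<gamma> 0 T" and \<gamma>0: "\<gamma> 0 = (0, 0, 0)" and \<gamma>T: "\<gamma> T = geod \<phi> K k s"
    and N: "negligible N" "\<And>t. t \<in> {0..T} - N \<Longrightarrow> norm (hvel \<gamma> t) = 1"
    and T: "T > 0"
  shows "T = s" and "\<And>t. t \<in> {0..T} \<Longrightarrow> \<gamma> t = geod \<phi> K k t"
proof -
  have ad: "admissible \<gamma> 0 T" using m by (simp add: length_minimizing_iff)
  have one: "((\<lambda>_. 1 :: real) has_integral T) {0..T}" using has_integral_const_real[of "1 :: real" 0 T] T by simp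
  have len: "sr_length \<gamma> 0 T = T"
    by (rule has_integral_unique[OF sr_length_has_integral(2)[OF ad]])
      (rule has_integral_spike[OF N(1) _ one], simp add: N(2))
  have "reach (\<gamma> 0) (\<gamma> T) s"
    using reachI[OF hcurve_admissible[OF hcurve_geod[OF s]], of \<phi> K k] \<gamma>0 \<gamma>T s length_geod[OF k s] by simp
  then have "T \<le> s" using m len by (simp add: length_minimizing_iff)
  moreover have "s - 0 \<le> T"
    by (rule geod_length_le[OF k K(1) _ s, of "\<gamma> 0" "\<gamma> T"]) (use reachI[OF ad] len \<gamma>0 \<gamma>T K in auto)
  ultimately show Ts: "T = s" by simp
  interpret deviation \<gamma> 0 T \<phi> K k "\<lambda>t. t" "\<lambda>_. 1"
    by unfold_locales (use ad k in \<open>auto intro: has_vector_derivative_id\<close>)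
  obtain K' where K': "K < K'" "K' * T < 2 * pi"
  proof -
    have "K < 2 * pi / T" using K(2) T Ts by (simp add: field_simps)
    then obtain K' where "K < K'" "K' < 2 * pi / T" using dense by blast
    then show ?thesis using that T by (simp add: field_simps)
  qed
  have "((\<lambda>t. (norm (hvel \<gamma> t))\<^sup>2 / 1) has_integral T) {0..T}"
    by (rule has_integral_spike[OF N(1) _ one]) (simp add: N(2))
  moreover have z: "z 0 = 0" "z T = 0" using \<gamma>0 \<gamma>T Ts by (auto simp: z_def)
  moreover have "T - 0 + (1 - K / K') * integral {0..T} (\<lambda>t. (norm (z' t))\<^sup>2 / 1)
    \<le> integral {0..T} (\<lambda>t. (norm (hvel \<gamma> t))\<^sup>2 / 1)"
    by (rule weighted_energy_lower_bound) (use K K' z \<gamma>0 \<gamma>T Ts in auto)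
  ultimately have "(1 - K / K') * integral {0..T} (\<lambda>t. (norm (z' t))\<^sup>2) \<le> 0"
    by (simp add: integral_unique)
  moreover have "1 - K / K' > 0" using K K' by simp
  ultimately have E: "integral {0..T} (\<lambda>t. (norm (z' t))\<^sup>2) \<le> 0"
    by (simp add: mult_le_0_iff)
  show "\<gamma> t = geod \<phi> K k t" if t: "t \<in> {0..T}" for t
  proof (rule z_eq_0_imp_eq_geod[OF _ _ t])
    show "z t = 0" if t: "t \<in> {0..T}" for t
    proof -
      have "(norm (z t - z 0))\<^sup>2 \<le> (t - 0) * integral {0..T} (\<lambda>t. (norm (z' t))\<^sup>2)"
        by (rule lip_deriv_increment_squared_le[OF lip_deriv_z]) (use t in auto)
      also have "\<dots> \<le> 0" using E t by (simp add: mult_nonneg_nonpos)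
      finally show ?thesis using z by simp
    qed
    show "vert (\<gamma> 0) = vert (geod \<phi> K k 0)" using \<gamma>0 by simp
  qed
qed

lemma polar_coordinates:
  fixes x a :: real
  assumes "(x, a) \<noteq> (0, 0)"
  obtains \<psi> where "x = sqrt (x\<^sup>2 + a\<^sup>2) * cos \<psi>" "a = sqrt (x\<^sup>2 + a\<^sup>2) * sin \<psi>"
proof -
  let ?r = "sqrt (x\<^sup>2 + a\<^sup>2)"
  have r: "?r > 0" using assms by (auto simp: sum_power2_gt_zero_iff)
  have "x\<^sup>2 + a\<^sup>2 \<noteq> 0" using assms by (auto simp: sum_power2_eq_zero_iff)
  then have "(x / ?r)\<^sup>2 + (a / ?r)\<^sup>2 = 1"
    by (simp add: power_divide flip: add_divide_distrib)
  then obtain \<psi> where "x / ?r = cos \<psi>" "a / ?r = sin \<psi>"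
    using sincos_total_2pi by metis
  then have "x = ?r * cos \<psi>" "a = ?r * sin \<psi>"
    using r by (metis nonzero_mult_div_cancel_left times_divide_eq_right less_irrefl)+
  then show ?thesis by (rule that)
qed

lemma mult_cos_le_sin:
  fixes \<theta> :: real
  assumes "0 \<le> \<theta>" "\<theta> \<le> pi" shows "\<theta> * cos \<theta> \<le> sin \<theta>"
proof -
  have "sin 0 - 0 * cos 0 \<le> sin \<theta> - \<theta> * cos \<theta>"
  proof (rule DERIV_nonneg_imp_nondecreasing[OF assms(1)])
    fix t assume t: "0 \<le> t" "t \<le> \<theta>"
    have "((\<lambda>t. sin t - t * cos t) has_real_derivative t * sin t) (at t)"
      by (auto intro!: derivative_eq_intros)
    moreover have "t * sin t \<ge> 0" using t assms by (intro mult_nonneg_nonneg sin_ge_zero) auto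
    ultimately show "\<exists>y. ((\<lambda>t. sin t - t * cos t) has_real_derivative y) (at t) \<and> 0 \<le> y" by blast
  qed
  then show ?thesis by simp
qed

text \<open>
  The quotient of the area of a circular segment and its squared chord takes every positive value:
  it is small for small angles and infinite at \<open>2 * pi\<close>. Clearing denominators makes the function
  continuous on the closed interval, so that the intermediate value theorem applies.
\<close>
lemma segment_angle_exists:
  fixes r b :: real
  assumes "r > 0" "b > 0"
  obtains \<theta> where "0 < \<theta>" "\<theta> < 2 * pi" "(\<theta> - sin \<theta>) * r = 4 * b * (1 - cos \<theta>)"
proof -
  define g where "g = (\<lambda>\<theta>. (\<theta> - sin \<theta>) * r - 4 * b * (1 - cos \<theta>))"
  define \<theta>0 where "\<theta>0 = min 1 (b / r)"
  have \<theta>0: "\<theta>0 > 0" "\<theta>0 \<le> 1" "\<theta>0 * r \<le> b" using assms by (auto simp: \<theta>0_def min_def field_simps)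
  have pi1: "1 < pi" using pi_gt3 by simp
  have c1: "cos \<theta>0 \<le> 1" by simp
  have "\<theta>0 - sin \<theta>0 \<le> \<theta>0 * (1 - cos \<theta>0)"
    using mult_cos_le_sin[of \<theta>0] \<theta>0 pi1 by (simp add: right_diff_distrib)
  then have "(\<theta>0 - sin \<theta>0) * r \<le> \<theta>0 * (1 - cos \<theta>0) * r"
    using assms by (simp add: mult_right_mono)
  also have "\<dots> = (\<theta>0 * r) * (1 - cos \<theta>0)" by simp
  also have "\<dots> \<le> (4 * b) * (1 - cos \<theta>0)"
    by (rule mult_right_mono) (use \<theta>0 assms in auto)
  finally have "g \<theta>0 \<le> 0" by (simp add: g_def)
  moreover have g2: "g (2 * pi) > 0" using assms by (simp add: g_def)
  moreover have "\<theta>0 \<le> 2 * pi" using \<theta>0 pi1 by simp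
  moreover have "continuous_on {\<theta>0..2 * pi} g" unfolding g_def by (intro continuous_intros)
  ultimately obtain \<theta> where \<theta>: "\<theta>0 \<le> \<theta>" "\<theta> \<le> 2 * pi" "g \<theta> = 0"
    using IVT'[of g \<theta>0 0 "2 * pi"] by fastforce
  have "\<theta> \<noteq> 2 * pi" using g2 \<theta>(3) by auto
  then show ?thesis using that[of \<theta>] \<theta> \<theta>0 by (simp add: g_def)
qed

lemma geod_exists_aux:
  fixes x a b :: real
  assumes "(x, a) \<noteq> (0, 0)" "b \<ge> 0"
  obtains \<phi> K s where "0 \<le> K" "0 \<le> s" "K * s < 2 * pi" "geod \<phi> K k s = (x, a *\<^sub>R k, b *\<^sub>R k)"
proof -
  define r where "r = sqrt (x\<^sup>2 + a\<^sup>2)"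
  have r: "r > 0" using assms by (auto simp: r_def sum_power2_gt_zero_iff)
  obtain \<psi> where \<psi>: "x = r * cos \<psi>" "a = r * sin \<psi>"
    using polar_coordinates[OF assms(1)] unfolding r_def by metis
  show ?thesis
  proof (cases "b = 0")
    case True
    then show ?thesis using that[of 0 r \<psi>] r \<psi> by (simp add: geod_def)
  next
    case False
    then obtain \<theta> where \<theta>: "0 < \<theta>" "\<theta> < 2 * pi" "(\<theta> - sin \<theta>) * r\<^sup>2 = 4 * b * (1 - cos \<theta>)"
      using segment_angle_exists[of "r\<^sup>2" b] r assms(2) by auto
    define S where "S = sin (\<theta> / 2)"
    have S: "S > 0" unfolding S_def by (rule sin_gt_zero) (use \<theta> in auto)
    have cosS: "1 - cos \<theta> = 2 * S\<^sup>2"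
      using cos_double_sin[of "\<theta> / 2"] by (simp add: S_def)
    define K where "K = 2 * S / r"
    have K: "K > 0" using S r by (simp add: K_def)
    define \<phi> where "\<phi> = \<psi> - \<theta> / 2"
    have Ks: "K * (\<theta> / K) = \<theta>" using K by simp
    have "sin (\<phi> + \<theta>) - sin \<phi> = 2 * S * cos \<psi>"
      using sin_diff_sin[of "\<phi> + \<theta>" \<phi>] by (simp add: \<phi>_def S_def add_divide_distrib)
    then have 1: "(sin (\<phi> + \<theta>) - sin \<phi>) / K = x"
      using S r by (simp add: K_def \<psi> field_simps)
    have "cos \<phi> - cos (\<phi> + \<theta>) = 2 * S * sin \<psi>"
      using cos_diff_cos[of \<phi> "\<phi> + \<theta>"] by (simp add: \<phi>_def S_def add_divide_distrib)
    then have 2: "(cos \<phi> - cos (\<phi> + \<theta>)) / K = a"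
      using S r by (simp add: K_def \<psi> field_simps)
    have "(\<theta> - sin \<theta>) * r\<^sup>2 = 8 * b * S\<^sup>2" using \<theta>(3) cosS by simp
    then have 3: "(\<theta> - sin \<theta>) / (2 * K\<^sup>2) = b"
      using S r by (simp add: K_def field_simps power2_eq_square)
    show ?thesis
      using that[of K "\<theta> / K" \<phi>] K \<theta> 1 2 3 by (simp add: geod_def Ks)
  qed
qed

text \<open>
  The sign of the area can be absorbed in the direction, since \<open>k\<close> and \<open>- k\<close> span the same line; this keeps
  the curvature nonnegative.
\<close>
lemma geod_exists:
  fixes x a b :: real
  assumes "(x, a) \<noteq> (0, 0)" "norm k = 1"
  obtains \<phi> K s k' where "norm k' = 1" "0 \<le> K" "0 \<le> s" "K * s < 2 * pi"
    "geod \<phi> K k' s = (x, a *\<^sub>R k, b *\<^sub>R k)"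
proof (cases "b \<ge> 0")
  case True
  obtain \<phi> K s where "0 \<le> K" "0 \<le> s" "K * s < 2 * pi" "geod \<phi> K k s = (x, a *\<^sub>R k, b *\<^sub>R k)"
    using geod_exists_aux[OF assms(1) True] by metis
  then show ?thesis using that[of k K s \<phi>] assms by simp
next
  case False
  have "(x, - a) \<noteq> (0, 0)" "- b \<ge> 0" using assms False by auto
  then obtain \<phi> K s where "0 \<le> K" "0 \<le> s" "K * s < 2 * pi"
     "geod \<phi> K (- k) s = (x, (- a) *\<^sub>R (- k), (- b) *\<^sub>R (- k))"
    using geod_exists_aux by metis
  then show ?thesis using that[of "- k" K s \<phi>] assms by simp
qed

text \<open>
  \<open>C_n\<close> is the union of the Heisenberg subgroups spanned by the \<open>x\<close>-axis and a direction \<open>k\<close>.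
\<close>
lemma C_n_direction:
  assumes "p \<in> C_n"
  obtains k x a b where "norm k = 1" "p = (x, a *\<^sub>R k, b *\<^sub>R k)"
proof -
  obtain x l y \<alpha> \<beta> where p: "p = (x, l, y)" and ne: "(\<alpha>, \<beta>) \<noteq> (0, 0)" and ly: "\<alpha> *\<^sub>R l + \<beta> *\<^sub>R y = 0"
    using assms unfolding C_n_def by blast
  have unit: "\<exists>k c. norm k = 1 \<and> v = c *\<^sub>R k" for v :: "real^3"
  proof (cases "v = 0")
    case True
    then show ?thesis by (intro exI[of _ "axis 1 1"] exI[of _ 0]) (simp add: norm_axis_1)
  next
    case False
    then show ?thesis by (intro exI[of _ "v /\<^sub>R norm v"] exI[of _ "norm v"]) simp
  qed
  show ?thesis
  proof (cases "\<beta> = 0")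
    case True
    then have "l = 0" using ne ly by auto
    moreover obtain k c where "norm k = 1" "y = c *\<^sub>R k" using unit by blast
    ultimately show ?thesis using that[of k x 0 c] p by simp
  next
    case False
    obtain k c where k: "norm k = 1" "l = c *\<^sub>R k" using unit by blast
    have "\<beta> *\<^sub>R y = - (\<alpha> *\<^sub>R l)" using ly by (metis add.commute add_eq_0_iff)
    then have "y = (1 / \<beta>) *\<^sub>R (- (\<alpha> *\<^sub>R l))"
      using False by (metis divide_self_if real_vector.scale_one scaleR_scaleR times_divide_eq_left mult_1)
    then have "y = (- \<alpha> * c / \<beta>) *\<^sub>R k" using k by simp
    then show ?thesis using that[of k x c] p k by blast
  qed
qed

section \<open>Variations of an arc\<close>

text \<open>
  The point with deviation \<open>w\<close> from the arc at time \<open>t\<close> and vertical deviation \<open>\<alpha>\<close>, in the coordinates \<open>z\<close> and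
  \<open>A\<close> of a deviation.
\<close>
definition dev_point :: "real \<Rightarrow> real \<Rightarrow> real^3 \<Rightarrow> real \<Rightarrow> hplane \<Rightarrow> real^3 \<Rightarrow> carnot" where
  "dev_point \<phi> K k t w \<alpha> =
    (let c = plane (geod \<phi> K k t) in
     (fst c + fst w, snd c + snd w, vert (geod \<phi> K k t) + (1/2) *\<^sub>R (\<alpha> + area c w)))"

lemma plane_dev_point: "plane (dev_point \<phi> K k t w \<alpha>) = plane (geod \<phi> K k t) + w"
  by (simp add: dev_point_def plane_def Let_def prod_eq_iff)

lemma vert_dev_point:
  "vert (dev_point \<phi> K k t w \<alpha>) = vert (geod \<phi> K k t) + (1/2) *\<^sub>R (\<alpha> + area (plane (geod \<phi> K k t)) w)"
  by (simp add: dev_point_def vert_def Let_def)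

lemma dev_point_0: "dev_point \<phi> K k t 0 0 = geod \<phi> K k t"
  by (rule plane_vert_eqI) (simp_all add: plane_dev_point vert_dev_point area.zero_right)

lemma (in deviation) dev_point_A: "dev_point \<phi> K k (\<sigma> t) (z t) (A t) = \<gamma> t"
proof (rule plane_vert_eqI)
  show "vert (dev_point \<phi> K k (\<sigma> t) (z t) (A t)) = vert (\<gamma> t)"
    by (simp add: vert_dev_point A_def flip: scaleR_diff_right)
qed (simp add: plane_dev_point z_def)

text \<open>
  The cost of a smooth variation \<open>\<zeta>\<close> of an arc, bounded by half of the energy plus half of the time. The
  vertical displacement \<open>\<Delta>\<close> and the first-order cost \<open>I\<close> share the linear term, which is what lets the
  multiplier \<open>K *\<^sub>R k\<close> price vertical displacements.
\<close>
lemma reach_dev_point: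
  assumes k: "norm k = 1" and st: "s \<le> t"
    and \<zeta>: "\<And>\<tau>. (\<zeta> has_vector_derivative \<zeta>' \<tau>) (at \<tau>)" and c: "continuous_on UNIV \<zeta>'"
    and \<Delta>: "((\<lambda>\<tau>. area (\<zeta> \<tau>) (\<zeta>' \<tau>) + 2 *\<^sub>R area (\<zeta> \<tau>) (dir \<phi> K k \<tau>)) has_integral \<Delta>) {s..t}"
    and E: "((\<lambda>\<tau>. (norm (\<zeta>' \<tau>))\<^sup>2) has_integral E) {s..t}"
    and I: "((\<lambda>\<tau>. area (\<zeta> \<tau>) (dir \<phi> K k \<tau>)) has_integral I) {s..t}"
  obtains l where "reach (dev_point \<phi> K k s (\<zeta> s) \<alpha>) (dev_point \<phi> K k t (\<zeta> t) (\<alpha> + \<Delta>)) l"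
    "2 * l \<le> 2 * (t - s) + 2 * (dir \<phi> K k t \<bullet> \<zeta> t - dir \<phi> K k s \<bullet> \<zeta> s) + E + 2 * K * (k \<bullet> I)"
proof -
  let ?e = "dir \<phi> K k"
  define c where "c = (\<lambda>\<tau>. plane (geod \<phi> K k \<tau>) + \<zeta> \<tau>)"
  define c' where "c' = (\<lambda>\<tau>. ?e \<tau> + \<zeta>' \<tau>)"
  have gp: "((\<lambda>\<tau>. plane (geod \<phi> K k \<tau>)) has_vector_derivative ?e \<tau>) (at \<tau> within S)" for \<tau> S
    using bounded_linear.has_vector_derivative[OF bounded_linear_plane geod_has_vector_derivative] by simp
  obtain \<eta> \<eta>' where \<eta>: "hcurve \<eta> \<eta>' s t" "\<And>\<tau>. plane (\<eta> \<tau>) = c \<tau>" "\<And>\<tau>. plane (\<eta>' \<tau>) = c' \<tau>"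
    "vert (\<eta> s) = vert (dev_point \<phi> K k s (\<zeta> s) \<alpha>)"
  proof (rule horizontal_lift[OF st])
    show "(c has_vector_derivative c' \<tau>) (at \<tau> within {s..t})" for \<tau>
      unfolding c_def c'_def
      by (intro has_vector_derivative_add gp has_vector_derivative_at_within[OF \<zeta>])
    show "continuous_on {s..t} c'"
      unfolding c'_def by (intro continuous_intros continuous_dir continuous_on_subset[OF c]) auto
  qed blast
  note ad = hcurve_admissible[OF \<eta>(1)]
  interpret deviation \<eta> s t \<phi> K k "\<lambda>t. t" "\<lambda>_. 1"
    by unfold_locales (use ad k in \<open>auto intro: has_vector_derivative_id\<close>)
  have z: "z \<tau> = \<zeta> \<tau>" for \<tau> by (simp add: z_def \<eta>(2) c_def)
  obtain N where N: "negligible N" "\<And>\<tau>. \<tau> \<in> {s..t} - N \<Longrightarrow> hvel \<eta> \<tau> = c' \<tau>"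
    using hcurve_hvel[OF \<eta>(1)] \<eta>(3) by metis
  have "\<eta> s = dev_point \<phi> K k s (\<zeta> s) \<alpha>"
    by (rule plane_vert_eqI) (simp_all add: \<eta>(2,4) c_def plane_dev_point)
  moreover have "\<eta> t = dev_point \<phi> K k t (\<zeta> t) (\<alpha> + \<Delta>)"
  proof -
    have As: "A s = \<alpha>"
      by (simp add: A_def z \<eta>(4) vert_dev_point scaleR_add_right)
    have "((\<lambda>\<tau>. area (z \<tau>) (z' \<tau>) + (2 * 1) *\<^sub>R area (z \<tau>) (?e \<tau>)) has_integral A t - A s) {s..t}"
      by (rule lip_deriv_has_integral[OF lip_deriv_A st])
    moreover have "((\<lambda>\<tau>. area (z \<tau>) (z' \<tau>) + (2 * 1) *\<^sub>R area (z \<tau>) (?e \<tau>)) has_integral \<Delta>) {s..t}"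
      by (rule has_integral_spike[OF N(1) _ \<Delta>]) (simp add: z z'_def N(2) c'_def)
    ultimately have "A t - A s = \<Delta>" by (rule has_integral_unique)
    then have "A t = \<alpha> + \<Delta>" using As by (simp add: algebra_simps)
    then show ?thesis using dev_point_A[of t] by (simp add: z)
  qed
  ultimately have r: "reach (dev_point \<phi> K k s (\<zeta> s) \<alpha>) (dev_point \<phi> K k t (\<zeta> t) (\<alpha> + \<Delta>)) (sr_length \<eta> s t)"
    using reachI[OF ad] by simp
  have cdir': "continuous_on {s..t} (\<lambda>\<tau>. K *\<^sub>R (- sin (\<phi> + K * \<tau>), cos (\<phi> + K * \<tau>) *\<^sub>R k))"
    by (intro continuous_intros)
  have "((\<lambda>\<tau>. ?e \<tau> \<bullet> \<zeta>' \<tau> + (K *\<^sub>R (- sin (\<phi> + K * \<tau>), cos (\<phi> + K * \<tau>) *\<^sub>R k)) \<bullet> \<zeta> \<tau>) has_integral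
      (?e t \<bullet> \<zeta> t - ?e s \<bullet> \<zeta> s)) {s..t}"
    by (rule lip_deriv_has_integral[OF lip_deriv_bilinear[OF bounded_bilinear_inner
          lip_deriv_C1[OF dir_has_vector_derivative cdir']
          lip_deriv_C1[OF has_vector_derivative_at_within[OF \<zeta>] continuous_on_subset[OF assms(4)]]] st]) simp
  then have 1: "((\<lambda>\<tau>. ?e \<tau> \<bullet> \<zeta>' \<tau> + - K * (k \<bullet> area (\<zeta> \<tau>) (?e \<tau>))) has_integral
      (?e t \<bullet> \<zeta> t - ?e s \<bullet> \<zeta> s)) {s..t}"
    by (simp only: dir_derivative_inner[OF k])
  have one: "((\<lambda>_. 1 :: real) has_integral t - s) {s..t}"
    using has_integral_const_real[of "1 :: real" s t] st by simp
  have "((\<lambda>\<tau>. 1 + (?e \<tau> \<bullet> \<zeta>' \<tau> + - K * (k \<bullet> area (\<zeta> \<tau>) (?e \<tau>))) + (1/2) * (norm (\<zeta>' \<tau>))\<^sup>2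
      + K * (k \<bullet> area (\<zeta> \<tau>) (?e \<tau>))) has_integral
      (t - s) + (?e t \<bullet> \<zeta> t - ?e s \<bullet> \<zeta> s) + (1/2) * E + K * (k \<bullet> I)) {s..t}"
    by (intro has_integral_add one 1 has_integral_mult_right E
        has_integral_linear[OF I bounded_linear_inner_right, unfolded o_def])
  then have 2: "((\<lambda>\<tau>. 1 + ?e \<tau> \<bullet> \<zeta>' \<tau> + (1/2) * (norm (\<zeta>' \<tau>))\<^sup>2) has_integral
      (t - s) + (?e t \<bullet> \<zeta> t - ?e s \<bullet> \<zeta> s) + (1/2) * E + K * (k \<bullet> I)) {s..t}"
    by (rule has_integral_eq[rotated]) simp
  have "sr_length \<eta> s t \<le> (t - s) + (?e t \<bullet> \<zeta> t - ?e s \<bullet> \<zeta> s) + (1/2) * E + K * (k \<bullet> I)"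
  proof (rule has_integral_le[OF hcurve_length[OF \<eta>(1)] 2])
    fix \<tau>
    have "(norm (c' \<tau>))\<^sup>2 = 1 + 2 * (?e \<tau> \<bullet> \<zeta>' \<tau>) + (norm (\<zeta>' \<tau>))\<^sup>2"
    proof -
      have "?e \<tau> \<bullet> ?e \<tau> = 1" using norm_dir[OF k] by (simp add: norm_eq_1)
      then show ?thesis
        by (simp add: c'_def power2_norm_eq_inner inner_add_left inner_add_right inner_commute)
    qed
    moreover have "0 \<le> (norm (c' \<tau>) - 1)\<^sup>2" by simp
    ultimately show "norm (plane (\<eta>' \<tau>)) \<le> 1 + ?e \<tau> \<bullet> \<zeta>' \<tau> + (1/2) * (norm (\<zeta>' \<tau>))\<^sup>2"
      unfolding \<eta>(3) power2_diff by simp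
  qed
  then show ?thesis using that[OF r] by simp
qed

lemma integral_pos_of_continuous:
  fixes f :: "real \<Rightarrow> real"
  assumes c: "continuous_on {a..b} f" and nn: "\<And>t. t \<in> {a..b} \<Longrightarrow> f t \<ge> 0"
    and t0: "t0 \<in> {a..b}" "f t0 > 0" and ab: "a < b"
  shows "integral {a..b} f > 0"
proof (rule ccontr)
  assume "\<not> integral {a..b} f > 0"
  moreover have "integral {a..b} f \<ge> 0"
    by (rule integral_nonneg[OF integrable_continuous_real[OF c] nn])
  ultimately have "integral (cbox a b) f = 0" by simp
  then have "f t0 = 0"
    using integral_cbox_eq_0_iff[of a b f] c nn t0 ab by (auto simp: box_real)
  with t0 show False by simp
qed

text \<open>
  If the arc is not parallel to the hyperplane \<open>x = const\<close>, then a push in direction \<open>\<delta>\<close> changes the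
  vertical end point linearly in the size of the push. An arbitrary \<open>\<delta>\<close> therefore costs
  the length \<open>K * (k \<bullet> \<delta>) / 2\<close> prescribed by the multiplier of the arc, up to an error of second order.
\<close>
lemma vertical_correction:
  assumes k: "norm k = 1" and ab: "a < b" and t0: "t0 \<in> {a..b}" "cos (\<phi> + K * t0) \<noteq> 0"
  obtains C where "C \<ge> 0" "\<And>\<delta>. \<exists>l. reach (geod \<phi> K k a) (dev_point \<phi> K k b 0 \<delta>) l \<and>
    2 * l \<le> 2 * (b - a) + K * (k \<bullet> \<delta>) + C * (norm \<delta>)\<^sup>2"
proof -
  \<comment> \<open>The factor \<open>cos\<close> makes the integral against the \<open>x\<close>-velocity of the arc positive.\<close>
  define h where "h = (\<lambda>t. cos (\<phi> + K * t) * ((t - a) * (b - t)))"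
  define h' where "h' = (\<lambda>t. - sin (\<phi> + K * t) * K * ((t - a) * (b - t)) + cos (\<phi> + K * t) * (a + b - 2 * t))"
  have dh: "(h has_real_derivative h' t) (at t)" for t
    unfolding h_def h'_def by (auto intro!: derivative_eq_intros simp: algebra_simps)
  have ch: "continuous_on S h" "continuous_on S h'" for S
    unfolding h_def h'_def by (intro continuous_intros)+
  define Nn where "Nn = integral {a..b} (\<lambda>t. cos (\<phi> + K * t) * h t)"
  have "\<exists>t1\<in>{a<..<b}. cos (\<phi> + K * t1) \<noteq> 0"
  proof (rule ccontr)
    assume "\<not> ?thesis"
    then have z: "cos (\<phi> + K * t) = 0" if "t \<in> {a<..<b}" for t using that by blast
    have "cos (\<phi> + K * t0) = 0"
      by (rule continuous_constant_on_closure[of "{a<..<b}" "\<lambda>t. cos (\<phi> + K * t)"])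
        (use z t0 ab in \<open>auto intro!: continuous_intros\<close>)
    then show False using t0 by simp
  qed
  then obtain t1 where t1: "t1 \<in> {a<..<b}" "cos (\<phi> + K * t1) \<noteq> 0" by blast
  have Nn: "Nn > 0"
    unfolding Nn_def
  proof (rule integral_pos_of_continuous[of _ _ _ t1])
    show "continuous_on {a..b} (\<lambda>t. cos (\<phi> + K * t) * h t)"
      by (intro continuous_intros ch)
    have eq: "cos (\<phi> + K * t) * h t = (cos (\<phi> + K * t))\<^sup>2 * ((t - a) * (b - t))" for t
      by (simp add: h_def power2_eq_square)
    show "0 \<le> cos (\<phi> + K * t) * h t" if "t \<in> {a..b}" for t
      unfolding eq using that by simp
    show "0 < cos (\<phi> + K * t1) * h t1"
      unfolding eq using t1 by simp
  qed (use t1 ab in auto)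
  define E where "E = integral {a..b} (\<lambda>t. (h' t)\<^sup>2)"
  have iE: "((\<lambda>t. (h' t)\<^sup>2) has_integral E) {a..b}"
    unfolding E_def by (intro integrable_integral integrable_continuous_real continuous_intros ch)
  have E0: "E \<ge> 0" by (rule has_integral_nonneg[OF iE]) simp
  have iN: "((\<lambda>t. cos (\<phi> + K * t) * h t) has_integral Nn) {a..b}"
    unfolding Nn_def by (intro integrable_integral integrable_continuous_real continuous_intros ch)
  show ?thesis
  proof (rule that[of "E / (4 * Nn\<^sup>2)"])
    show "0 \<le> E / (4 * Nn\<^sup>2)" using E0 by simp
    fix \<delta> :: "real^3"
    define u where "u = (- 1 / (2 * Nn)) *\<^sub>R \<delta>"
    define \<zeta> where "\<zeta> = (\<lambda>t. (0 :: real, h t *\<^sub>R u))"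
    define \<zeta>' where "\<zeta>' = (\<lambda>t. (0 :: real, h' t *\<^sub>R u))"
    have a1: "area (\<zeta> t) (\<zeta>' t) = 0" for t by (simp add: area_def \<zeta>_def \<zeta>'_def)
    have a2: "area (\<zeta> t) (dir \<phi> K k t) = (cos (\<phi> + K * t) * h t) *\<^sub>R (- u)" for t
      by (simp add: area_def \<zeta>_def dir_def)
    have u: "Nn *\<^sub>R (- u) = (1/2) *\<^sub>R \<delta>" using Nn by (simp add: u_def)
    have iI: "((\<lambda>t. area (\<zeta> t) (dir \<phi> K k t)) has_integral (1/2) *\<^sub>R \<delta>) {a..b}"
      unfolding a2 u[symmetric] by (rule has_integral_scaleR_left[OF iN])
    have i\<Delta>: "((\<lambda>t. area (\<zeta> t) (\<zeta>' t) + 2 *\<^sub>R area (\<zeta> t) (dir \<phi> K k t)) has_integral \<delta>) {a..b}"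
      unfolding a1 using has_integral_cmul[OF iI, of 2] by simp
    have "((\<lambda>t. (h' t)\<^sup>2 * (norm u)\<^sup>2) has_integral E * (norm u)\<^sup>2) {a..b}"
      by (rule has_integral_mult_left[OF iE])
    then have iE': "((\<lambda>t. (norm (\<zeta>' t))\<^sup>2) has_integral E * (norm u)\<^sup>2) {a..b}"
      by (simp add: \<zeta>'_def norm_prod_def power_mult_distrib)
    have d: "(\<zeta> has_vector_derivative \<zeta>' t) (at t)" for t
      unfolding \<zeta>_def \<zeta>'_def
      by (intro has_vector_derivative_Pair bounded_linear.has_vector_derivative[OF bounded_linear_scaleR_left]
          has_vector_derivative_const) (use dh in \<open>simp add: has_real_derivative_iff_has_vector_derivative\<close>)
    have c: "continuous_on UNIV \<zeta>'" unfolding \<zeta>'_def by (intro continuous_intros ch)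
    have ends: "\<zeta> a = 0" "\<zeta> b = 0" by (simp_all add: \<zeta>_def h_def zero_prod_def)
    obtain l where "reach (dev_point \<phi> K k a (\<zeta> a) 0) (dev_point \<phi> K k b (\<zeta> b) (0 + \<delta>)) l"
      "2 * l \<le> 2 * (b - a) + 2 * (dir \<phi> K k b \<bullet> \<zeta> b - dir \<phi> K k a \<bullet> \<zeta> a) + E * (norm u)\<^sup>2 + 2 * K * (k \<bullet> ((1/2) *\<^sub>R \<delta>))"
      by (rule reach_dev_point[OF k less_imp_le[OF ab] d c i\<Delta> iE' iI])
    moreover have "E * (norm u)\<^sup>2 = E / (4 * Nn\<^sup>2) * (norm \<delta>)\<^sup>2"
      using Nn by (simp add: u_def power_mult_distrib power_divide)
    ultimately show "\<exists>l. reach (geod \<phi> K k a) (dev_point \<phi> K k b 0 \<delta>) l \<and>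
        2 * l \<le> 2 * (b - a) + K * (k \<bullet> \<delta>) + E / (4 * Nn\<^sup>2) * (norm \<delta>)\<^sup>2"
      by (intro exI[of _ l]) (simp add: ends dev_point_0)
  qed
qed

text \<open>
  The exceptional case of the previous construction: the arc is a line with constant \<open>x\<close>.
\<close>
lemma cos_affine_eq_0:
  fixes \<phi> K :: real
  assumes "a < b" "\<And>t. t \<in> {a..b} \<Longrightarrow> cos (\<phi> + K * t) = 0"
  shows "K = 0" "cos \<phi> = 0" "(sin \<phi>)\<^sup>2 = 1"
proof -
  show K: "K = 0"
  proof (rule ccontr)
    assume K: "K \<noteq> 0"
    define d where "d = min (b - a) (1 / \<bar>K\<bar>)"
    have d: "0 < d" "d \<le> b - a" "\<bar>K * d\<bar> \<le> 1"
      using assms(1) K by (auto simp: d_def min_def abs_mult field_simps)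
    have ca: "cos (\<phi> + K * a) = 0" using assms by simp
    have "cos (\<phi> + K * a + K * d) = 0" using assms(2)[of "a + d"] d assms(1) by (simp add: algebra_simps)
    then have "sin (\<phi> + K * a) * sin (K * d) = 0" using ca by (simp add: cos_add)
    moreover have "sin (\<phi> + K * a) \<noteq> 0" using ca sin_zero_norm_cos_one by fastforce
    moreover have "sin \<bar>K * d\<bar> > 0"
      using d K pi_gt3 by (intro sin_gt_zero) auto
    then have "sin (K * d) \<noteq> 0" by (auto simp: abs_if split: if_splits)
    ultimately show False by simp
  qed
  show c: "cos \<phi> = 0" using assms K by force
  show "(sin \<phi>)\<^sup>2 = 1" using sin_cos_squared_add[of \<phi>] c by simp
qed

text \<open>
  Along a line with constant \<open>x\<close> only displacements parallel to \<open>k\<close> are reached to first order (the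
  coefficient \<open>\<alpha>\<close> below); the orthogonal part \<open>\<delta>2\<close> must be produced as the area of a deviation of size
  \<open>sqrt (norm \<delta>2)\<close>, whose excess length is of the order of that area. This is why the orthogonal part enters the
  bound linearly.
\<close>
lemma vertical_correction_singular:
  assumes k: "norm k = 1" and ab: "a < b" and \<phi>: "cos \<phi> = 0" "(sin \<phi>)\<^sup>2 = 1"
  obtains C where "C \<ge> 0" "\<And>\<delta>. \<exists>l. reach (geod \<phi> 0 k a) (dev_point \<phi> 0 k b 0 \<delta>) l \<and>
    2 * l \<le> 2 * (b - a) + C * ((norm \<delta>)\<^sup>2 + norm (\<delta> - (k \<bullet> \<delta>) *\<^sub>R k))"
proof -
  define w where "w = (\<lambda>t. (t - a) * (b - t))"
  define w' where "w' = (\<lambda>t. a + b - 2 * t)"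
  have dw: "(w has_real_derivative w' t) (at t)" for t
    unfolding w_def w'_def by (auto intro!: derivative_eq_intros simp: algebra_simps)
  have dw': "(w' has_real_derivative -2) (at t)" for t
    unfolding w'_def by (auto intro!: derivative_eq_intros)
  have cw: "continuous_on S w" "continuous_on S w'" for S
    unfolding w_def w'_def by (intro continuous_intros)+
  have int: "(f has_integral integral {a..b} f) {a..b}" if "continuous_on {a..b} f" for f :: "real \<Rightarrow> real"
    using that by (intro integrable_integral integrable_continuous_real)
  define W1 where "W1 = integral {a..b} w"
  define W2 where "W2 = integral {a..b} (\<lambda>t. (w t)\<^sup>2)"
  have mid: "(a + b) / 2 \<in> {a..b}" using ab by simp
  moreover have "w ((a + b) / 2) > 0"
    unfolding w_def by (rule mult_pos_pos) (use ab in \<open>simp_all add: field_simps\<close>)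
  ultimately have mid: "(a + b) / 2 \<in> {a..b}" "w ((a + b) / 2) > 0" by blast+
  have wnn: "w t \<ge> 0" if "t \<in> {a..b}" for t using that by (simp add: w_def)
  have W1: "W1 > 0"
    unfolding W1_def by (rule integral_pos_of_continuous[OF cw(1) wnn mid ab])
  have W2: "W2 > 0"
    unfolding W2_def by (rule integral_pos_of_continuous[OF _ _ mid(1) _ ab])
      (use mid in \<open>auto intro!: continuous_intros cw\<close>)
  have iW1: "(w has_integral W1) {a..b}" unfolding W1_def by (rule int[OF cw(1)])
  have iW2: "((\<lambda>t. (w t)\<^sup>2) has_integral W2) {a..b}"
    unfolding W2_def by (intro int continuous_intros cw)
  have iww': "((\<lambda>t. w t * w' t) has_integral 0) {a..b}"
  proof -
    have "((\<lambda>t. w t * w' t) has_integral (w b)\<^sup>2 / 2 - (w a)\<^sup>2 / 2) {a..b}"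
      by (rule fundamental_theorem_of_calculus)
        (use ab dw in \<open>auto intro!: derivative_eq_intros simp flip: has_real_derivative_iff_has_vector_derivative
            simp: has_field_derivative_at_within\<close>)
    then show ?thesis by (simp add: w_def)
  qed
  define f2' where "f2' = (\<lambda>t. (w' t)\<^sup>2 - 2 * w t)"
  have cf2: "continuous_on S f2'" for S unfolding f2'_def by (intro continuous_intros cw)
  define E1 where "E1 = integral {a..b} (\<lambda>t. (w' t)\<^sup>2)"
  define E2 where "E2 = integral {a..b} (\<lambda>t. (f2' t)\<^sup>2)"
  have iE1: "((\<lambda>t. (w' t)\<^sup>2) has_integral E1) {a..b}" and iE2: "((\<lambda>t. (f2' t)\<^sup>2) has_integral E2) {a..b}"
    unfolding E1_def E2_def by (intro int continuous_intros cw cf2)+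
  have E0: "E1 \<ge> 0" "E2 \<ge> 0" using has_integral_nonneg[OF iE1] has_integral_nonneg[OF iE2] by auto
  define C where "C = E1 / (2 * W1\<^sup>2) + E2 / (2 * W2\<^sup>2) + E1"
  show ?thesis
  proof (rule that[of C])
    show "C \<ge> 0" using E0 by (simp add: C_def)
    fix \<delta> :: "real^3"
    define \<delta>1 where "\<delta>1 = k \<bullet> \<delta>"
    define \<delta>2 where "\<delta>2 = \<delta> - \<delta>1 *\<^sub>R k"
    define \<beta> where "\<beta> = norm \<delta>2"
    define s where "s = sqrt \<beta>"
    have s2: "s * s = \<beta>" by (simp add: s_def \<beta>_def)
    define u where "u = \<delta>2 /\<^sub>R \<beta>"
    have u: "\<beta> *\<^sub>R u = \<delta>2" "norm u \<le> 1" by (cases "\<delta>2 = 0"; simp add: u_def \<beta>_def)+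
    define \<alpha> where "\<alpha> = sin \<phi> * \<delta>1 / (2 * W1)"
    define c2 where "c2 = s / (2 * W2)"
    \<comment> \<open>\<open>w\<close> and \<open>w * w'\<close> are even and odd about the midpoint, so the first one moves the end point along \<open>k\<close>
       without enclosing area with \<open>w\<close>, and the second one encloses area but has mean zero.\<close>
    define X where "X = (\<lambda>t. \<alpha> * w t + c2 * (w t * w' t))"
    define X' where "X' = (\<lambda>t. \<alpha> * w' t + c2 * f2' t)"
    define \<zeta> where "\<zeta> = (\<lambda>t. (X t, (s * w t) *\<^sub>R u))"
    define \<zeta>' where "\<zeta>' = (\<lambda>t. (X' t, (s * w' t) *\<^sub>R u))"
    have dX: "(X has_real_derivative X' t) (at t)" for t
      unfolding X_def X'_def f2'_def
      by (rule derivative_eq_intros dw dw' refl)+ (simp add: algebra_simps power2_eq_square)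
    have dsw: "((\<lambda>t. s * w t) has_real_derivative s * w' t) (at t)" for t
      by (rule derivative_eq_intros dw refl)+ simp
    have d: "(\<zeta> has_vector_derivative \<zeta>' t) (at t)" for t
      unfolding \<zeta>_def \<zeta>'_def
      by (intro has_vector_derivative_Pair bounded_linear.has_vector_derivative[OF bounded_linear_scaleR_left])
        (use dX dsw in \<open>simp_all add: has_real_derivative_iff_has_vector_derivative\<close>)
    have c: "continuous_on S \<zeta>'" for S unfolding \<zeta>'_def X'_def by (intro continuous_intros cw cf2)
    have ends: "\<zeta> a = 0" "\<zeta> b = 0" by (simp_all add: \<zeta>_def X_def w_def zero_prod_def)
    have a1: "area (\<zeta> t) (\<zeta>' t) = ((w t)\<^sup>2) *\<^sub>R ((1 / W2) *\<^sub>R \<delta>2)" for t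
    proof -
      have "X t * (s * w' t) - X' t * (s * w t) = (w t)\<^sup>2 * (1 / W2) * \<beta>"
        using W2 unfolding s2[symmetric]
        by (simp add: X_def X'_def f2'_def c2_def field_simps power2_eq_square)
      then have "area (\<zeta> t) (\<zeta>' t) = ((w t)\<^sup>2 * (1 / W2) * \<beta>) *\<^sub>R u"
        by (simp add: area_def \<zeta>_def \<zeta>'_def flip: scaleR_diff_left)
      then show ?thesis unfolding u(1)[symmetric] by simp
    qed
    have a2: "area (\<zeta> t) (dir \<phi> 0 k t) = X t *\<^sub>R (sin \<phi> *\<^sub>R k)" for t
      by (simp add: area_def \<zeta>_def dir_def \<phi>)
    have "(X has_integral \<alpha> * W1 + c2 * 0) {a..b}"
      unfolding X_def by (intro has_integral_add has_integral_mult_right iW1 iww')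
    then have iX: "(X has_integral \<alpha> * W1) {a..b}" by simp
    have ss: "sin \<phi> * sin \<phi> = 1" using \<phi>(2) by (simp add: power2_eq_square)
    have "(\<alpha> * W1) * sin \<phi> = \<delta>1 / 2"
      using W1 ss by (simp add: \<alpha>_def field_simps)
    then have I_eq: "(\<alpha> * W1) *\<^sub>R (sin \<phi> *\<^sub>R k) = (\<delta>1 / 2) *\<^sub>R k" by simp
    have iI: "((\<lambda>t. area (\<zeta> t) (dir \<phi> 0 k t)) has_integral (\<delta>1 / 2) *\<^sub>R k) {a..b}"
      unfolding a2 I_eq[symmetric] by (rule has_integral_scaleR_left[OF iX])
    have "((\<lambda>t. area (\<zeta> t) (\<zeta>' t) + 2 *\<^sub>R area (\<zeta> t) (dir \<phi> 0 k t)) has_integral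
        W2 *\<^sub>R ((1 / W2) *\<^sub>R \<delta>2) + 2 *\<^sub>R (\<delta>1 / 2) *\<^sub>R k) {a..b}"
      by (intro has_integral_add has_integral_cmul iI) (unfold a1, rule has_integral_scaleR_left[OF iW2])
    moreover have "W2 *\<^sub>R ((1 / W2) *\<^sub>R \<delta>2) + 2 *\<^sub>R (\<delta>1 / 2) *\<^sub>R k = \<delta>"
      using W2 by (simp add: \<delta>2_def)
    ultimately have i\<Delta>: "((\<lambda>t. area (\<zeta> t) (\<zeta>' t) + 2 *\<^sub>R area (\<zeta> t) (dir \<phi> 0 k t)) has_integral \<delta>) {a..b}"
      by simp
    define E where "E = integral {a..b} (\<lambda>t. (norm (\<zeta>' t))\<^sup>2)"
    have iE: "((\<lambda>t. (norm (\<zeta>' t))\<^sup>2) has_integral E) {a..b}"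
      unfolding E_def by (intro int continuous_intros c)
    have "((\<lambda>t. 2 * \<alpha>\<^sup>2 * (w' t)\<^sup>2 + 2 * c2\<^sup>2 * (f2' t)\<^sup>2 + \<beta> * (w' t)\<^sup>2) has_integral
        2 * \<alpha>\<^sup>2 * E1 + 2 * c2\<^sup>2 * E2 + \<beta> * E1) {a..b}"
      by (intro has_integral_add has_integral_mult_right iE1 iE2)
    then have "E \<le> 2 * \<alpha>\<^sup>2 * E1 + 2 * c2\<^sup>2 * E2 + \<beta> * E1"
    proof (rule has_integral_le[OF iE])
      fix t
      have "0 \<le> (\<alpha> * w' t - c2 * f2' t)\<^sup>2" by simp
      then have "(X' t)\<^sup>2 \<le> 2 * \<alpha>\<^sup>2 * (w' t)\<^sup>2 + 2 * c2\<^sup>2 * (f2' t)\<^sup>2"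
        by (simp add: X'_def power2_eq_square algebra_simps)
      moreover have "(norm ((s * w' t) *\<^sub>R u))\<^sup>2 \<le> \<beta> * (w' t)\<^sup>2"
      proof -
        have "(norm ((s * w' t) *\<^sub>R u))\<^sup>2 = (\<beta> * (w' t)\<^sup>2) * (norm u)\<^sup>2"
          unfolding s2[symmetric] by (simp add: power_mult_distrib power2_eq_square[of s])
        also have "\<dots> \<le> (\<beta> * (w' t)\<^sup>2) * 1"
          by (rule mult_left_mono) (use u(2) in \<open>auto simp: \<beta>_def abs_square_le_1\<close>)
        finally show ?thesis by simp
      qed
      ultimately show "(norm (\<zeta>' t))\<^sup>2 \<le> 2 * \<alpha>\<^sup>2 * (w' t)\<^sup>2 + 2 * c2\<^sup>2 * (f2' t)\<^sup>2 + \<beta> * (w' t)\<^sup>2"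
        by (simp add: \<zeta>'_def norm_prod_def)
    qed
    also have "2 * \<alpha>\<^sup>2 * E1 = E1 / (2 * W1\<^sup>2) * \<delta>1\<^sup>2"
      using W1 \<phi>(2) by (simp add: \<alpha>_def power_divide power_mult_distrib)
    also have "2 * c2\<^sup>2 * E2 = E2 / (2 * W2\<^sup>2) * \<beta>"
      using W2 unfolding s2[symmetric] by (simp add: c2_def power_divide power_mult_distrib power2_eq_square[of s])
    finally have E: "E \<le> E1 / (2 * W1\<^sup>2) * \<delta>1\<^sup>2 + (E2 / (2 * W2\<^sup>2) + E1) * \<beta>"
      by (simp add: distrib_right mult.commute[of \<beta>])
    have "\<bar>\<delta>1\<bar> \<le> norm \<delta>" using Cauchy_Schwarz_ineq2[of k \<delta>] k by (simp add: \<delta>1_def)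
    then have "\<delta>1\<^sup>2 \<le> (norm \<delta>)\<^sup>2" using abs_le_square_iff[of \<delta>1 "norm \<delta>"] by simp
    then have "E1 / (2 * W1\<^sup>2) * \<delta>1\<^sup>2 \<le> C * (norm \<delta>)\<^sup>2"
      by (intro mult_mono) (use E0 in \<open>auto simp: C_def\<close>)
    moreover have "(E2 / (2 * W2\<^sup>2) + E1) * \<beta> \<le> C * \<beta>"
      by (intro mult_right_mono) (use E0 in \<open>auto simp: C_def \<beta>_def\<close>)
    ultimately have E': "E \<le> C * ((norm \<delta>)\<^sup>2 + \<beta>)" using E by (simp add: distrib_left)
    obtain l where "reach (dev_point \<phi> 0 k a (\<zeta> a) 0) (dev_point \<phi> 0 k b (\<zeta> b) (0 + \<delta>)) l"
      "2 * l \<le> 2 * (b - a) + 2 * (dir \<phi> 0 k b \<bullet> \<zeta> b - dir \<phi> 0 k a \<bullet> \<zeta> a) + E + 2 * 0 * (k \<bullet> ((\<delta>1 / 2) *\<^sub>R k))"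
      by (rule reach_dev_point[OF k less_imp_le[OF ab] d c i\<Delta> iE iI])
    then show "\<exists>l. reach (geod \<phi> 0 k a) (dev_point \<phi> 0 k b 0 \<delta>) l \<and>
        2 * l \<le> 2 * (b - a) + C * ((norm \<delta>)\<^sup>2 + norm (\<delta> - (k \<bullet> \<delta>) *\<^sub>R k))"
      using E' by (intro exI[of _ l]) (simp add: ends dev_point_0 \<beta>_def \<delta>2_def \<delta>1_def)
  qed
qed

section \<open>Minimizers have no corners\<close>

text \<open>
  For a curve of unit speed the energy equals the length of the interval, so that only the boundary
  terms and the quadratic form in the deviation remain.
\<close>
lemma (in deviation) energy_balance:
  assumes ps: "\<And>t. p t = 1" and N: "negligible N" "\<And>t. t \<in> {a..b} - N \<Longrightarrow> norm (hvel \<gamma> t) = 1"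
  shows "((\<lambda>t. K * (k \<bullet> area (z t) (z' t)) - (norm (z' t))\<^sup>2) has_integral G b - G a) {a..b}"
  by (rule has_integral_spike[OF N(1) _ lip_deriv_has_integral[OF lip_deriv_G ab]]) (simp add: ps N(2))

text \<open>
  Let \<open>h\<close> be the energy of the deviation of \<open>\<gamma>\<close> from the arc on an interval of length \<open>r\<close> after \<open>T\<close>. The competitor
  constructed below saves \<open>h\<close> and loses only a multiple of \<open>r * h\<close>, so minimality forces \<open>h = 0\<close> when \<open>r\<close> is
  small. The map \<open>R\<close> picks the part of a vertical displacement that is expensive to correct; it
  annihilates the first-order part of the displacement, so the expensive part is quadratic in the deviation.
\<close>
lemma extension_estimate:
  assumes k: "norm k = 1" and K: "0 \<le> K" and m: "length_minimizing \<gamma> a b"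
    and aT: "a < a1" "a1 < T" "T < b" "b \<le> T + 1"
    and eq: "\<And>t. t \<in> {a..T} \<Longrightarrow> \<gamma> t = geod \<phi> K k t"
    and N: "negligible N" "\<And>t. t \<in> {a..b} - N \<Longrightarrow> norm (hvel \<gamma> t) = 1"
    and C: "C \<ge> 0" "\<And>\<delta>. \<exists>l. reach (geod \<phi> K k a) (dev_point \<phi> K k a1 0 \<delta>) l \<and>
        2 * l \<le> 2 * (a1 - a) + K * (k \<bullet> \<delta>) + C * ((norm \<delta>)\<^sup>2 + norm (R \<delta>))"
    and R: "bounded_linear R" "\<And>v. norm (R v) \<le> norm v" "\<And>u t. R (area u (dir \<phi> K k t)) = 0"
    and small: "(b - T) * (K + C * ((4 + 2 * (b - a1))\<^sup>2 + 1) + 1 / (T - a1)) < 1"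
    and t: "t \<in> {T..b}"
  shows "\<gamma> t = geod \<phi> K k t"
proof -
  interpret R: bounded_linear R by fact
  let ?e = "dir \<phi> K k"
  have adab: "admissible \<gamma> a b" using m by (simp add: length_minimizing_iff)
  have ad: "admissible \<gamma> T b" by (rule sr_length_split(2)[OF adab]) (use aT in auto)
  interpret deviation \<gamma> T b \<phi> K k "\<lambda>t. t" "\<lambda>_. 1"
    by unfold_locales (use ad k in \<open>auto intro: has_vector_derivative_id\<close>)
  define r where "r = b - T"
  define M where "M = b - a1"
  have r: "0 < r" "r \<le> 1" using aT by (auto simp: r_def)
  have M: "0 < M" "T - a1 \<le> M" "0 < T - a1" using aT by (auto simp: M_def)
  have N': "norm (hvel \<gamma> t) = 1" if "t \<in> {T..b} - N" for t using N(2)[of t] that aT by auto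
  have \<gamma>T: "\<gamma> T = geod \<phi> K k T" using eq aT by simp
  have zT: "z T = 0" "A T = 0" "G T = 0"
    using \<gamma>T by (simp_all add: z_def A_def G_def area.zero_right)
  have iz': "(\<lambda>t. (norm (z' t))\<^sup>2) integrable_on {T..b}" using integrable_z' by simp
  define h where "h = integral {T..b} (\<lambda>t. (norm (z' t))\<^sup>2)"
  have ih: "((\<lambda>t. (norm (z' t))\<^sup>2) has_integral h) {T..b}" unfolding h_def using iz' by (rule integrable_integral)
  have h0: "h \<ge> 0" by (rule has_integral_nonneg[OF ih]) simp
  have const: "((\<lambda>_. c) has_integral r * c) {T..b}" for c :: real
    using has_integral_const_real[of c T b] aT by (simp add: r_def)
  have h4: "h \<le> r * 4"
  proof (rule has_integral_le)
    show "((\<lambda>t. if t \<in> N then 4 else (norm (z' t))\<^sup>2) has_integral h) {T..b}"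
      by (rule has_integral_spike[OF N(1) _ ih]) simp
    fix t assume t: "t \<in> {T..b}"
    have "norm (z' t) \<le> 2" if "t \<notin> N"
    proof -
      have "norm (z' t) \<le> norm (hvel \<gamma> t) + norm (?e t)"
        unfolding z'_def by (simp add: norm_triangle_ineq4)
      then show ?thesis using N'[of t] that t k by simp
    qed
    then have "(norm (z' t))\<^sup>2 \<le> 2\<^sup>2" if "t \<notin> N" using that by (intro power_mono) auto
    then show "(if t \<in> N then 4 else (norm (z' t))\<^sup>2) \<le> 4" by simp
  qed (rule const)
  define S where "S = sqrt (r * h)"
  have S0: "S \<ge> 0" and S2: "S\<^sup>2 = r * h" using r h0 by (auto simp: S_def)
  have "r * h \<le> 1 * (1 * 4)" using r h0 h4 by (intro mult_mono) auto
  then have "S\<^sup>2 \<le> 2\<^sup>2" using S2 by simp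
  then have S_le: "S \<le> 2" by (rule power2_le_imp_le) simp
  have zsq: "(norm (z t))\<^sup>2 \<le> r * h" if "t \<in> {T..b}" for t
  proof -
    have "(norm (z t - z T))\<^sup>2 \<le> (t - T) * h"
      unfolding h_def by (rule lip_deriv_increment_squared_le[OF lip_deriv_z]) (use that in auto)
    also have "\<dots> \<le> r * h" by (rule mult_right_mono) (use that h0 in \<open>auto simp: r_def\<close>)
    finally show ?thesis using zT by simp
  qed
  have zS: "norm (z t) \<le> S" if "t \<in> {T..b}" for t
    using zsq[OF that] by (simp add: S_def real_le_rsqrt)
  define d where "d = z b"
  have dS: "norm d \<le> S" and d2: "(norm d)\<^sup>2 \<le> r * h" using zS[of b] zsq[of b] aT by (auto simp: d_def)
  \<comment> \<open>The vertical deviation \<open>A b\<close> equals \<open>V + 2 *\<^sub>R J\<close>: \<open>V\<close> is quadratic in the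
     deviation, hence of order \<open>r * h\<close>; \<open>J\<close> is linear, hence only of order \<open>sqrt (r * h)\<close>.\<close>
  have cz: "continuous_on {T..b} z" by (rule lip_deriv_continuous_on[OF lip_deriv_z])
  define J where "J = integral {T..b} (\<lambda>t. area (z t) (?e t))"
  have iJ: "((\<lambda>t. area (z t) (?e t)) has_integral J) {T..b}"
    unfolding J_def
    by (intro integrable_integral integrable_continuous_real area.continuous_on cz continuous_dir)
  have nJ: "norm J \<le> r * S"
  proof -
    have "norm J \<le> integral {T..b} (\<lambda>_. S)" unfolding J_def
    proof (rule integral_norm_bound_integral)
      fix t assume "t \<in> {T..b}"
      then show "norm (area (z t) (?e t)) \<le> S"
        using norm_area_le[of "z t" "?e t"] zS[of t] k by simp
    qed (use iJ in auto)
    then show ?thesis unfolding integral_unique[OF const] .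
  qed
  define V where "V = A b - 2 *\<^sub>R J"
  have "((\<lambda>t. area (z t) (z' t) + (2 * 1) *\<^sub>R area (z t) (?e t)) has_integral A b) {T..b}"
    using lip_deriv_has_integral[OF lip_deriv_A ab] zT by simp
  from has_integral_diff[OF this has_integral_cmul[OF iJ, of 2]]
  have iV: "((\<lambda>t. area (z t) (z' t)) has_integral V) {T..b}"
    by (simp add: V_def)
  have nV: "norm V \<le> r * h"
  proof -
    have i: "((\<lambda>t. 1/2 * (h + r * (norm (z' t))\<^sup>2)) has_integral 1/2 * (r * h + r * h)) {T..b}"
      by (intro has_integral_mult_right has_integral_add const ih)
    have "norm (integral {T..b} (\<lambda>t. area (z t) (z' t))) \<le> integral {T..b} (\<lambda>t. 1/2 * (h + r * (norm (z' t))\<^sup>2))"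
    proof (rule integral_norm_bound_integral)
      fix t assume t: "t \<in> {T..b}"
      have "0 \<le> (norm (z t) - r * norm (z' t))\<^sup>2" by simp
      then have "2 * r * (norm (z t) * norm (z' t)) \<le> (norm (z t))\<^sup>2 + r * (r * (norm (z' t))\<^sup>2)"
        by (simp add: power2_eq_square algebra_simps)
      also have "\<dots> \<le> r * h + r * (r * (norm (z' t))\<^sup>2)" using zsq[OF t] by simp
      also have "\<dots> = 2 * r * (1/2 * (h + r * (norm (z' t))\<^sup>2))" by (simp add: distrib_left)
      finally have "norm (z t) * norm (z' t) \<le> 1/2 * (h + r * (norm (z' t))\<^sup>2)"
        using r(1) by simp
      then show "norm (area (z t) (z' t)) \<le> 1/2 * (h + r * (norm (z' t))\<^sup>2)"
        using norm_area_le order_trans by blast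
    qed (use i iV in blast)+
    then show ?thesis unfolding integral_unique[OF i] integral_unique[OF iV] by (simp add: mult.commute)
  qed
  \<comment> \<open>The competitor reaches the plane end point of \<open>\<gamma>\<close> by a deviation that is linear in time and starts
     already at \<open>a1\<close>. This costs only \<open>(norm d)\<^sup>2 / M\<close>, of order \<open>r * h\<close>, instead of the energy \<open>h\<close>. The
     missing vertical displacement \<open>\<delta>\<close> is produced between \<open>a\<close> and \<open>a1\<close>, where \<open>\<gamma>\<close> is the arc.\<close>
  define \<zeta> where "\<zeta> = (\<lambda>t. ((t - a1) / M) *\<^sub>R d)"
  define \<zeta>' where "\<zeta>' = (\<lambda>t :: real. (1 / M) *\<^sub>R d)"
  have d\<zeta>: "(\<zeta> has_vector_derivative \<zeta>' t) (at t)" for t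
    unfolding \<zeta>_def \<zeta>'_def
    by (intro bounded_linear.has_vector_derivative[OF bounded_linear_scaleR_left])
      (use M in \<open>auto intro!: derivative_eq_intros simp flip: has_real_derivative_iff_has_vector_derivative\<close>)
  have c\<zeta>': "continuous_on S' \<zeta>'" for S' unfolding \<zeta>'_def by (intro continuous_intros)
  have c\<zeta>: "continuous_on S' \<zeta>" for S' unfolding \<zeta>_def by (intro continuous_intros) (use M in auto)
  have \<zeta>_ends: "\<zeta> a1 = 0" "\<zeta> b = d" using M by (simp_all add: \<zeta>_def M_def)
  define I where "I = integral {a1..b} (\<lambda>t. area (\<zeta> t) (?e t))"
  have iI: "((\<lambda>t. area (\<zeta> t) (?e t)) has_integral I) {a1..b}"
    unfolding I_def
    by (intro integrable_integral integrable_continuous_real area.continuous_on c\<zeta> continuous_dir)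
  have constM: "((\<lambda>_. c) has_integral M * c) {a1..b}" for c :: real
    using has_integral_const_real[of c a1 b] aT by (simp add: M_def)
  have nI: "norm I \<le> M * S"
  proof -
    have "norm I \<le> integral {a1..b} (\<lambda>_. S)" unfolding I_def
    proof (rule integral_norm_bound_integral)
      fix t assume t: "t \<in> {a1..b}"
      have "norm (\<zeta> t) \<le> 1 * norm d"
        unfolding \<zeta>_def norm_scaleR by (rule mult_right_mono) (use t M in \<open>auto simp: M_def\<close>)
      then show "norm (area (\<zeta> t) (?e t)) \<le> S"
        using norm_area_le[of "\<zeta> t" "?e t"] dS k by simp
    qed (use iI in auto)
    then show ?thesis unfolding integral_unique[OF constM] .
  qed
  have i\<Delta>: "((\<lambda>t. area (\<zeta> t) (\<zeta>' t) + 2 *\<^sub>R area (\<zeta> t) (?e t)) has_integral 2 *\<^sub>R I) {a1..b}"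
    using has_integral_cmul[OF iI, of 2]
    by (simp add: \<zeta>_def \<zeta>'_def area.scaleR_left area.scaleR_right)
  have iE: "((\<lambda>t. (norm (\<zeta>' t))\<^sup>2) has_integral (norm d)\<^sup>2 / M) {a1..b}"
    using constM[of "(norm d)\<^sup>2 / M\<^sup>2"] M
    by (simp add: \<zeta>'_def power_divide power2_eq_square)
  define \<delta> where "\<delta> = A b - 2 *\<^sub>R I"
  obtain l1 where l1: "reach (geod \<phi> K k a) (dev_point \<phi> K k a1 0 \<delta>) l1"
    "2 * l1 \<le> 2 * (a1 - a) + K * (k \<bullet> \<delta>) + C * ((norm \<delta>)\<^sup>2 + norm (R \<delta>))"
    using C(2) by blast
  obtain l2 where l2: "reach (dev_point \<phi> K k a1 (\<zeta> a1) \<delta>) (dev_point \<phi> K k b (\<zeta> b) (\<delta> + 2 *\<^sub>R I)) l2"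
    "2 * l2 \<le> 2 * (b - a1) + 2 * (?e b \<bullet> \<zeta> b - ?e a1 \<bullet> \<zeta> a1) + (norm d)\<^sup>2 / M + 2 * K * (k \<bullet> I)"
    by (rule reach_dev_point[OF k _ d\<zeta> c\<zeta>' i\<Delta> iE iI]) (use aT in auto)
  have "dev_point \<phi> K k b (\<zeta> b) (\<delta> + 2 *\<^sub>R I) = \<gamma> b"
    using dev_point_A[of b] by (simp add: \<zeta>_ends d_def \<delta>_def)
  then have "reach (\<gamma> a) (\<gamma> b) (l1 + l2)"
    using reach_trans[OF l1(1)] l2(1) eq[of a] aT \<zeta>_ends by simp
  moreover have "sr_length \<gamma> a b = b - a"
  proof (rule has_integral_unique[OF sr_length_has_integral(2)[OF adab]])
    have "((\<lambda>_. 1 :: real) has_integral b - a) {a..b}"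
      using has_integral_const_real[of "1 :: real" a b] aT by simp
    then show "((\<lambda>t. norm (hvel \<gamma> t)) has_integral b - a) {a..b}"
      by (rule has_integral_spike[OF N(1), rotated]) (simp add: N(2))
  qed
  ultimately have "b - a \<le> l1 + l2" using m by (simp add: length_minimizing_iff)
  then have "0 \<le> 2 * (l1 + l2) - 2 * (b - a)" by simp
  also have "\<dots> \<le> K * (k \<bullet> \<delta>) + C * ((norm \<delta>)\<^sup>2 + norm (R \<delta>)) + 2 * (?e b \<bullet> d) + (norm d)\<^sup>2 / M + 2 * K * (k \<bullet> I)"
    using l1(2) l2(2) unfolding \<zeta>_ends by simp
  also have "\<dots> = G b + C * ((norm \<delta>)\<^sup>2 + norm (R \<delta>)) + (norm d)\<^sup>2 / M"
    by (simp add: G_def \<delta>_def d_def inner_diff_right algebra_simps)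
  also have "G b = K * (k \<bullet> V) - h"
  proof -
    have "((\<lambda>t. K * (k \<bullet> area (z t) (z' t)) - (norm (z' t))\<^sup>2) has_integral G b - G T) {T..b}"
      by (rule energy_balance[OF _ N(1)]) (auto simp: N')
    moreover have "((\<lambda>t. K * (k \<bullet> area (z t) (z' t)) - (norm (z' t))\<^sup>2) has_integral K * (k \<bullet> V) - h) {T..b}"
      by (intro has_integral_diff has_integral_mult_right ih
          has_integral_linear[OF iV bounded_linear_inner_right, unfolded o_def])
    ultimately have "G b - G T = K * (k \<bullet> V) - h" by (rule has_integral_unique)
    then show ?thesis using zT by simp
  qed
  finally have main: "h \<le> K * (k \<bullet> V) + C * ((norm \<delta>)\<^sup>2 + norm (R \<delta>)) + (norm d)\<^sup>2 / M" by simp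
  have 1: "K * (k \<bullet> V) \<le> K * (r * h)"
    using norm_cauchy_schwarz[of k V] nV k K by (intro mult_left_mono) auto
  have \<delta>: "\<delta> = V + 2 *\<^sub>R (J - I)" by (simp add: \<delta>_def V_def algebra_simps)
  have "norm \<delta> \<le> norm V + 2 * (norm J + norm I)"
  proof -
    have "norm \<delta> \<le> norm V + norm (2 *\<^sub>R (J - I))" unfolding \<delta> by (rule norm_triangle_ineq)
    then show ?thesis using norm_triangle_ineq4[of J I] by simp
  qed
  also have "\<dots> \<le> S\<^sup>2 + 2 * (r * S + M * S)" using nV nJ nI S2 by simp
  also have "\<dots> \<le> 2 * S + 2 * (1 * S + M * S)"
    unfolding power2_eq_square using r S_le S0 by (intro add_mono mult_left_mono mult_right_mono) auto
  also have "\<dots> = (4 + 2 * M) * S" by (simp add: algebra_simps)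
  finally have "(norm \<delta>)\<^sup>2 \<le> ((4 + 2 * M) * S)\<^sup>2" by (rule power_mono) simp
  then have 2: "(norm \<delta>)\<^sup>2 \<le> (4 + 2 * M)\<^sup>2 * (r * h)" by (simp add: power_mult_distrib S2)
  have "((\<lambda>t. R (area (z t) (?e t))) has_integral R J) {T..b}" "((\<lambda>t. R (area (\<zeta> t) (?e t))) has_integral R I) {a1..b}"
    using has_integral_linear[OF iJ R(1)] has_integral_linear[OF iI R(1)] by (simp_all add: o_def)
  then have "R J = 0" "R I = 0"
    unfolding R(3) using has_integral_unique has_integral_0 by metis+
  then have "R \<delta> = R V" by (simp add: \<delta> R.add R.scaleR R.diff)
  then have 3: "norm (R \<delta>) \<le> r * h" using R(2)[of V] nV by simp
  have "C * ((norm \<delta>)\<^sup>2 + norm (R \<delta>)) \<le> C * ((4 + 2 * M)\<^sup>2 * (r * h) + r * h)"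
    by (rule mult_left_mono) (use 2 3 C in auto)
  moreover have "(norm d)\<^sup>2 / M \<le> (r * h) / (T - a1)"
    by (rule frac_le) (use d2 M r h0 in auto)
  ultimately have "h \<le> K * (r * h) + C * ((4 + 2 * M)\<^sup>2 * (r * h) + r * h) + (r * h) / (T - a1)"
    using main 1 by linarith
  also have "\<dots> = (r * (K + C * ((4 + 2 * M)\<^sup>2 + 1) + 1 / (T - a1))) * h"
    by (simp add: algebra_simps)
  finally have le: "h \<le> (r * (K + C * ((4 + 2 * M)\<^sup>2 + 1) + 1 / (T - a1))) * h" .
  have "h = 0"
  proof (rule ccontr)
    assume "h \<noteq> 0"
    then have "h > 0" using h0 by simp
    then have "(r * (K + C * ((4 + 2 * M)\<^sup>2 + 1) + 1 / (T - a1))) * h < 1 * h"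
      using small unfolding r_def M_def by (intro mult_strict_right_mono)
    then show False using le by simp
  qed
  show ?thesis
  proof (rule z_eq_0_imp_eq_geod[OF _ _ t])
    show "z t = 0" if "t \<in> {T..b}" for t using zsq[OF that] \<open>h = 0\<close> by simp
  qed (use \<gamma>T in simp)
qed

text \<open>
  A minimizer that starts as an arc continues as the same arc. Corners are excluded in particular, although a
  minimizer is only assumed to be Lipschitz. In the estimate above, \<open>R\<close> is zero except for lines
  with constant \<open>x\<close>, where it is the projection orthogonal to \<open>k\<close>.
\<close>
theorem geod_extension:
  assumes k: "norm k = 1" and K: "0 \<le> K" and m: "length_minimizing \<gamma> a b"
    and aT: "a < T" "T < b"
    and eq: "\<And>t. t \<in> {a..T} \<Longrightarrow> \<gamma> t = geod \<phi> K k t"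
    and N: "negligible N" "\<And>t. t \<in> {a..b} - N \<Longrightarrow> norm (hvel \<gamma> t) = 1"
  obtains r where "r > 0" "T + r \<le> b" "\<And>t. t \<in> {T..T + r} \<Longrightarrow> \<gamma> t = geod \<phi> K k t"
proof -
  define a1 where "a1 = (a + T) / 2"
  have a1: "a < a1" "a1 < T" using aT by (auto simp: a1_def)
  have "\<exists>C (R :: real^3 \<Rightarrow> real^3). C \<ge> 0 \<and> (\<forall>\<delta>. \<exists>l. reach (geod \<phi> K k a) (dev_point \<phi> K k a1 0 \<delta>) l \<and>
        2 * l \<le> 2 * (a1 - a) + K * (k \<bullet> \<delta>) + C * ((norm \<delta>)\<^sup>2 + norm (R \<delta>)))
      \<and> bounded_linear R \<and> (\<forall>v. norm (R v) \<le> norm v) \<and> (\<forall>u t. R (area u (dir \<phi> K k t)) = 0)"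
  proof (cases "\<exists>t0\<in>{a..a1}. cos (\<phi> + K * t0) \<noteq> 0")
    case True
    then obtain t0 where "t0 \<in> {a..a1}" "cos (\<phi> + K * t0) \<noteq> 0" by blast
    from vertical_correction[OF k a1(1) this] obtain C where "C \<ge> 0"
      "\<And>\<delta>. \<exists>l. reach (geod \<phi> K k a) (dev_point \<phi> K k a1 0 \<delta>) l \<and>
        2 * l \<le> 2 * (a1 - a) + K * (k \<bullet> \<delta>) + C * (norm \<delta>)\<^sup>2" by metis
    then show ?thesis
      by (intro exI[of _ C] exI[of _ "\<lambda>_. 0 :: real^3"]) simp
  next
    case False
    then have z: "\<And>t. t \<in> {a..a1} \<Longrightarrow> cos (\<phi> + K * t) = 0" by blast
    have c: "K = 0" "cos \<phi> = 0" "(sin \<phi>)\<^sup>2 = 1"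
      using cos_affine_eq_0[OF a1(1), of \<phi> K] z by blast+
    define R where "R = (\<lambda>v. v - (k \<bullet> v) *\<^sub>R k)"
    obtain C where C: "C \<ge> 0" "\<And>\<delta>. \<exists>l. reach (geod \<phi> 0 k a) (dev_point \<phi> 0 k a1 0 \<delta>) l \<and>
        2 * l \<le> 2 * (a1 - a) + C * ((norm \<delta>)\<^sup>2 + norm (R \<delta>))"
      using vertical_correction_singular[OF k a1(1) c(2,3)] unfolding R_def by metis
    have "bounded_linear R"
      unfolding R_def
      by (intro bounded_linear_sub bounded_linear_ident bounded_linear_scaleR_const bounded_linear_inner_right)
    moreover have "norm (R v) \<le> norm v" for v
    proof -
      have kk: "k \<bullet> k = 1" using k by (simp add: norm_eq_1)
      have "(norm (R v))\<^sup>2 = (norm v)\<^sup>2 - (k \<bullet> v)\<^sup>2"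
        unfolding R_def power2_norm_eq_inner power2_eq_square[of "k \<bullet> v"]
        by (simp add: inner_diff_left inner_diff_right inner_commute kk)
      then have "(norm (R v))\<^sup>2 \<le> (norm v)\<^sup>2" by simp
      then show ?thesis by (rule power2_le_imp_le) simp
    qed
    moreover have "R (area u (dir \<phi> K k t)) = 0" for u t
    proof -
      have "k \<bullet> k = 1" using k by (simp add: norm_eq_1)
      then show ?thesis by (simp add: R_def area_def dir_def c(1,2))
    qed
    ultimately show ?thesis
      using C unfolding c(1) by (intro exI[of _ C] exI[of _ R]) simp
  qed
  then obtain C and R :: "real^3 \<Rightarrow> real^3" where C: "C \<ge> 0" "\<And>\<delta>. \<exists>l. reach (geod \<phi> K k a) (dev_point \<phi> K k a1 0 \<delta>) l \<and>
        2 * l \<le> 2 * (a1 - a) + K * (k \<bullet> \<delta>) + C * ((norm \<delta>)\<^sup>2 + norm (R \<delta>))"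
    and R: "bounded_linear R" "\<And>v. norm (R v) \<le> norm v" "\<And>u t. R (area u (dir \<phi> K k t)) = 0"
    by blast
  \<comment> \<open>\<open>B\<close> dominates the constant of the estimate for every extension by at most \<open>1\<close>, so that the length
     of the extension can be chosen after it.\<close>
  define B where "B = K + C * ((4 + 2 * (T + 1 - a1))\<^sup>2 + 1) + 1 / (T - a1)"
  have B: "B > 0" unfolding B_def using K C(1) a1 by (simp add: add_nonneg_pos)
  define r where "r = min (min 1 (b - T)) (1 / (2 * B))"
  have r: "r > 0" "r \<le> 1" "T + r \<le> b" "r * B < 1"
  proof -
    have "r * B \<le> 1 / (2 * B) * B" by (rule mult_right_mono) (use B in \<open>auto simp: r_def\<close>)
    then show "r * B < 1" using B by simp
  qed (use B aT in \<open>auto simp: r_def\<close>)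
  have small: "(T + r - T) * (K + C * ((4 + 2 * (T + r - a1))\<^sup>2 + 1) + 1 / (T - a1)) < 1"
  proof -
    have "(4 + 2 * (T + r - a1))\<^sup>2 \<le> (4 + 2 * (T + 1 - a1))\<^sup>2"
      by (rule power_mono) (use r a1 in auto)
    then have "C * ((4 + 2 * (T + r - a1))\<^sup>2 + 1) \<le> C * ((4 + 2 * (T + 1 - a1))\<^sup>2 + 1)"
      using C(1) by (intro mult_left_mono) auto
    then have "r * (K + C * ((4 + 2 * (T + r - a1))\<^sup>2 + 1) + 1 / (T - a1)) \<le> r * B"
      unfolding B_def using r by (intro mult_left_mono) auto
    also have "\<dots> < 1" by fact
    finally show ?thesis by simp
  qed
  have m': "length_minimizing \<gamma> a (T + r)"
    by (rule length_minimizing_mono[OF m]) (use r aT in auto)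
  have "\<gamma> t = geod \<phi> K k t" if "t \<in> {T..T + r}" for t
    by (rule extension_estimate[OF k K m' a1 _ _ eq N(1) _ C R small that])
      (use r N(2) in auto)
  then show ?thesis using that r by blast
qed

section \<open>Cut times\<close>

lemma circle_curve_eq_geod:
  assumes K: "K > 0" "K\<^sup>2 * (C1\<^sup>2 + C2\<^sup>2) = 1" and \<phi>: "K * C2 = cos \<phi>" "K * C1 = sin \<phi>"
  shows "circle_curve C1 C2 K k = geod \<phi> K k"
proof
  fix t
  have C: "C2 = cos \<phi> / K" "C1 = sin \<phi> / K" using \<phi> K(1) by (auto simp: field_simps)
  have v: "(C1\<^sup>2 + C2\<^sup>2) = 1 / K\<^sup>2" using K by (simp add: field_simps)
  have 1: "C1 * (cos (K * t) - 1) + C2 * sin (K * t) = (sin (\<phi> + K * t) - sin \<phi>) / K"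
    using K(1) by (simp add: C sin_add field_simps)
  have 2: "C1 * sin (K * t) + C2 * (1 - cos (K * t)) = (cos \<phi> - cos (\<phi> + K * t)) / K"
    using K(1) by (simp add: C cos_add field_simps)
  show "circle_curve C1 C2 K k t = geod \<phi> K k t"
    using K(1) unfolding circle_curve_def geod_def 1 2 v by simp
qed

lemma circle_curve_angle:
  fixes C1 C2 K :: real
  assumes "K\<^sup>2 * (C1\<^sup>2 + C2\<^sup>2) = 1"
  obtains \<phi> where "K * C2 = cos \<phi>" "K * C1 = sin \<phi>"
proof -
  have "(K * C2)\<^sup>2 + (K * C1)\<^sup>2 = 1" using assms by (simp add: power_mult_distrib algebra_simps)
  then show ?thesis using sincos_total_2pi that by metis
qed

lemma geod_in_C_n: "geod \<phi> K k t \<in> C_n"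
proof -
  obtain x a b where p: "geod \<phi> K k t = (x, a *\<^sub>R k, b *\<^sub>R k)"
  proof (cases "K = 0")
    case True
    then have "geod \<phi> K k t = (t * cos \<phi>, (t * sin \<phi>) *\<^sub>R k, 0 *\<^sub>R k)" by (simp add: geod_def)
    then show ?thesis by (rule that)
  next
    case False
    then have "geod \<phi> K k t = ((sin (\<phi> + K * t) - sin \<phi>) / K, ((cos \<phi> - cos (\<phi> + K * t)) / K) *\<^sub>R k,
           ((K * t - sin (K * t)) / (2 * K\<^sup>2)) *\<^sub>R k)" by (simp add: geod_def)
    then show ?thesis by (rule that)
  qed
  have "\<exists>\<alpha> \<beta>. (\<alpha>, \<beta>) \<noteq> (0, 0) \<and> \<alpha> *\<^sub>R (a *\<^sub>R k) + \<beta> *\<^sub>R (b *\<^sub>R k) = 0"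
  proof (cases "a = 0 \<and> b = 0")
    case True
    then show ?thesis by (intro exI[of _ 1]) simp
  next
    case False
    then show ?thesis by - (rule exI[of _ b], rule exI[of _ "- a"], auto simp: mult.commute)
  qed
  then show ?thesis unfolding p C_n_def by simp
qed

lemma AE_lebesgue_on_subset:
  assumes "AE t in lebesgue_on {0::real..}. P t" "a \<ge> 0"
  shows "AE t in lebesgue_on {a..b}. P t"
proof -
  have "AE t in lebesgue. t \<in> {0..} \<longrightarrow> P t"
    using assms(1) by (simp add: AE_restrict_space_iff)
  then have "AE t in lebesgue. t \<in> {a..b} \<longrightarrow> P t"
    by eventually_elim (use assms(2) in auto)
  then show ?thesis by (simp add: AE_restrict_space_iff)
qed

lemma speed_geod:
  assumes "norm k = 1" shows "speed (geod \<phi> K k) t = 1"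
proof -
  have v: "vector_derivative (geod \<phi> K k) (at t) = geod_vel \<phi> K k t"
    by (rule vector_derivative_at[OF geod_has_vector_derivative])
  have "geod_vel \<phi> K k t \<in> distrib_N (geod \<phi> K k t)"
    by (simp add: distrib_N_iff vert_geod_vel)
  then show ?thesis using assms by (simp add: speed_def v sr_metric_self)
qed

lemma geod_is_geodesic_in_C_n:
  assumes k: "norm k = 1" and K: "0 \<le> K"
  shows "geodesic_in_C_n (geod \<phi> K k)"
proof -
  have sp: "AE t in lebesgue_on {0..}. speed (geod \<phi> K k) t = 1" using speed_geod[OF k] by simp
  have "\<exists>\<epsilon>>0. \<forall>a b. 0 \<le> a \<and> t - \<epsilon> \<le> a \<and> a \<le> b \<and> b \<le> t + \<epsilon> \<longrightarrow> length_minimizing (geod \<phi> K k) a b" for t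
    \<comment> \<open>Any interval shorter than a full turn would do; this choice covers \<open>K = 0\<close> as well.\<close>
  proof (intro exI[of _ "1 / (K + 1)"] conjI allI impI)
    fix a b assume ab: "0 \<le> a \<and> t - 1 / (K + 1) \<le> a \<and> a \<le> b \<and> b \<le> t + 1 / (K + 1)"
    have "K * (b - a) \<le> K * (2 / (K + 1))" using ab K by (intro mult_left_mono) auto
    also have "\<dots> \<le> 2" using K by (simp add: field_simps)
    also have "\<dots> < 2 * pi" using pi_gt3 by simp
    finally show "length_minimizing (geod \<phi> K k) a b"
      using geod_minimizing[OF k K] ab by blast
  qed (use K in simp)
  then show ?thesis
    unfolding geodesic_in_C_n_def arclength_geodesic_def sr_geodesic_def
    using sp hcurve_admissible[OF hcurve_geod] geod_in_C_n by auto
qed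

text \<open>
  All arcs with the same \<open>K\<close> and \<open>k\<close> meet after a full turn, whatever their initial angle. If the longer arc
  were minimizing, then so would be the curve that makes its first turn with the opposite initial angle; but this curve
  has a corner.
\<close>
lemma geod_not_minimizing:
  assumes k: "norm k = 1" and K: "0 < K" and T: "2 * pi / K < T"
  shows "\<not> length_minimizing (geod \<phi> K k) 0 T"
proof
  assume m: "length_minimizing (geod \<phi> K k) 0 T"
  let ?\<gamma> = "geod \<phi> K k" and ?\<eta> = "geod (\<phi> + pi) K k"
  define P where "P = 2 * pi / K"
  have P: "0 < P" "P < T" "K * P = 2 * pi" using K T by (auto simp: P_def)
  have end_eq: "?\<eta> P = ?\<gamma> P"
  proof -
    have "sin (\<phi> + pi + K * P) = - sin \<phi>" "cos (\<phi> + pi + K * P) = - cos \<phi>"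
      "sin (\<phi> + K * P) = sin \<phi>" "cos (\<phi> + K * P) = cos \<phi>"
      unfolding P(3) sin_periodic cos_periodic by simp_all
    then show ?thesis using K by (simp add: geod_def)
  qed
  let ?\<rho> = "\<lambda>t. if t \<le> P then ?\<eta> t else ?\<gamma> t" and ?\<rho>' = "\<lambda>t. if t \<le> P then geod_vel (\<phi> + pi) K k t else geod_vel \<phi> K k t"
  note h = hcurve_concat[OF hcurve_geod hcurve_geod end_eq, of 0 T]
  have h1: "hcurve ?\<rho> ?\<rho>' 0 T" using h(1) P by simp
  have len: "sr_length ?\<rho> 0 T = sr_length ?\<gamma> 0 T"
    using h(2) P length_geod[OF k] by simp
  have mr: "length_minimizing ?\<rho> 0 T"
    unfolding length_minimizing_iff
  proof (intro conjI hcurve_admissible[OF h1])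
    have "?\<rho> 0 = ?\<gamma> 0" "?\<rho> T = ?\<gamma> T" using P by simp_all
    then show "\<forall>l. reach (?\<rho> 0) (?\<rho> T) l \<longrightarrow> sr_length ?\<rho> 0 T \<le> l"
      unfolding len using m unfolding length_minimizing_iff by simp
  qed
  obtain N where N: "negligible N" "\<And>t. t \<in> {0..T} - N \<Longrightarrow> hvel ?\<rho> t = plane (?\<rho>' t)"
    by (rule hcurve_hvel[OF h1]) (rule that)
  have N': "norm (hvel ?\<rho> t) = 1" if "t \<in> {0..T} - N" for t
    using N(2)[OF that] k by simp
  have eqP: "\<And>t. t \<in> {0..P} \<Longrightarrow> ?\<rho> t = geod (\<phi> + pi) K k t" by simp
  obtain r where r: "r > 0" "P + r \<le> T" and
    eq: "\<And>t. t \<in> {P..P + r} \<Longrightarrow> ?\<rho> t = geod (\<phi> + pi) K k t"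
    by (rule geod_extension[OF k less_imp_le[OF K] mr P(1,2) eqP N(1) N']) (assumption | rule that)+
  define s where "s = min r (1 / K)"
  have s: "0 < s" "s \<le> r" "K * s \<le> 1" using r K by (auto simp: s_def min_def field_simps)
  have "?\<gamma> (P + s) = ?\<eta> (P + s)" using eq[of "P + s"] s by simp
  then have ends: "fst (?\<gamma> (P + s)) = fst (?\<eta> (P + s))" "fst (snd (?\<gamma> (P + s))) = fst (snd (?\<eta> (P + s)))"
    by simp_all
  have k0: "k \<noteq> 0" using k by auto
  have per: "\<phi> + K * (P + s) = (\<phi> + K * s) + 2 * pi" "\<phi> + pi + K * (P + s) = ((\<phi> + K * s) + pi) + 2 * pi"
    using P(3) by (simp_all add: algebra_simps)
  have v: "sin (\<phi> + K * (P + s)) = sin (\<phi> + K * s)" "cos (\<phi> + K * (P + s)) = cos (\<phi> + K * s)"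
    "sin (\<phi> + pi + K * (P + s)) = - sin (\<phi> + K * s)" "cos (\<phi> + pi + K * (P + s)) = - cos (\<phi> + K * s)"
    unfolding per sin_periodic cos_periodic by simp_all
  have "sin (\<phi> + K * s) - sin \<phi> = - sin (\<phi> + K * s) + sin \<phi>"
    using ends(1) K by (simp add: geod_def v)
  moreover have "cos \<phi> - cos (\<phi> + K * s) = - cos \<phi> + cos (\<phi> + K * s)"
    using ends(2) K k0 by (simp add: geod_def v)
  ultimately have "sin (\<phi> + K * s) = sin \<phi>" "cos (\<phi> + K * s) = cos \<phi>" by simp_all
  then have "cos (K * s) = (cos \<phi>)\<^sup>2 + (sin \<phi>)\<^sup>2"
    using cos_diff[of "\<phi> + K * s" \<phi>] by (simp add: power2_eq_square)
  then have "cos (K * s) = 1" by simp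
  moreover have "cos (K * s) < cos 0"
    by (rule cos_monotone_0_pi) (use s K pi_gt3 in auto)
  ultimately show False by simp
qed

lemma cut_time_geod:
  assumes k: "norm k = 1" and K: "0 < K"
  shows "cut_time (geod \<phi> K k) = ereal (2 * pi / K)"
proof -
  let ?S = "{ereal t |t. 0 < t \<and> length_minimizing (geod \<phi> K k) 0 t}"
  have "length_minimizing (geod \<phi> K k) 0 (2 * pi / K)"
  proof (rule length_minimizing_closed)
    show "admissible (geod \<phi> K k) 0 (2 * pi / K)" by (rule hcurve_admissible[OF hcurve_geod]) (use K in simp)
    show "length_minimizing (geod \<phi> K k) 0 t" if "0 < t" "t < 2 * pi / K" for t
      by (rule geod_minimizing[OF k]) (use that K in \<open>auto simp: field_simps\<close>)
  qed (use K in simp)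
  then have "ereal (2 * pi / K) \<in> ?S" using K by (auto intro!: exI[of _ "2 * pi / K"])
  moreover have "x \<le> ereal (2 * pi / K)" if "x \<in> ?S" for x
    using that geod_not_minimizing[OF k K] by (auto simp: not_less[symmetric])
  ultimately show ?thesis
    unfolding cut_time_def by (intro antisym Sup_least Sup_upper) auto
qed

lemma geod_at_cut_time:
  assumes "K > 0" shows "geod \<phi> K k (2 * pi / K) = (0, 0, (pi / K\<^sup>2) *\<^sub>R k)"
  using assms by (simp add: geod_def)

text \<open>
  If the plane part of \<open>\<gamma> T\<close> did not vanish, then \<open>\<gamma> T\<close> would be the end point of an arc of less than a full
  turn in a Heisenberg subgroup. By uniqueness \<open>\<gamma>\<close> is that arc up to \<open>T\<close>, it remains so slightly beyond \<open>T\<close>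
  because it is locally minimizing at \<open>T\<close>, and there the arc still makes less than a full turn and is minimizing.
\<close>
lemma cut_point_vertical:
  assumes g: "geodesic_in_C_n \<gamma>" and cut: "cut_time \<gamma> = ereal T"
  shows "\<exists>y. y \<noteq> 0 \<and> \<gamma> T = (0, 0, y)"
proof -
  have \<gamma>0: "\<gamma> 0 = (0, 0, 0)" and Cn: "\<And>t. t \<ge> 0 \<Longrightarrow> \<gamma> t \<in> C_n"
    and adm: "\<And>t. t \<ge> 0 \<Longrightarrow> admissible \<gamma> 0 t" and sp: "AE t in lebesgue_on {0..}. speed \<gamma> t = 1"
    and loc: "\<And>t. t \<ge> 0 \<Longrightarrow> \<exists>\<epsilon>>0. \<forall>a b. 0 \<le> a \<and> t - \<epsilon> \<le> a \<and> a \<le> b \<and> b \<le> t + \<epsilon> \<longrightarrow> length_minimizing \<gamma> a b"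
    using g unfolding geodesic_in_C_n_def arclength_geodesic_def sr_geodesic_def by auto
  let ?S = "{ereal t |t. 0 < t \<and> length_minimizing \<gamma> 0 t}"
  have upper: "t \<le> T" if "0 < t" "length_minimizing \<gamma> 0 t" for t
  proof -
    have "ereal t \<le> Sup ?S" using that by (intro Sup_upper) auto
    then show ?thesis using cut by (simp add: cut_time_def)
  qed
  obtain \<epsilon>0 where "\<epsilon>0 > 0" "length_minimizing \<gamma> 0 \<epsilon>0" using loc[of 0] by force
  then have T: "T > 0" using upper[of \<epsilon>0] by simp
  have below: "length_minimizing \<gamma> 0 t" if "0 < t" "t < T" for t
  proof -
    have "ereal t < Sup ?S" using that cut by (simp add: cut_time_def)
    then obtain t' where "t < t'" "length_minimizing \<gamma> 0 t'"
      unfolding less_Sup_iff by auto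
    then show ?thesis using length_minimizing_mono[of \<gamma> 0 t' 0 t] that by simp
  qed
  have minT: "length_minimizing \<gamma> 0 T"
    by (rule length_minimizing_closed[OF adm T below]) (use T in auto)
  have unit: "\<exists>N. negligible N \<and> (\<forall>t\<in>{a..b} - N. norm (hvel \<gamma> t) = 1)" if "0 \<le> a" "a \<le> b" for a b
    using admissible_unit_speed[OF sr_length_split(2)[OF adm[of b] that] AE_lebesgue_on_subset[OF sp that(1)]] that
    by (metis order_trans)
  obtain N where N: "negligible N" "\<And>t. t \<in> {0..T} - N \<Longrightarrow> norm (hvel \<gamma> t) = 1"
    using unit[of 0 T] T by auto
  have lenT: "sr_length \<gamma> 0 T = T"
  proof (rule has_integral_unique[OF sr_length_has_integral(2)[OF adm]])
    have "((\<lambda>_. 1 :: real) has_integral T) {0..T}"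
      using has_integral_const_real[of "1 :: real" 0 T] T by simp
    then show "((\<lambda>t. norm (hvel \<gamma> t)) has_integral T) {0..T}"
      by (rule has_integral_spike[OF N(1), rotated]) (simp add: N(2))
  qed (use T in simp)
  obtain k x a b where k: "norm k = 1" and p: "\<gamma> T = (x, a *\<^sub>R k, b *\<^sub>R k)"
    using C_n_direction[OF Cn[OF less_imp_le[OF T]]] by blast
  have "(x, a) = (0, 0)"
  proof (rule ccontr)
    assume "(x, a) \<noteq> (0, 0)"
    then obtain \<phi> K s k' where k': "norm k' = 1" and K: "0 \<le> K" and s: "0 \<le> s" "K * s < 2 * pi"
      and gs: "geod \<phi> K k' s = (x, a *\<^sub>R k, b *\<^sub>R k)"
      using geod_exists[OF _ k] by metis
    have \<gamma>T: "\<gamma> T = geod \<phi> K k' s" using p gs by simp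
    have "T = s" by (rule geod_unique_minimizer(1)[OF k' K s(2,1) minT \<gamma>0 \<gamma>T N T])
    then have KT: "K * T < 2 * pi" using s by simp
    have eq: "\<gamma> t = geod \<phi> K k' t" if "t \<in> {0..T}" for t
      by (rule geod_unique_minimizer(2)[OF k' K s(2,1) minT \<gamma>0 \<gamma>T N T that])
    obtain \<epsilon> where \<epsilon>: "\<epsilon> > 0" "\<And>a b. 0 \<le> a \<Longrightarrow> T - \<epsilon> \<le> a \<Longrightarrow> a \<le> b \<Longrightarrow> b \<le> T + \<epsilon> \<Longrightarrow> length_minimizing \<gamma> a b"
      using loc[of T] T by auto
    define c where "c = max 0 (T - \<epsilon>)"
    have c: "0 \<le> c" "c < T" using T \<epsilon>(1) by (auto simp: c_def)
    have mc: "length_minimizing \<gamma> c (T + \<epsilon>)" by (rule \<epsilon>(2)) (use \<epsilon>(1) c in \<open>auto simp: c_def\<close>)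
    obtain M where M: "negligible M" "\<And>t. t \<in> {c..T + \<epsilon>} - M \<Longrightarrow> norm (hvel \<gamma> t) = 1"
      using unit[of c "T + \<epsilon>"] c \<epsilon>(1) by auto
    have eqc: "\<And>t. t \<in> {c..T} \<Longrightarrow> \<gamma> t = geod \<phi> K k' t" using eq c by auto
    have T\<epsilon>: "T < T + \<epsilon>" using \<epsilon>(1) by simp
    obtain r where r: "r > 0" and eqr: "\<And>t. t \<in> {T..T + r} \<Longrightarrow> \<gamma> t = geod \<phi> K k' t"
      by (rule geod_extension[OF k' K mc c(2) T\<epsilon> eqc M]) (assumption | rule that)+
    have "\<exists>q>0. q \<le> r \<and> K * (T + q) < 2 * pi"
    proof (cases "K = 0")
      case False
      then have K': "K > 0" using K by simp
      define q where "q = min r ((2 * pi - K * T) / (2 * K))"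
      have "q > 0" "q \<le> r" using r K' KT by (auto simp: q_def)
      moreover have "K * q \<le> (2 * pi - K * T) / 2"
        using K' by (simp add: q_def min_def field_simps)
      then have "K * (T + q) < 2 * pi" using KT by (simp add: distrib_left)
      ultimately show ?thesis by blast
    qed (use r in auto)
    then obtain q where q: "q > 0" "q \<le> r" "K * (T + q) < 2 * pi" by blast
    have "length_minimizing \<gamma> 0 (T + q)"
    proof (rule length_minimizing_cong)
      show "length_minimizing (geod \<phi> K k') 0 (T + q)"
        by (rule geod_minimizing[OF k' K]) (use q T in auto)
      show "\<gamma> t = geod \<phi> K k' t" if "t \<in> {0..T + q}" for t
        using eq[of t] eqr[of t] that q by (cases "t \<le> T") auto
    qed
    then show False using upper[of "T + q"] q T by simp
  qed
  then have p: "\<gamma> T = (0, 0, b *\<^sub>R k)" using p by simp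
  moreover have "b *\<^sub>R k \<noteq> 0"
  proof
    assume "b *\<^sub>R k = 0"
    then have "\<gamma> T = \<gamma> 0" using p \<gamma>0 by simp
    then have "reach (\<gamma> 0) (\<gamma> T) 0" by (simp add: reach_refl)
    then have "T \<le> 0" using minT lenT by (simp add: length_minimizing_iff)
    then show False using T by simp
  qed
  ultimately show ?thesis by blast
qed

lemma vertical_point_geod:
  fixes y :: "real^3"
  assumes "y \<noteq> 0"
  obtains k K where "norm k = 1" "K > 0" "\<And>\<phi>. geod \<phi> K k (2 * pi / K) = (0, 0, y)"
proof -
  define k where "k = y /\<^sub>R norm y"
  define K where "K = sqrt (pi / norm y)"
  have K: "K > 0" "pi / K\<^sup>2 = norm y" using assms by (simp_all add: K_def)
  have "norm k = 1" "norm y *\<^sub>R k = y" using assms by (simp_all add: k_def)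
  then show ?thesis using that[of k K] K geod_at_cut_time by simp
qed

theorem theorem2:
  "{p. \<exists>\<gamma>. geodesic_in_C_n \<gamma> \<and> loses_optimality_at \<gamma> p} =
     {p \<in> C_n. \<exists>y. y \<noteq> 0 \<and> p = (0, 0, y)}
   \<and> (\<forall>p\<in>{p \<in> C_n. \<exists>y. y \<noteq> 0 \<and> p = (0, 0, y)}. maxwell_point p)
   \<and> (\<forall>C1 C2 K :: real. \<forall>k :: real^3.
        (C1, C2) \<noteq> (0, 0) \<and> norm k = 1 \<and> K > 0 \<and> K\<^sup>2 * (C1\<^sup>2 + C2\<^sup>2) = 1 \<longrightarrow>
          geodesic_in_C_n (circle_curve C1 C2 K k) \<and>
          cut_time (circle_curve C1 C2 K k) = ereal (2 * pi * sqrt (C1\<^sup>2 + C2\<^sup>2)))"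
proof (intro conjI)
  show "{p. \<exists>\<gamma>. geodesic_in_C_n \<gamma> \<and> loses_optimality_at \<gamma> p} =
     {p \<in> C_n. \<exists>y. y \<noteq> 0 \<and> p = (0, 0, y)}"
  proof (intro set_eqI iffI)
    fix p assume "p \<in> {p. \<exists>\<gamma>. geodesic_in_C_n \<gamma> \<and> loses_optimality_at \<gamma> p}"
    then obtain \<gamma> T where "geodesic_in_C_n \<gamma>" "cut_time \<gamma> = ereal T" "p = \<gamma> T"
      unfolding loses_optimality_at_def by blast
    then obtain y where "y \<noteq> 0" "p = (0, 0, y)" using cut_point_vertical by metis
    moreover have "\<exists>\<alpha> \<beta> :: real. (\<alpha>, \<beta>) \<noteq> (0, 0) \<and> \<alpha> *\<^sub>R (0 :: real^3) + \<beta> *\<^sub>R y = 0"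
      by (rule exI[of _ 1], rule exI[of _ 0]) simp
    ultimately show "p \<in> {p \<in> C_n. \<exists>y. y \<noteq> 0 \<and> p = (0, 0, y)}"
      by (simp add: C_n_def)
  next
    fix p :: carnot assume "p \<in> {p \<in> C_n. \<exists>y. y \<noteq> 0 \<and> p = (0, 0, y)}"
    then obtain y where y: "y \<noteq> 0" "p = (0, 0, y)" by blast
    obtain k K where k: "norm k = 1" "K > 0" "\<And>\<phi>. geod \<phi> K k (2 * pi / K) = (0, 0, y)"
      using vertical_point_geod[OF y(1)] by metis
    have "geodesic_in_C_n (geod 0 K k)" using geod_is_geodesic_in_C_n k by simp
    moreover have "loses_optimality_at (geod 0 K k) p"
      unfolding loses_optimality_at_def using cut_time_geod[OF k(1,2)] k(3) y by metis
    ultimately show "p \<in> {p. \<exists>\<gamma>. geodesic_in_C_n \<gamma> \<and> loses_optimality_at \<gamma> p}" by blast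
  qed
next
  show "\<forall>p\<in>{p \<in> C_n. \<exists>y. y \<noteq> 0 \<and> p = (0, 0, y)}. maxwell_point p"
  proof
    fix p :: carnot assume "p \<in> {p \<in> C_n. \<exists>y. y \<noteq> 0 \<and> p = (0, 0, y)}"
    then obtain y where y: "y \<noteq> 0" "p = (0, 0, y)" by blast
    obtain k K where k: "norm k = 1" "K > 0" "\<And>\<phi>. geod \<phi> K k (2 * pi / K) = (0, 0, y)"
      using vertical_point_geod[OF y(1)] by metis
    let ?\<gamma> = "geod 0 K k" and ?\<eta> = "geod pi K k" and ?T = "2 * pi / K"
    have "arclength_geodesic ?\<gamma>" "arclength_geodesic ?\<eta>"
      using geod_is_geodesic_in_C_n[OF k(1)] k(2) unfolding geodesic_in_C_n_def by auto
    moreover have "?T > 0" using k by simp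
    moreover have "sr_length ?\<gamma> 0 ?T = sr_length ?\<eta> 0 ?T"
      using length_geod[OF k(1)] k(2) by simp
    moreover have "?\<gamma> (pi / K) \<noteq> ?\<eta> (pi / K)"
    proof
      assume "?\<gamma> (pi / K) = ?\<eta> (pi / K)"
      then have "k \<bullet> fst (snd (?\<gamma> (pi / K))) = k \<bullet> fst (snd (?\<eta> (pi / K)))" by simp
      moreover have "k \<bullet> k = 1" using k(1) by (simp add: norm_eq_1)
      ultimately show False using k(2) by (simp add: geod_def)
    qed
    then have "\<exists>t\<in>{0..?T}. ?\<gamma> t \<noteq> ?\<eta> t"
      using k by (intro bexI[of _ "pi / K"]) (auto simp: field_simps)
    ultimately show "maxwell_point p"
      unfolding maxwell_point_def using k(3) y(2)
      by - (rule exI[of _ ?\<gamma>], rule exI[of _ ?\<eta>], rule exI[of _ ?T], simp)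
  qed
next
  show "\<forall>C1 C2 K :: real. \<forall>k :: real^3.
        (C1, C2) \<noteq> (0, 0) \<and> norm k = 1 \<and> K > 0 \<and> K\<^sup>2 * (C1\<^sup>2 + C2\<^sup>2) = 1 \<longrightarrow>
          geodesic_in_C_n (circle_curve C1 C2 K k) \<and>
          cut_time (circle_curve C1 C2 K k) = ereal (2 * pi * sqrt (C1\<^sup>2 + C2\<^sup>2))"
  proof (intro allI impI)
    fix C1 C2 K :: real and k :: "real^3"
    assume H: "(C1, C2) \<noteq> (0, 0) \<and> norm k = 1 \<and> K > 0 \<and> K\<^sup>2 * (C1\<^sup>2 + C2\<^sup>2) = 1"
    then obtain \<phi> where \<phi>: "K * C2 = cos \<phi>" "K * C1 = sin \<phi>" using circle_curve_angle by metis
    have eq: "circle_curve C1 C2 K k = geod \<phi> K k" using circle_curve_eq_geod H \<phi> by blast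
    have "C1\<^sup>2 + C2\<^sup>2 = (1 / K)\<^sup>2" using H by (simp add: field_simps)
    then have "sqrt (C1\<^sup>2 + C2\<^sup>2) = 1 / K" using H by (simp add: real_sqrt_divide)
    then show "geodesic_in_C_n (circle_curve C1 C2 K k) \<and>
          cut_time (circle_curve C1 C2 K k) = ereal (2 * pi * sqrt (C1\<^sup>2 + C2\<^sup>2))"
      unfolding eq using geod_is_geodesic_in_C_n cut_time_geod H by simp
  qed
qed

end
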